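(* Let $K\subset S^3$ be a knot with open tubular neighbourhood $\overline K$, and let $\triangle$ be an ideal triangulation of $S^3\setminus\overline K$ with $n$ tetrahedra. Let $\mathcal I_\triangle(K)\subset\mathbb C_q[M^{\pm1},L^{\pm1}]$ be the localised quantum $A$-ideal, let $\mathbb W^{inv}_\triangle\supset\mathbb C_q[M^{\pm1},L^{\pm1}]$ be the invariant quantum torus of $\triangle$, and let $\mathcal I_{bulk}$ and $\mathcal I_{thr}$ be the left ideal of tetrahedron (bulk) relations and the right ideal of thread relations in $\mathbb W^{inv}_\triangle$ (all described in the context). Then there is an equality of left ideals $$\mathcal I_\triangle(K)=\mathbb C_q[M^{\pm1},L^{\pm1}]\cap\left(\mathcal I_{thr}+\mathcal I_{bulk}\right)$$ between the localised quantum $A$-ideal and the joint elimination ideal of the tetrahedron relations and thread relations.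
   Context: **Coefficients.** Work over $\mathbb C(q)$ with $q^{1/2}$ adjoined, $q$ generic. $G=\mathrm{SL}_2$, $B$ is the upper triangular Borel, $T=B/(B,B)\cong\mathbb C^\times$. $\mathrm{Rep}_qG$ and $\mathrm{Rep}_qT$ are the ribbon categories of integral representations of $U_q\mathfrak{sl}_2$ and $U_q\mathfrak t$; $V(m)$ denotes the simple objects of $\mathrm{Rep}_qG$. $\mathrm{Rep}_qB$ is the category of locally finite integral weight representations of $U_q\mathfrak b=\langle E,K^{\pm1}\rangle$. It is central over $\mathrm{Rep}_qG\boxtimes(\mathrm{Rep}_qT)^{bop}$ via $V\boxtimes\chi\mapsto i^*V\otimes\pi^*\chi$, where $i:U_q\mathfrak b\to U_q\mathfrak g$ is the inclusion and $\pi:U_q\mathfrak b\to U_q\mathfrak t$ kills $E$, with half-braiding $\sigma_{(123)}\mathcal R^G_{13}(\mathcal R^T_{32})^{-1}$. **Parabolic skeins.** A bipartite 3-manifold or surface is an oriented manifold divided into open $G$- and $T$-regions by an embedded codimension-one $B$-defect. Its skein module $\mathrm{SkMod}$ is spanned by isotopy classes of stratified ribbon graphs coloured by $\mathrm{Rep}_qG$ and $\mathrm{Rep}_qT$ in the respective regions and crossing the defect transversely at coupons coloured by morphisms of $\mathrm{Rep}_qB$, modulo the local relations given by graphical evaluation in these categories (near a defect, first project to the defect, replacing crossings by half-braidings). Gates are chosen disjoint intervals or disks in the boundary where skeins may end. The internal skein module sends a label $V$ of the gates to the skein module with boundary label $V$ at the gates. $\mathrm{SkAlg}^{int}(\Sigma)$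 is the internal skein module of $\Sigma\times[0,1]$, an algebra by stacking. The skein algebra of the $T$-coloured torus is $\mathbb C_q[M^{\pm1},L^{\pm1}]=\langle M^{\pm1},L^{\pm1}\mid LM=qML\rangle$, with $M,L$ the meridian and longitude. **The surface $\Sigma_\triangle$.** Stratify $S^3\setminus\overline K$ by a defect torus parallel to the boundary, with the collar $T^2\times I$ of the boundary as $T$-region and the rest as $G$-region. Let $M_\triangle$ be the complement in $S^3$ of a tubular neighbourhood of $K$ together with the edges of $\triangle$, with the induced stratification, and $\Sigma_\triangle=\partial M_\triangle$. It has genus $n+1$: a $T$-coloured torus with $n$ $G$-coloured annular handles, one for each of the $n$ edges of $\triangle$. It is punctured in the $T$-region once for each vertex of each tetrahedron ($4n$ punctures), with three gates on each puncture. For tetrahedron $i$ with vertices $0,1,2,3$ (numbered compatibly with orientation), $v_{ipe}$ is the gate at puncture $p$ facing vertex $e\neq p$. The long edge $A_{ijk}$ ($j<k$) is the skein labelled by the fundamental representation joining $v_{ijk}$ to $v_{ikj}$ through the $G$-handle of that edge, of weight $+1$ at both gates. For $(p,x,y,z)$ an even permutation of $(0,1,2,3)$, the short edge $a_{ipx}$ is the $T$-region skein around puncture $p$ from $v_{ipy}$ (weight $+1$) to $v_{ipz}$ (weight $-1$). Threads are $T$-region skeins joining gates of different punctures that are identified by a face gluing of $\triangle$, of weight $+1$ at one end and $-1$ at the other. Let $S_\triangle$ be the Ore set of long edges; $\mathrm{SkAlg}^{int}(\Sigma_\triangle)[S_\triangle^{-1}]$ is a quantum torus generated by the invertible short edges,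 long edges and threads. *Lattice normalisation:* for generators with $u_iu_j=q^{c_{ij}}u_ju_i$, the lattice-normalised product of $u_1,\dots,u_m$ is $q^{-\frac12\sum_{i<j}c_{ij}}u_1\cdots u_m$. **$\mathbb W^{inv}_\triangle$.** This is the subalgebra of $\mathrm{SkAlg}^{int}(\Sigma_\triangle)[S_\triangle^{-1}]$ invariant under the tori at all $12n$ gates. It is a quantum torus generated (with some redundancy) by: - $M^{\pm1},L^{\pm1}$, the meridian and longitude; - $4n$ central puncture monodromies $\alpha_{ip}$, the $T$-region curves parallel to the punctures, where $\alpha_{ip}$ is the lattice-normalised product of the three short edges at puncture $p$ of tetrahedron $i$; - $2n$ thread monodromies $r_1,\dots,r_{2n}$, the essential closed $T$-region curves parallel to the $2n$ $B$-defect circles, each a lattice-normalised product of threads, with $|r_j|$ the number of threads; $r_{2k-1},r_{2k}$ are the two curves parallel to the two ends of one $G$-annulus; thread monodromies commute with $M$, $L$ and each other; - $n-1$ skeletal (edge-ratio) variables $Y_1,\dots,Y_{n-1}$, ratios of inequivalent long edges multiplied by threads and short edges so as to have weight zero. **The ideals.** $\mathcal I_{bulk}$ is the left ideal generated by the bulk relations $b_i$, $i=1,\dots,n$, which fill in the interiors of the tetrahedra, $$b_i=q^{5/2}(A_{i03}a_{i32}a_{i01})(A_{i12}a_{i23}a_{i10})+q^{3/2}(A_{i01}a_{i03}^{-1}a_{i12}^{-1})(A_{i23}a_{i21}^{-1}a_{i30}^{-1})+q^{3/2}A_{i13}A_{i02},$$ rescaled to weight zero as $(A_{i13}A_{i02})^{-1}b_i$.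 $\mathcal I_{thr}$ is the right ideal of relations specialising the monodromies by the character $\chi_{mon}$: $$\alpha_{ip}\mapsto q^{3/2},\qquad r_{2k-1}\mapsto q^{1/2}q^{|r_{2k-1}|/2},\qquad r_{2k}\mapsto q^{-1/2}q^{|r_{2k}|/2},$$ that is, it is generated by the differences between these monodromies and their values. The thread relations correspond to gluing $2n$ $T$-coloured thickened disks $M_{thr}=(D^2\times I)_T^{\sqcup 2n}$ along annular neighbourhoods of the curves $r_j$. **The localised quantum $A$-ideal.** The truncated tetrahedra of $\triangle$ have six long edges each. A long edge skein is a skein with its ends at a $T$-region gate that passes through the $G$-region following a long edge of $\triangle$, labelled by an arbitrary simple $V(m)$. $\mathcal I_\triangle(K)$ is defined as the sum of the annihilator ideals, in $\mathbb C_q[M^{\pm1},L^{\pm1}]$ acting by inserting skeins at the boundary torus, of the long edge skeins with arbitrary labels. It is identified with, and is to be read here as, the annihilator of the empty skein in $$\mathrm{SkMod}^{loc}(S^3\setminus\overline K):=\mathrm{SkMod}(M_{thr})\otimes_{\mathbb W_{thr}}\mathbb W^{inv}_\triangle\otimes_{\mathbb W^{inv}_\triangle}\mathrm{SkMod}(M_\triangle),\qquad \mathbb W_{thr}=\mathbb C[r_1^{\pm1},\dots,r_{2n}^{\pm1}]\subset\mathbb W^{inv}_\triangle,$$ where the localised skein module of $M_\triangle$ is presented as the quotient by the bulk relations. *)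

theory Defs
  imports
    "HOL-Homology.Homology"
    "HOL-Algebra.Algebra"
    "HOL-Algebra.Algebraic_Closure_Type"
    "HOL-Computational_Algebra.Computational_Algebra"
    "HOL-Combinatorics.Combinatorics"
begin

section \<open>Coefficients\<close>

text \<open>The field of rational functions over the complex numbers in the variable \<open>qh\<close>,
  which is the adjoined square root of \<open>q\<close>; thus \<open>q = qh ^ 2\<close> is generic.\<close>

type_synonym coeff = "complex poly fract"

definition qh :: coeff where "qh = Fract [:0, 1:] 1"

abbreviation coeff_ring :: "coeff ring" where "coeff_ring \<equiv> ring_of_type_algebra"


section \<open>Knots and ideal triangulations\<close>

definition S3 :: "(real^4) set" where "S3 = sphere 0 1"

text \<open>\<open>g m\<close> is the \<open>m\<close>-th derivative of a 1-periodic smooth embedding \<open>g 0\<close>.\<close>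

definition knot :: "(real^4) set \<Rightarrow> bool" where
  "knot K \<longleftrightarrow> (\<exists>g :: nat \<Rightarrow> real \<Rightarrow> real^4.
     (\<forall>m t. (g m has_vector_derivative g (Suc m) t) (at t)) \<and>
     (\<forall>t. g 1 t \<noteq> 0) \<and>
     (\<forall>s t. g 0 s = g 0 t \<longleftrightarrow> s - t \<in> \<int>) \<and>
     range (g 0) = K \<and> K \<subseteq> S3)"

text \<open>Each tetrahedron has vertex set the type \<open>4\<close>. If \<open>glue T i f = (j, s)\<close>, the face
  of tetrahedron \<open>i\<close> opposite to \<open>f\<close> is glued to the face of tetrahedron \<open>j\<close> opposite to
  \<open>s f\<close>, each vertex \<open>v \<noteq> f\<close> being matched with \<open>s v\<close>. The vertex numberings are
  compatible with an orientation precisely if every \<open>s\<close> is odd.\<close>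

record triangulation =
  ntet :: nat
  glue :: "nat \<Rightarrow> 4 \<Rightarrow> nat \<times> (4 \<Rightarrow> 4)"

definition oriented_gluing :: "triangulation \<Rightarrow> bool" where
  "oriented_gluing T \<longleftrightarrow> (\<forall>i<ntet T. \<forall>f. \<forall>j s. glue T i f = (j, s) \<longrightarrow>
     j < ntet T \<and> bij s \<and> \<not> evenperm s \<and> (j, s f) \<noteq> (i, f) \<and>
     (\<exists>s'. glue T j (s f) = (i, s') \<and> s' \<circ> s = id))"

definition ideal_simplex :: "(real^4) set" where
  "ideal_simplex = {t. (\<forall>v. 0 \<le> t $ v \<and> t $ v < 1) \<and> (\<Sum>v\<in>UNIV. t $ v) = 1}"

definition tetrahedra :: "triangulation \<Rightarrow> (nat \<times> (real^4)) set" where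
  "tetrahedra T = {..<ntet T} \<times> ideal_simplex"

definition face_identification :: "triangulation \<Rightarrow> ((nat \<times> (real^4)) \<times> (nat \<times> (real^4))) set" where
  "face_identification T = {((i, t), (j, t')). (i, t) \<in> tetrahedra T \<and>
     (\<exists>f s. t $ f = 0 \<and> glue T i f = (j, s) \<and> (\<forall>v. t' $ s v = t $ v))}"

text \<open>\<open>h\<close> induces a homeomorphism from the glued ideal tetrahedra to the complement of \<open>K\<close>,
  i.e. to the interior of the complement of an open tubular neighbourhood.\<close>

definition ideal_triangulation ::
  "(real^4) set \<Rightarrow> triangulation \<Rightarrow> (nat \<times> (real^4) \<Rightarrow> real^4) \<Rightarrow> bool" where
  "ideal_triangulation K T h \<longleftrightarrow> oriented_gluing T \<and>
     quotient_map (top_of_set (tetrahedra T)) (top_of_set (S3 - K)) h \<and>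
     (\<forall>x\<in>tetrahedra T. \<forall>y\<in>tetrahedra T.
        h x = h y \<longleftrightarrow> (x, y) \<in> (face_identification T \<union> (face_identification T)\<inverse>)\<^sup>*)"


section \<open>Gates, threads and defect circles\<close>

text \<open>The triple \<open>(i, p, e)\<close> is the gate \<open>v\<^sub>i\<^sub>p\<^sub>e\<close>. It is also read as the corner of the
  triangle that truncates vertex \<open>p\<close> of tetrahedron \<open>i\<close>, lying on the edge \<open>pe\<close>.\<close>

type_synonym gate = "nat \<times> 4 \<times> 4"

definition gates :: "triangulation \<Rightarrow> gate set" where
  "gates T = {(i, p, e). i < ntet T \<and> p \<noteq> e}"

definition even4 :: "4 \<Rightarrow> 4 \<Rightarrow> 4 \<Rightarrow> 4 \<Rightarrow> bool" where
  "even4 a b c d \<longleftrightarrow>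
     (\<exists>s. bij s \<and> evenperm s \<and> s 0 = a \<and> s 1 = b \<and> s 2 = c \<and> s 3 = d)"

text \<open>For \<open>p \<noteq> x\<close>, the values \<open>y\<close> and \<open>z\<close> such that \<open>(p, x, y, z)\<close> is an even
  permutation.\<close>

definition third :: "4 \<Rightarrow> 4 \<Rightarrow> 4" where "third p x = (THE y. \<exists>z. even4 p x y z)"
definition fourth :: "4 \<Rightarrow> 4 \<Rightarrow> 4" where "fourth p x = (THE z. \<exists>y. even4 p x y z)"

text \<open>The corner reached from \<open>(i, p, e)\<close> across the face opposite to \<open>third p e\<close>. As gluing
  maps are odd, iterating \<open>next_corner\<close> runs once around one end of an edge of the
  triangulation; its orbits are the defect circles. The thread numbered \<open>g\<close> joins \<open>g\<close> to
  \<open>next_corner T g\<close>; every thread occurs once, since crossing the other face at a corner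
  inverts \<open>next_corner\<close>.\<close>

definition next_corner :: "triangulation \<Rightarrow> gate \<Rightarrow> gate" where
  "next_corner T = (\<lambda>(i, p, e). case glue T i (third p e) of (j, s) \<Rightarrow> (j, s p, s e))"

definition circle_of :: "triangulation \<Rightarrow> gate \<Rightarrow> gate set" where
  "circle_of T g = range (\<lambda>m. (next_corner T ^^ m) g)"

definition other_end :: "gate \<Rightarrow> gate" where
  "other_end = (\<lambda>(i, p, e). (i, e, p))"

text \<open>Equivalence of (ends of) long edges: they lie on the same edge of the triangulation.\<close>

definition same_edge :: "triangulation \<Rightarrow> (gate \<times> gate) set" where
  "same_edge T = (let R = {(g, g'). g \<in> gates T \<and> (g' = next_corner T g \<or> g' = other_end g)}
     in (R \<union> R\<inverse>)\<^sup>*)"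


section \<open>Meridian and longitude loops on the boundary torus\<close>

text \<open>Short edges and threads drawn on the triangles cutting off the ideal vertices at
  barycentric height \<open>3/4\<close>. A step along the short edge \<open>(i, p, x)\<close> or the thread \<open>g\<close>
  carries a direction flag; \<open>True\<close> means from \<open>(i, p, third p x)\<close> to \<open>(i, p, fourth p x)\<close>,
  resp. from \<open>g\<close> to \<open>next_corner T g\<close>.\<close>

datatype step = ShortStep nat 4 4 bool | ThreadStep gate bool

definition gate_point :: "4 \<Rightarrow> 4 \<Rightarrow> real^4" where
  "gate_point p e = (\<chi> v. if v = p then 3/4 else if v = e then 1/8 else 1/16)"

text \<open>The point near the corner \<open>pe\<close> on the face opposite to \<open>x\<close>.\<close>

definition side_point :: "4 \<Rightarrow> 4 \<Rightarrow> 4 \<Rightarrow> real^4" where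
  "side_point p e x = (\<chi> v. if v = p then 3/4 else if v = e then 1/6 else if v = x then 0 else 1/12)"

definition thread_path ::
  "triangulation \<Rightarrow> (nat \<times> (real^4) \<Rightarrow> real^4) \<Rightarrow> gate \<Rightarrow> real \<Rightarrow> real^4" where
  "thread_path T h = (\<lambda>(i, p, e). case glue T i (third p e) of (j, s) \<Rightarrow>
     (\<lambda>u. h (i, linepath (gate_point p e) (side_point p e (third p e)) u)) +++
     (\<lambda>u. h (j, linepath (side_point (s p) (s e) (s (third p e))) (gate_point (s p) (s e)) u)))"

fun step_path ::
  "triangulation \<Rightarrow> (nat \<times> (real^4) \<Rightarrow> real^4) \<Rightarrow> step \<Rightarrow> real \<Rightarrow> real^4" where
  "step_path T h (ShortStep i p x d) =
     (let c = (\<lambda>u. h (i, linepath (gate_point p (third p x)) (gate_point p (fourth p x)) u))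
      in if d then c else reversepath c)"
| "step_path T h (ThreadStep g d) = (if d then thread_path T h g else reversepath (thread_path T h g))"

fun valid_step :: "triangulation \<Rightarrow> step \<Rightarrow> bool" where
  "valid_step T (ShortStep i p x d) \<longleftrightarrow> i < ntet T \<and> p \<noteq> x"
| "valid_step T (ThreadStep g d) \<longleftrightarrow> g \<in> gates T"

fun join_all :: "(real \<Rightarrow> 'b::topological_space) list \<Rightarrow> real \<Rightarrow> 'b" where
  "join_all [] = undefined"
| "join_all [c] = c"
| "join_all (c # c' # cs) = c +++ join_all (c' # cs)"

definition walk_loop ::
  "triangulation \<Rightarrow> (nat \<times> (real^4) \<Rightarrow> real^4) \<Rightarrow> step list \<Rightarrow> (real \<Rightarrow> real^4)" where
  "walk_loop T h ss = join_all (map (step_path T h) ss)"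

definition closed_walk ::
  "triangulation \<Rightarrow> (nat \<times> (real^4) \<Rightarrow> real^4) \<Rightarrow> step list \<Rightarrow> bool" where
  "closed_walk T h ss \<longleftrightarrow> ss \<noteq> [] \<and> (\<forall>st\<in>set ss. valid_step T st) \<and>
     (\<forall>m. Suc m < length ss \<longrightarrow>
        pathfinish (step_path T h (ss ! m)) = pathstart (step_path T h (ss ! Suc m))) \<and>
     pathfinish (step_path T h (last ss)) = pathstart (step_path T h (hd ss))"

text \<open>An open tubular neighbourhood of the knot, made of neighbourhoods of the ideal vertices.\<close>

definition knot_nbhd ::
  "(real^4) set \<Rightarrow> triangulation \<Rightarrow> (nat \<times> (real^4) \<Rightarrow> real^4) \<Rightarrow> (real^4) set" where
  "knot_nbhd K T h = K \<union> h ` {(i, t). (i, t) \<in> tetrahedra T \<and> (\<exists>v. t $ v > 1/2)}"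

definition loop_chain :: "(real \<Rightarrow> real^4) \<Rightarrow> (real^4) chain" where
  "loop_chain c = frag_of (restrict (\<lambda>x. c (x 1)) (standard_simplex 1))"

text \<open>A meridian contracts in the tubular neighbourhood and generates the first homology of
  the knot complement. A longitude runs once along the knot and is null-homologous in the
  complement. Both are determined up to orientation.\<close>

definition meridian_loop where
  "meridian_loop K T h c \<longleftrightarrow>
     (\<exists>a. homotopic_loops (knot_nbhd K T h) c (linepath a a)) \<and>
     (\<forall>z. singular_relcycle 1 (top_of_set (S3 - K)) {} z \<longrightarrow>
        (\<exists>m. homologous_rel 1 (top_of_set (S3 - K)) {} z (frag_cmul m (loop_chain c))))"

definition longitude_loop where
  "longitude_loop K T h c \<longleftrightarrow>
     (\<exists>k. simple_path k \<and> pathfinish k = pathstart k \<and> path_image k = K \<and>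
        homotopic_loops (knot_nbhd K T h) c k) \<and>
     singular_relboundary 1 (top_of_set (S3 - K)) {} (loop_chain c)"


section \<open>The internal skein algebra of the boundary surface as a quantum torus\<close>

text \<open>The localised internal skein algebra with its generating skeins:
  \<^item> \<open>long D i j k\<close> (used for \<open>j < k\<close>), \<open>short D i p x\<close>, \<open>thread D g\<close> are the long edges, short
    edges and threads, \<open>mer D\<close> and \<open>lon D\<close> are \<open>M\<close> and \<open>L\<close>;
  \<^item> \<open>tsign D g\<close> is the weight of \<open>thread D g\<close> at \<open>g\<close>, its weight at \<open>next_corner T g\<close>
    being the negative;
  \<^item> \<open>torus D g z\<close> is the action of the scalar \<open>z\<close> in the torus at the gate \<open>g\<close>;
  \<^item> \<open>circ D j\<close>, for \<open>j = 1, \<dots>, 2n\<close>, is a corner on the \<open>j\<close>-th defect circle;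
  \<^item> \<open>chi D\<close> is the character specialising the monodromies.\<close>

record 'a skein_data =
  alg :: "'a ring"
  scal :: "coeff \<Rightarrow> 'a"
  long :: "nat \<Rightarrow> 4 \<Rightarrow> 4 \<Rightarrow> 'a"
  short :: "nat \<Rightarrow> 4 \<Rightarrow> 4 \<Rightarrow> 'a"
  thread :: "gate \<Rightarrow> 'a"
  tsign :: "gate \<Rightarrow> int"
  torus :: "gate \<Rightarrow> coeff \<Rightarrow> 'a \<Rightarrow> 'a"
  mer :: 'a
  lon :: 'a
  circ :: "nat \<Rightarrow> gate"
  chi :: "'a \<Rightarrow> coeff"

definition long_gens :: "triangulation \<Rightarrow> 'a skein_data \<Rightarrow> 'a set" where
  "long_gens T D = {long D i j k | i j k. i < ntet T \<and> j < k}"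
definition short_gens :: "triangulation \<Rightarrow> 'a skein_data \<Rightarrow> 'a set" where
  "short_gens T D = {short D i p x | i p x. i < ntet T \<and> p \<noteq> x}"
definition thread_gens :: "triangulation \<Rightarrow> 'a skein_data \<Rightarrow> 'a set" where
  "thread_gens T D = thread D ` gates T"

definition q_commute :: "'a ring \<Rightarrow> (coeff \<Rightarrow> 'a) \<Rightarrow> 'a \<Rightarrow> 'a \<Rightarrow> int \<Rightarrow> bool" where
  "q_commute W sc u v d \<longleftrightarrow> u \<otimes>\<^bsub>W\<^esub> v = sc (qh powi d) \<otimes>\<^bsub>W\<^esub> (v \<otimes>\<^bsub>W\<^esub> u)"

text \<open>\<open>W\<close> is a quantum torus over the coefficient field with generators \<open>U\<close>, possibly with
  redundancy: the Laurent monomials in \<open>U\<close> span \<open>W\<close>, and pairwise non-proportional ones are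
  linearly independent.\<close>

definition quantum_torus :: "'a ring \<Rightarrow> (coeff \<Rightarrow> 'a) \<Rightarrow> 'a set \<Rightarrow> bool" where
  "quantum_torus W sc U \<longleftrightarrow>
     ring W \<and> sc \<in> ring_hom coeff_ring W \<and>
     (\<forall>c. \<forall>w\<in>carrier W. sc c \<otimes>\<^bsub>W\<^esub> w = w \<otimes>\<^bsub>W\<^esub> sc c) \<and>
     U \<subseteq> Units W \<and> (\<forall>u\<in>U. \<forall>v\<in>U. \<exists>d. q_commute W sc u v d) \<and>
     carrier W = generate (add_monoid W)
       {sc c \<otimes>\<^bsub>W\<^esub> m | c m. m \<in> generate (units_of W) U} \<and>
     (\<forall>S c. finite S \<and> S \<subseteq> generate (units_of W) U \<and>
        (\<forall>m\<in>S. \<forall>m'\<in>S. m \<noteq> m' \<longrightarrow> (\<forall>a. m \<noteq> sc a \<otimes>\<^bsub>W\<^esub> m')) \<and>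
        finsum W (\<lambda>m. sc (c m) \<otimes>\<^bsub>W\<^esub> m) S = \<zero>\<^bsub>W\<^esub> \<longrightarrow> (\<forall>m\<in>S. c m = 0))"

text \<open>Exponents of \<open>qh\<close> are twice those of \<open>q\<close>, so the normalising factor
  \<open>q ^ (- 1/2 \<Sum> c\<^sub>i\<^sub>j)\<close> is \<open>qh ^ (- 1/2 \<Sum> d\<^sub>i\<^sub>j)\<close> with \<open>d\<^sub>i\<^sub>j = 2 c\<^sub>i\<^sub>j\<close>. It lies in the coefficient
  field exactly if \<open>\<Sum> d\<^sub>i\<^sub>j\<close> is even.\<close>

definition exponent_sum :: "'a skein_data \<Rightarrow> 'a list \<Rightarrow> int" where
  "exponent_sum D us =
     (\<Sum>j<length us. \<Sum>i<j. THE d. q_commute (alg D) (scal D) (us ! i) (us ! j) d)"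

definition lattice_product :: "'a skein_data \<Rightarrow> 'a list \<Rightarrow> 'a" where
  "lattice_product D us = scal D (qh powi (- (exponent_sum D us div 2))) \<otimes>\<^bsub>alg D\<^esub>
     foldr (monoid.mult (alg D)) us \<one>\<^bsub>alg D\<^esub>"

definition puncture_shorts :: "'a skein_data \<Rightarrow> nat \<Rightarrow> 4 \<Rightarrow> 'a list" where
  "puncture_shorts D i p = map (short D i p) (filter (\<lambda>x. x \<noteq> p) [0, 1, 2, 3])"

definition circle_threads :: "triangulation \<Rightarrow> 'a skein_data \<Rightarrow> nat \<Rightarrow> 'a list" where
  "circle_threads T D j =
     map (\<lambda>m. thread D ((next_corner T ^^ m) (circ D j))) [0..<card (circle_of T (circ D j))]"

definition alpha :: "'a skein_data \<Rightarrow> nat \<Rightarrow> 4 \<Rightarrow> 'a" where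
  "alpha D i p = lattice_product D (puncture_shorts D i p)"

definition thread_mon :: "triangulation \<Rightarrow> 'a skein_data \<Rightarrow> nat \<Rightarrow> 'a" where
  "thread_mon T D j = lattice_product D (circle_threads T D j)"

definition alphas :: "triangulation \<Rightarrow> 'a skein_data \<Rightarrow> 'a set" where
  "alphas T D = {alpha D i p | i p. i < ntet T}"

definition thread_mons :: "triangulation \<Rightarrow> 'a skein_data \<Rightarrow> 'a set" where
  "thread_mons T D = thread_mon T D ` {1..2 * ntet T}"

text \<open>The subalgebra generated by the elements of \<open>U\<close> and their inverses.\<close>

definition laurent_subalgebra :: "'a skein_data \<Rightarrow> 'a set \<Rightarrow> 'a set" where
  "laurent_subalgebra D U = generate_ring (alg D) (range (scal D) \<union> U \<union> m_inv (alg D) ` U)"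

definition W_inv :: "triangulation \<Rightarrow> 'a skein_data \<Rightarrow> 'a ring" where
  "W_inv T D = (alg D)\<lparr>carrier :=
     {w \<in> carrier (alg D). \<forall>g\<in>gates T. \<forall>z. z \<noteq> 0 \<longrightarrow> torus D g z w = w}\<rparr>"

definition W_thr :: "triangulation \<Rightarrow> 'a skein_data \<Rightarrow> 'a ring" where
  "W_thr T D = (alg D)\<lparr>carrier := laurent_subalgebra D (thread_mons T D)\<rparr>"

definition W_mon :: "triangulation \<Rightarrow> 'a skein_data \<Rightarrow> 'a ring" where
  "W_mon T D = (alg D)\<lparr>carrier := laurent_subalgebra D (alphas T D \<union> thread_mons T D)\<rparr>"

text \<open>As \<open>q\<close> is generic, the algebra on \<open>M, L\<close> with \<open>LM = qML\<close> is simple, so the subalgebra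
  generated by \<open>M\<^sup>\<plusminus>, L\<^sup>\<plusminus>\<close> is a copy of it.\<close>

definition boundary_torus :: "'a skein_data \<Rightarrow> 'a ring" where
  "boundary_torus D = (alg D)\<lparr>carrier := laurent_subalgebra D {mer D, lon D}\<rparr>"

text \<open>The weight at \<open>g\<close> of a long edge, short edge or thread.\<close>

definition long_wt :: "nat \<Rightarrow> 4 \<Rightarrow> 4 \<Rightarrow> gate \<Rightarrow> int" where
  "long_wt i j k g = of_bool (g = (i, j, k)) + of_bool (g = (i, k, j))"
definition short_wt :: "nat \<Rightarrow> 4 \<Rightarrow> 4 \<Rightarrow> gate \<Rightarrow> int" where
  "short_wt i p x g = of_bool (g = (i, p, third p x)) - of_bool (g = (i, p, fourth p x))"
definition thread_wt :: "triangulation \<Rightarrow> 'a skein_data \<Rightarrow> gate \<Rightarrow> gate \<Rightarrow> int" where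
  "thread_wt T D t g = tsign D t * (of_bool (g = t) - of_bool (g = next_corner T t))"

definition gate_tori_act :: "triangulation \<Rightarrow> 'a skein_data \<Rightarrow> bool" where
  "gate_tori_act T D \<longleftrightarrow> (\<forall>g\<in>gates T. \<forall>z. z \<noteq> 0 \<longrightarrow>
     torus D g z \<in> ring_hom (alg D) (alg D) \<and>
     (\<forall>c. torus D g z (scal D c) = scal D c) \<and>
     (\<forall>i<ntet T. \<forall>j k. j < k \<longrightarrow>
        torus D g z (long D i j k) = scal D (z powi long_wt i j k g) \<otimes>\<^bsub>alg D\<^esub> long D i j k) \<and>
     (\<forall>i<ntet T. \<forall>p x. p \<noteq> x \<longrightarrow>
        torus D g z (short D i p x) = scal D (z powi short_wt i p x g) \<otimes>\<^bsub>alg D\<^esub> short D i p x) \<and>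
     (\<forall>t\<in>gates T.
        torus D g z (thread D t) = scal D (z powi thread_wt T D t g) \<otimes>\<^bsub>alg D\<^esub> thread D t))"

fun step_elem :: "'a skein_data \<Rightarrow> step \<Rightarrow> 'a" where
  "step_elem D (ShortStep i p x d) =
     (if d then short D i p x else inv\<^bsub>alg D\<^esub> (short D i p x))"
| "step_elem D (ThreadStep g d) =
     (if d = (tsign D g = 1) then thread D g else inv\<^bsub>alg D\<^esub> (thread D g))"

text \<open>\<open>w\<close> is the closed skein along a loop \<open>c\<close> of the kind \<open>P\<close>, cut at gates into short edges
  and threads; in the T-region this changes a skein by an invertible scalar only.\<close>

definition carried_by_loop where
  "carried_by_loop T h D P w \<longleftrightarrow> (\<exists>ss a. closed_walk T h ss \<and> P (walk_loop T h ss) \<and> a \<noteq> 0 \<and>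
     w = scal D a \<otimes>\<^bsub>alg D\<^esub> foldr (monoid.mult (alg D)) (map (step_elem D) ss) \<one>\<^bsub>alg D\<^esub>)"

text \<open>The edge-ratio variables: a ratio of inequivalent long edges, corrected to weight zero.\<close>

definition edge_ratio :: "triangulation \<Rightarrow> 'a skein_data \<Rightarrow> 'a \<Rightarrow> bool" where
  "edge_ratio T D y \<longleftrightarrow> y \<in> carrier (W_inv T D) \<and> (\<exists>i j k i' j' k' t.
     i < ntet T \<and> j < k \<and> i' < ntet T \<and> j' < k' \<and> ((i, j, k), (i', j', k')) \<notin> same_edge T \<and>
     t \<in> generate (units_of (alg D)) (short_gens T D \<union> thread_gens T D) \<and>
     y = long D i j k \<otimes>\<^bsub>alg D\<^esub> inv\<^bsub>alg D\<^esub> (long D i' j' k') \<otimes>\<^bsub>alg D\<^esub> t)"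

text \<open>The structure of the localised internal skein algebra of the boundary surface. The
  commutation exponents between its generators are not constrained beyond what is listed.\<close>

definition parabolic_skein_torus ::
  "(real^4) set \<Rightarrow> triangulation \<Rightarrow> (nat \<times> (real^4) \<Rightarrow> real^4) \<Rightarrow> 'a skein_data \<Rightarrow> bool" where
  "parabolic_skein_torus K T h D \<longleftrightarrow>
     quantum_torus (alg D) (scal D) (long_gens T D \<union> short_gens T D \<union> thread_gens T D) \<and>
     (\<forall>g\<in>gates T. tsign D g \<in> {1, -1} \<and> tsign D (next_corner T g) = tsign D g) \<and>
     gate_tori_act T D \<and>
     \<comment> \<open>defect circles: the two ends of the \<open>k\<close>-th handle are numbered \<open>2k - 1\<close> and \<open>2k\<close>\<close>
     circ D ` {1..2 * ntet T} \<subseteq> gates T \<and>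
     (\<forall>g\<in>gates T. \<exists>!j. j \<in> {1..2 * ntet T} \<and> g \<in> circle_of T (circ D j)) \<and>
     (\<forall>k\<in>{1..ntet T}. other_end (circ D (2 * k - 1)) \<in> circle_of T (circ D (2 * k))) \<and>
     \<comment> \<open>the monodromies are lattice-normalised products\<close>
     (\<forall>i<ntet T. \<forall>p. even (exponent_sum D (puncture_shorts D i p))) \<and>
     (\<forall>j\<in>{1..2 * ntet T}. even (exponent_sum D (circle_threads T D j))) \<and>
     (\<forall>a\<in>alphas T D. \<forall>w\<in>carrier (W_inv T D). a \<otimes>\<^bsub>alg D\<^esub> w = w \<otimes>\<^bsub>alg D\<^esub> a) \<and>
     (\<forall>r\<in>thread_mons T D. \<forall>w\<in>thread_mons T D \<union> {mer D, lon D}.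
        r \<otimes>\<^bsub>alg D\<^esub> w = w \<otimes>\<^bsub>alg D\<^esub> r) \<and>
     \<comment> \<open>meridian and longitude\<close>
     mer D \<in> carrier (W_inv T D) \<and> lon D \<in> carrier (W_inv T D) \<and>
     carried_by_loop T h D (meridian_loop K T h) (mer D) \<and>
     carried_by_loop T h D (longitude_loop K T h) (lon D) \<and>
     lon D \<otimes>\<^bsub>alg D\<^esub> mer D = scal D (qh ^ 2) \<otimes>\<^bsub>alg D\<^esub> (mer D \<otimes>\<^bsub>alg D\<^esub> lon D) \<and>
     (\<exists>Y. (\<forall>l\<in>{1..ntet T - 1}. edge_ratio T D (Y l)) \<and>
        carrier (W_inv T D) = laurent_subalgebra D
          ({mer D, lon D} \<union> alphas T D \<union> thread_mons T D \<union> Y ` {1..ntet T - 1})) \<and>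
     \<comment> \<open>the character on the algebra of monodromies; \<open>|r\<^sub>j|\<close> is the length of \<open>circle_threads T D j\<close>\<close>
     chi D \<in> ring_hom (W_mon T D) coeff_ring \<and> (\<forall>c. chi D (scal D c) = c) \<and>
     (\<forall>i<ntet T. \<forall>p. chi D (alpha D i p) = qh ^ 3) \<and>
     (\<forall>k\<in>{1..ntet T}.
        chi D (thread_mon T D (2 * k - 1)) = qh * qh ^ length (circle_threads T D (2 * k - 1)) \<and>
        chi D (thread_mon T D (2 * k)) = inverse qh * qh ^ length (circle_threads T D (2 * k)))"


section \<open>One-sided ideals and the bulk and thread relations\<close>

definition left_ideal :: "'a set \<Rightarrow> ('a, 'b) ring_scheme \<Rightarrow> bool" where
  "left_ideal I R \<longleftrightarrow> additive_subgroup I R \<and> (\<forall>a\<in>carrier R. \<forall>x\<in>I. a \<otimes>\<^bsub>R\<^esub> x \<in> I)"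

definition gen_left_ideal :: "('a, 'b) ring_scheme \<Rightarrow> 'a set \<Rightarrow> 'a set" where
  "gen_left_ideal R S = generate (add_monoid R) {a \<otimes>\<^bsub>R\<^esub> s | a s. a \<in> carrier R \<and> s \<in> S}"

definition gen_right_ideal :: "('a, 'b) ring_scheme \<Rightarrow> 'a set \<Rightarrow> 'a set" where
  "gen_right_ideal R S = generate (add_monoid R) {s \<otimes>\<^bsub>R\<^esub> a | a s. a \<in> carrier R \<and> s \<in> S}"

definition bulk_rel :: "'a skein_data \<Rightarrow> nat \<Rightarrow> 'a" where
  "bulk_rel D i = (let W = alg D; A = long D i; a = short D i in
     scal D (qh ^ 5) \<otimes>\<^bsub>W\<^esub>
       ((A 0 3 \<otimes>\<^bsub>W\<^esub> a 3 2 \<otimes>\<^bsub>W\<^esub> a 0 1) \<otimes>\<^bsub>W\<^esub> (A 1 2 \<otimes>\<^bsub>W\<^esub> a 2 3 \<otimes>\<^bsub>W\<^esub> a 1 0)) \<oplus>\<^bsub>W\<^esub>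
     scal D (qh ^ 3) \<otimes>\<^bsub>W\<^esub>
       ((A 0 1 \<otimes>\<^bsub>W\<^esub> inv\<^bsub>W\<^esub> (a 0 3) \<otimes>\<^bsub>W\<^esub> inv\<^bsub>W\<^esub> (a 1 2)) \<otimes>\<^bsub>W\<^esub>
        (A 2 3 \<otimes>\<^bsub>W\<^esub> inv\<^bsub>W\<^esub> (a 2 1) \<otimes>\<^bsub>W\<^esub> inv\<^bsub>W\<^esub> (a 3 0))) \<oplus>\<^bsub>W\<^esub>
     scal D (qh ^ 3) \<otimes>\<^bsub>W\<^esub> (A 1 3 \<otimes>\<^bsub>W\<^esub> A 0 2))"

definition bulk_rels :: "triangulation \<Rightarrow> 'a skein_data \<Rightarrow> 'a set" where
  "bulk_rels T D = {inv\<^bsub>alg D\<^esub> (long D i 1 3 \<otimes>\<^bsub>alg D\<^esub> long D i 0 2) \<otimes>\<^bsub>alg D\<^esub> bulk_rel D i | i. i < ntet T}"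

definition I_bulk :: "triangulation \<Rightarrow> 'a skein_data \<Rightarrow> 'a set" where
  "I_bulk T D = gen_left_ideal (W_inv T D) (bulk_rels T D)"

definition specialise :: "'a skein_data \<Rightarrow> 'a \<Rightarrow> 'a" where
  "specialise D m = m \<ominus>\<^bsub>alg D\<^esub> scal D (chi D m)"

definition I_thr :: "triangulation \<Rightarrow> 'a skein_data \<Rightarrow> 'a set" where
  "I_thr T D = gen_right_ideal (W_inv T D) (specialise D ` (alphas T D \<union> thread_mons T D))"


section \<open>Tensor products over a noncommutative ring\<close>

text \<open>\<open>A\<close> and \<open>B\<close> are abelian groups in multiplicative record form; \<open>ra\<close> is the right action of
  \<open>R\<close> on \<open>A\<close> and \<open>lb\<close> its left action on \<open>B\<close>.\<close>

definition tensor_null ::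
  "('r, 'x) ring_scheme \<Rightarrow> ('a, 'y) monoid_scheme \<Rightarrow> ('a \<Rightarrow> 'r \<Rightarrow> 'a) \<Rightarrow>
   ('b, 'z) monoid_scheme \<Rightarrow> ('r \<Rightarrow> 'b \<Rightarrow> 'b) \<Rightarrow> ('a \<times> 'b \<Rightarrow>\<^sub>0 int) set" where
  "tensor_null R A ra B lb = generate (free_Abelian_group (carrier A \<times> carrier B))
     ({frag_of (a \<otimes>\<^bsub>A\<^esub> a', b) - frag_of (a, b) - frag_of (a', b) | a a' b.
         a \<in> carrier A \<and> a' \<in> carrier A \<and> b \<in> carrier B} \<union>
      {frag_of (a, b \<otimes>\<^bsub>B\<^esub> b') - frag_of (a, b) - frag_of (a, b') | a b b'.
         a \<in> carrier A \<and> b \<in> carrier B \<and> b' \<in> carrier B} \<union>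
      {frag_of (ra a r, b) - frag_of (a, lb r b) | a r b.
         a \<in> carrier A \<and> r \<in> carrier R \<and> b \<in> carrier B})"

definition tensor_group ::
  "('r, 'x) ring_scheme \<Rightarrow> ('a, 'y) monoid_scheme \<Rightarrow> ('a \<Rightarrow> 'r \<Rightarrow> 'a) \<Rightarrow>
   ('b, 'z) monoid_scheme \<Rightarrow> ('r \<Rightarrow> 'b \<Rightarrow> 'b) \<Rightarrow> ('a \<times> 'b \<Rightarrow>\<^sub>0 int) set monoid" where
  "tensor_group R A ra B lb =
     free_Abelian_group (carrier A \<times> carrier B) Mod tensor_null R A ra B lb"

definition tensor_class ::
  "('r, 'x) ring_scheme \<Rightarrow> ('a, 'y) monoid_scheme \<Rightarrow> ('a \<Rightarrow> 'r \<Rightarrow> 'a) \<Rightarrow>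
   ('b, 'z) monoid_scheme \<Rightarrow> ('r \<Rightarrow> 'b \<Rightarrow> 'b) \<Rightarrow> ('a \<times> 'b \<Rightarrow>\<^sub>0 int) \<Rightarrow> ('a \<times> 'b \<Rightarrow>\<^sub>0 int) set" where
  "tensor_class R A ra B lb x =
     tensor_null R A ra B lb #>\<^bsub>free_Abelian_group (carrier A \<times> carrier B)\<^esub> x"

text \<open>The endomorphism induced by endomorphisms \<open>f\<close> and \<open>g\<close> of the factors, on cosets.\<close>

definition tensor_map ::
  "('r, 'x) ring_scheme \<Rightarrow> ('a, 'y) monoid_scheme \<Rightarrow> ('a \<Rightarrow> 'r \<Rightarrow> 'a) \<Rightarrow>
   ('b, 'z) monoid_scheme \<Rightarrow> ('r \<Rightarrow> 'b \<Rightarrow> 'b) \<Rightarrow> ('a \<Rightarrow> 'a) \<Rightarrow> ('b \<Rightarrow> 'b) \<Rightarrow>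
   ('a \<times> 'b \<Rightarrow>\<^sub>0 int) set \<Rightarrow> ('a \<times> 'b \<Rightarrow>\<^sub>0 int) set" where
  "tensor_map R A ra B lb f g Z =
     (\<Union>x\<in>Z. tensor_class R A ra B lb (frag_extend (\<lambda>(a, b). frag_of (f a, g b)) x))"


section \<open>The localised skein module and the localised quantum A-ideal\<close>

text \<open>The skein module of the thickened T-disks is one-dimensional, spanned by the empty skein,
  the thread monodromies acting through the character.\<close>

definition skmod_thr :: "coeff monoid" where
  "skmod_thr = add_monoid coeff_ring"

definition thr_act :: "'a skein_data \<Rightarrow> coeff \<Rightarrow> 'a \<Rightarrow> coeff" where
  "thr_act D c w = c * chi D w"

text \<open>The localised skein module of \<open>M\<^sub>\<triangle>\<close>. On skeins of weight zero at all gates a puncture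
  monodromy bounds a disk pushed into \<open>M\<^sub>\<triangle>\<close>, so the (central) puncture monodromies already take
  their values here, and only the thread monodromies are specialised by gluing \<open>M\<^sub>t\<^sub>h\<^sub>r\<close>.\<close>

definition bulk_module_rels :: "triangulation \<Rightarrow> 'a skein_data \<Rightarrow> 'a set" where
  "bulk_module_rels T D = gen_left_ideal (W_inv T D) (bulk_rels T D \<union> specialise D ` alphas T D)"

definition skmod_bulk :: "triangulation \<Rightarrow> 'a skein_data \<Rightarrow> 'a set monoid" where
  "skmod_bulk T D = add_monoid (W_inv T D) Mod bulk_module_rels T D"

definition bulk_class :: "triangulation \<Rightarrow> 'a skein_data \<Rightarrow> 'a \<Rightarrow> 'a set" where
  "bulk_class T D w = bulk_module_rels T D +>\<^bsub>W_inv T D\<^esub> w"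

definition bulk_act :: "triangulation \<Rightarrow> 'a skein_data \<Rightarrow> 'a \<Rightarrow> 'a set \<Rightarrow> 'a set" where
  "bulk_act T D w Z = (\<Union>x\<in>Z. bulk_class T D (w \<otimes>\<^bsub>alg D\<^esub> x))"

text \<open>\<open>SkMod(M\<^sub>t\<^sub>h\<^sub>r) \<otimes>\<^bsub>W_thr\<^esub> W_inv\<close>, with its endomorphisms \<open>id \<otimes> f\<close>.\<close>

definition thr_tensor :: "triangulation \<Rightarrow> 'a skein_data \<Rightarrow> (coeff \<times> 'a \<Rightarrow>\<^sub>0 int) set monoid" where
  "thr_tensor T D =
     tensor_group (W_thr T D) skmod_thr (thr_act D) (add_monoid (W_inv T D)) (monoid.mult (alg D))"

definition thr_tensor_map ::
  "triangulation \<Rightarrow> 'a skein_data \<Rightarrow> ('a \<Rightarrow> 'a) \<Rightarrow> (coeff \<times> 'a \<Rightarrow>\<^sub>0 int) set \<Rightarrow> (coeff \<times> 'a \<Rightarrow>\<^sub>0 int) set" where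
  "thr_tensor_map T D f =
     tensor_map (W_thr T D) skmod_thr (thr_act D) (add_monoid (W_inv T D)) (monoid.mult (alg D)) id f"

definition thr_tensor_ract ::
  "triangulation \<Rightarrow> 'a skein_data \<Rightarrow> (coeff \<times> 'a \<Rightarrow>\<^sub>0 int) set \<Rightarrow> 'a \<Rightarrow> (coeff \<times> 'a \<Rightarrow>\<^sub>0 int) set" where
  "thr_tensor_ract T D Z w = thr_tensor_map T D (\<lambda>x. x \<otimes>\<^bsub>alg D\<^esub> w) Z"

definition SkMod_loc ::
  "triangulation \<Rightarrow> 'a skein_data \<Rightarrow> ((coeff \<times> 'a \<Rightarrow>\<^sub>0 int) set \<times> 'a set \<Rightarrow>\<^sub>0 int) set monoid" where
  "SkMod_loc T D = tensor_group (W_inv T D)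
     (thr_tensor T D) (thr_tensor_ract T D) (skmod_bulk T D) (bulk_act T D)"

text \<open>Inserting \<open>p\<close> at the boundary torus multiplies the middle factor by \<open>p\<close> on the left; for
  \<open>p\<close> in \<open>boundary_torus D\<close> this is well defined because \<open>p\<close> commutes with \<open>W_thr T D\<close>.\<close>

definition insert_skein ::
  "triangulation \<Rightarrow> 'a skein_data \<Rightarrow> 'a \<Rightarrow>
   ((coeff \<times> 'a \<Rightarrow>\<^sub>0 int) set \<times> 'a set \<Rightarrow>\<^sub>0 int) set \<Rightarrow>
   ((coeff \<times> 'a \<Rightarrow>\<^sub>0 int) set \<times> 'a set \<Rightarrow>\<^sub>0 int) set" where
  "insert_skein T D p = tensor_map (W_inv T D)
     (thr_tensor T D) (thr_tensor_ract T D) (skmod_bulk T D) (bulk_act T D)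
     (thr_tensor_map T D (\<lambda>x. p \<otimes>\<^bsub>alg D\<^esub> x)) id"

definition empty_skein ::
  "triangulation \<Rightarrow> 'a skein_data \<Rightarrow> ((coeff \<times> 'a \<Rightarrow>\<^sub>0 int) set \<times> 'a set \<Rightarrow>\<^sub>0 int) set" where
  "empty_skein T D = tensor_class (W_inv T D)
     (thr_tensor T D) (thr_tensor_ract T D) (skmod_bulk T D) (bulk_act T D)
     (frag_of
       (tensor_class (W_thr T D) skmod_thr (thr_act D) (add_monoid (W_inv T D)) (monoid.mult (alg D))
          (frag_of (1, \<one>\<^bsub>alg D\<^esub>)),
        bulk_class T D \<one>\<^bsub>alg D\<^esub>))"

definition localised_A_ideal :: "triangulation \<Rightarrow> 'a skein_data \<Rightarrow> 'a set" where
  "localised_A_ideal T D =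
     {p \<in> carrier (boundary_torus D). insert_skein T D p (empty_skein T D) = \<one>\<^bsub>SkMod_loc T D\<^esub>}"

end

theory Submission
  imports Defs
begin

text \<open>Write \<open>J\<close> for the left ideal of relations of the localised skein module of \<open>M\<^sub>\<triangle>\<close>, i.e. the
  bulk relations together with the specialised puncture monodromies. Multiplying out the tensor
  factors identifies the localised skein module with \<open>W\<^sub>i\<^sub>n\<^sub>v / (R + J)\<close>, where \<open>R\<close> is the right
  ideal generated by \<open>c - \<chi>(c)\<close> for \<open>c\<close> in the algebra of thread monodromies, and the empty skein
  becomes the class of \<open>1\<close>. Modulo \<open>R\<close> only the thread monodromies themselves matter, and the
  puncture monodromies are central, so that \<open>R + J\<close> equals the sum of the right ideal of thread
  relations and the left ideal of bulk relations. Inserting \<open>p\<close> at the boundary torus sends \<open>1\<close> to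
  \<open>p\<close>, since \<open>p\<close> commutes with the thread monodromies.\<close>

text \<open>The sum of a right and a left ideal is just an additive subgroup, so the comparison
  takes place in an abelian group, and facts about ideals are proved in one form: the elements with
  a wanted property form an additive subgroup, and the generators have it. That the joint ideal
  annihilates is a computation with tensor relators. The converse needs an additive map out of a
  tensor product whose factors are themselves sets of cosets. Products of chosen representatives are
  additive and balanced only up to the joint ideal, and this suffices: ambiguity in the left factor
  is absorbed by the right ideal, ambiguity in the right factor by the left ideal. Two facts must be
  extracted from the description of the generators. The bulk relations have weight zero, so that
  their left ideal is a subgroup of \<open>W_inv T D\<close>. The thread monodromies,
  \<open>mer D\<close> and \<open>lon D\<close> are units; the Laurent subalgebras adjoin values of
  \<open>m_inv\<close>, which are inverses only for units.\<close>

hide_const (open) Finite_Cartesian_Product.transpose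


section \<open>Rings and one-sided ideals\<close>

text \<open>If \<open>a\<close>, \<open>b\<close>, \<open>c\<close> agree with
  \<open>y \<oplus> z\<close>, \<open>y\<close>, \<open>z\<close> modulo a subgroup, this identity
  puts the additivity defect of \<open>a\<close>, \<open>b\<close>, \<open>c\<close> into that
  subgroup.\<close>

lemma (in abelian_group) minus_minus_minus:
  assumes "a \<in> carrier G" "b \<in> carrier G" "c \<in> carrier G" "y \<in> carrier G" "z \<in> carrier G"
  shows "(a \<ominus> (y \<oplus> z)) \<ominus> (b \<ominus> y) \<ominus> (c \<ominus> z) = a \<ominus> b \<ominus> c"
proof -
  have "\<ominus> y \<oplus> (y \<oplus> (\<ominus> z \<oplus> (z \<oplus> d))) = d" if "d \<in> carrier G" for d
    using assms that by (simp add: r_neg1)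
  from this [of "a \<oplus> (\<ominus> b \<oplus> \<ominus> c)"] show ?thesis
    using assms by (simp add: a_minus_def minus_add a_ac)
qed

lemma (in abelian_group) add_minus_minus:
  "x \<in> carrier G \<Longrightarrow> y \<in> carrier G \<Longrightarrow> (x \<oplus> y) \<ominus> x \<ominus> y = \<zero>"
  by (simp add: a_minus_def a_comm [of x y] a_assoc r_neg r_neg2)

text \<open>The counterpart for balancing: two elements congruent to the same \<open>z\<close> are
  congruent to each other.\<close>

lemma (in abelian_group) minus_minus_cancel:
  "x \<in> carrier G \<Longrightarrow> y \<in> carrier G \<Longrightarrow> z \<in> carrier G \<Longrightarrow> (x \<ominus> z) \<ominus> (y \<ominus> z) = x \<ominus> y"
  by (simp add: a_minus_def minus_add a_comm [of "\<ominus> y" z] a_assoc r_neg1)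

lemma (in ring) minus_add_minus:
  "x \<in> carrier R \<Longrightarrow> y \<in> carrier R \<Longrightarrow> z \<in> carrier R \<Longrightarrow> (x \<ominus> y) \<oplus> (y \<ominus> z) = x \<ominus> z"
  by (simp add: a_minus_def a_assoc) (simp add: a_assoc [symmetric] l_neg)

lemma (in ring) l_minus_distr:
  "x \<in> carrier R \<Longrightarrow> y \<in> carrier R \<Longrightarrow> z \<in> carrier R \<Longrightarrow> (x \<ominus> y) \<otimes> z = x \<otimes> z \<ominus> y \<otimes> z"
  by (simp add: a_minus_def l_distr l_minus)

lemma (in ring) r_minus_distr:
  "x \<in> carrier R \<Longrightarrow> y \<in> carrier R \<Longrightarrow> z \<in> carrier R \<Longrightarrow> z \<otimes> (x \<ominus> y) = z \<otimes> x \<ominus> z \<otimes> y"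
  by (simp add: a_minus_def r_distr r_minus)

context ring
begin

lemma additive_generate:
  assumes "S \<subseteq> carrier R"
  shows "additive_subgroup (generate (add_monoid R) S) R"
  using add.generate_is_subgroup assms by (simp add: additive_subgroup_def)

lemma additive_generate_least:
  assumes "additive_subgroup N R" "S \<subseteq> N"
  shows "generate (add_monoid R) S \<subseteq> N"
  using add.generate_subgroup_incl assms by (simp add: additive_subgroup_def)

lemma gen_left_ideal_gens: "S \<subseteq> carrier R \<Longrightarrow> {a \<otimes> s | a s. a \<in> carrier R \<and> s \<in> S} \<subseteq> carrier R"
  by auto

lemma gen_right_ideal_gens: "S \<subseteq> carrier R \<Longrightarrow> {s \<otimes> a | a s. a \<in> carrier R \<and> s \<in> S} \<subseteq> carrier R"
  by auto

lemma additive_gen_left_ideal: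
  "S \<subseteq> carrier R \<Longrightarrow> additive_subgroup (gen_left_ideal R S) R"
  unfolding gen_left_ideal_def by (intro additive_generate gen_left_ideal_gens)

lemma additive_gen_right_ideal:
  "S \<subseteq> carrier R \<Longrightarrow> additive_subgroup (gen_right_ideal R S) R"
  unfolding gen_right_ideal_def by (intro additive_generate gen_right_ideal_gens)

lemma gen_left_ideal_incl: "a \<in> carrier R \<Longrightarrow> s \<in> S \<Longrightarrow> a \<otimes> s \<in> gen_left_ideal R S"
  unfolding gen_left_ideal_def by (rule generate.incl) blast

lemma gen_right_ideal_incl: "s \<in> S \<Longrightarrow> a \<in> carrier R \<Longrightarrow> s \<otimes> a \<in> gen_right_ideal R S"
  unfolding gen_right_ideal_def by (rule generate.incl) blast

lemma gen_left_ideal_least: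
  assumes "additive_subgroup N R" "\<And>a s. a \<in> carrier R \<Longrightarrow> s \<in> S \<Longrightarrow> a \<otimes> s \<in> N"
  shows "gen_left_ideal R S \<subseteq> N"
  unfolding gen_left_ideal_def by (rule additive_generate_least) (use assms in auto)

lemma gen_right_ideal_least:
  assumes "additive_subgroup N R" "\<And>a s. a \<in> carrier R \<Longrightarrow> s \<in> S \<Longrightarrow> s \<otimes> a \<in> N"
  shows "gen_right_ideal R S \<subseteq> N"
  unfolding gen_right_ideal_def by (rule additive_generate_least) (use assms in auto)

text \<open>With \<open>f\<close> multiplication by a fixed element, this reduces stability of a
  generated ideal to its generators: the preimage is a subgroup, and the generated ideal is the
  least one containing the multiples of the generators.\<close>

lemma additive_vimage:
  assumes N: "additive_subgroup N R" and f: "f \<in> carrier R \<rightarrow> carrier R"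
    and "\<And>x y. x \<in> carrier R \<Longrightarrow> y \<in> carrier R \<Longrightarrow> f (x \<oplus> y) = f x \<oplus> f y"
  shows "additive_subgroup {x \<in> carrier R. f x \<in> N} R"
proof -
  interpret N: additive_subgroup N R by (fact N)
  have zero: "f \<zero> = \<zero>"
    using assms(3) [of \<zero> \<zero>] f by (simp add: Pi_iff)
  have minus: "f (\<ominus> x) = \<ominus> f x" if "x \<in> carrier R" for x
    using assms(3) [of "\<ominus> x" x] that f zero by (intro minus_equality [symmetric]) (simp_all add: l_neg Pi_iff)
  show ?thesis
    unfolding additive_subgroup_def
    by (rule add.subgroupI) (use f assms(3) zero minus in \<open>auto simp: a_inv_def [symmetric]\<close>)
qed

lemma gen_left_ideal_mult_closed:
  assumes S: "S \<subseteq> carrier R" and a: "a \<in> carrier R" and x: "x \<in> gen_left_ideal R S"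
  shows "a \<otimes> x \<in> gen_left_ideal R S"
proof -
  have "gen_left_ideal R S \<subseteq> {x \<in> carrier R. a \<otimes> x \<in> gen_left_ideal R S}"
  proof (rule gen_left_ideal_least)
    show "additive_subgroup {x \<in> carrier R. a \<otimes> x \<in> gen_left_ideal R S} R"
      by (rule additive_vimage [OF additive_gen_left_ideal [OF S]]) (auto simp: a r_distr)
    fix b s assume "b \<in> carrier R" "s \<in> S"
    then show "b \<otimes> s \<in> {x \<in> carrier R. a \<otimes> x \<in> gen_left_ideal R S}"
      using gen_left_ideal_incl [of "a \<otimes> b" s S] a S by (auto simp: m_assoc subset_iff)
  qed
  with x show ?thesis by blast
qed

lemma gen_right_ideal_mult_closed:
  assumes S: "S \<subseteq> carrier R" and a: "a \<in> carrier R" and x: "x \<in> gen_right_ideal R S"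
  shows "x \<otimes> a \<in> gen_right_ideal R S"
proof -
  have "gen_right_ideal R S \<subseteq> {x \<in> carrier R. x \<otimes> a \<in> gen_right_ideal R S}"
  proof (rule gen_right_ideal_least)
    show "additive_subgroup {x \<in> carrier R. x \<otimes> a \<in> gen_right_ideal R S} R"
      by (rule additive_vimage [OF additive_gen_right_ideal [OF S]]) (auto simp: a l_distr)
    fix b s assume "b \<in> carrier R" "s \<in> S"
    then show "s \<otimes> b \<in> {x \<in> carrier R. x \<otimes> a \<in> gen_right_ideal R S}"
      using gen_right_ideal_incl [of s S "b \<otimes> a"] a S by (auto simp: m_assoc subset_iff)
  qed
  with x show ?thesis by blast
qed

text \<open>Allows commutation with a generated subalgebra to be checked on generators.\<close>

lemma centraliser_subring:
  assumes Y: "Y \<subseteq> carrier R"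
  shows "subring {x \<in> carrier R. \<forall>y\<in>Y. x \<otimes> y = y \<otimes> x} R"
proof (rule subringI)
  fix h1 h2 assume *: "h1 \<in> {x \<in> carrier R. \<forall>y\<in>Y. x \<otimes> y = y \<otimes> x}"
    "h2 \<in> {x \<in> carrier R. \<forall>y\<in>Y. x \<otimes> y = y \<otimes> x}"
  have "(h1 \<otimes> h2) \<otimes> y = y \<otimes> (h1 \<otimes> h2)" if "y \<in> Y" for y
  proof -
    have y: "y \<in> carrier R" "h1 \<in> carrier R" "h2 \<in> carrier R" using that Y * by auto
    have "(h1 \<otimes> h2) \<otimes> y = h1 \<otimes> (y \<otimes> h2)" using * that y by (simp add: m_assoc)
    also have "\<dots> = (y \<otimes> h1) \<otimes> h2" using * that y by (simp add: m_assoc [symmetric])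
    also have "\<dots> = y \<otimes> (h1 \<otimes> h2)" using y by (simp add: m_assoc)
    finally show ?thesis .
  qed
  with * show "h1 \<otimes> h2 \<in> {x \<in> carrier R. \<forall>y\<in>Y. x \<otimes> y = y \<otimes> x}" by simp
qed (use Y in \<open>auto simp: subset_iff l_minus r_minus l_distr r_distr\<close>)

lemma Units_commute_inv:
  assumes u: "u \<in> Units R" and x: "x \<in> carrier R" and c: "u \<otimes> x = x \<otimes> u"
  shows "inv u \<otimes> x = x \<otimes> inv u"
proof -
  have "inv u \<otimes> x = inv u \<otimes> (x \<otimes> u) \<otimes> inv u"
    using u x by (simp add: m_assoc Units_closed)
  also have "\<dots> = (inv u \<otimes> u) \<otimes> x \<otimes> inv u"
    unfolding c [symmetric] using u x by (simp only: m_assoc Units_closed Units_inv_closed m_closed)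
  also have "\<dots> = x \<otimes> inv u"
    using u x by simp
  finally show ?thesis .
qed

lemma foldr_Units: "set us \<subseteq> Units R \<Longrightarrow> foldr (\<otimes>) us \<one> \<in> Units R"
  by (induction us) auto

end


section \<open>Even permutations of the vertices\<close>

lemma four_cases: "(x::4) = 0 \<or> x = 1 \<or> x = 2 \<or> x = 3"
  using exhaust_4 [of x] by auto

text \<open>Every even permutation of four points is a product of two transpositions, the identity
  arising by repeating one, so this form supplies all witnesses for \<open>even4\<close>.\<close>

lemma even4_transpose:
  assumes "a \<noteq> b" "c \<noteq> d" and "s = transpose a b \<circ> transpose c d"
  shows "even4 (s 0) (s 1) (s 2) (s 3)"
  unfolding even4_def
  using assms by (intro exI [of _ s]) (auto simp: evenperm_comp evenperm_swap permutation_swap_id bij_comp)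

text \<open>Once \<open>p\<close> and \<open>x\<close> are fixed, the two remaining vertices can be
  ordered in two ways of opposite parity. Hence the descriptions defining \<open>third\<close> and
  \<open>fourth\<close> are unambiguous.\<close>

lemma even4_unique:
  assumes "even4 p x y z" "even4 p x y' z'"
  shows "y = y' \<and> z = z'"
proof -
  obtain s where s: "bij s" "evenperm s" "s 0 = p" "s 1 = x" "s 2 = y" "s 3 = z"
    using assms(1) unfolding even4_def by blast
  obtain s' where s': "bij s'" "evenperm s'" "s' 0 = p" "s' 1 = x" "s' 2 = y'" "s' 3 = z'"
    using assms(2) unfolding even4_def by blast
  have perm: "permutation s"
    using s(1) by (simp add: permutation)
  have inj: "s i = s j \<longleftrightarrow> i = j" "s' i = s' j \<longleftrightarrow> i = j" for i j
    using s(1) s'(1) by (simp_all add: bij_def inj_eq)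
  have d: "p \<noteq> x" "p \<noteq> y" "p \<noteq> z" "x \<noteq> y" "x \<noteq> z" "y \<noteq> z"
    "p \<noteq> y'" "p \<noteq> z'" "x \<noteq> y'" "x \<noteq> z'" "y' \<noteq> z'"
    using inj [of 0 1] inj [of 0 2] inj [of 0 3] inj [of 1 2] inj [of 1 3] inj [of 2 3] s s' by auto
  have range: "w = p \<or> w = x \<or> w = y \<or> w = z" for w
  proof -
    obtain i where "w = s i" using s(1) by (metis bij_pointE)
    with four_cases [of i] s show ?thesis by auto
  qed
  \<comment> \<open>In the swapped order \<open>s'\<close> would be \<open>s\<close> followed by a
    transposition, hence odd.\<close>
  have "\<not> (y' = z \<and> z' = y)"
  proof
    assume swap: "y' = z \<and> z' = y"
    have "s' i = (transpose y z \<circ> s) i" for i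
      using four_cases [of i] s s' d swap by (auto simp: Transposition.transpose_def)
    then have "s' = transpose y z \<circ> s" by blast
    then show False
      using s(2) s'(2) perm d by (simp add: evenperm_comp evenperm_swap permutation_swap_id)
  qed
  with range [of y'] range [of z'] d show ?thesis by metis
qed

lemma third_fourth_eq:
  assumes "even4 p x y z"
  shows "third p x = y" "fourth p x = z"
  unfolding third_def fourth_def using assms even4_unique by blast+

text \<open>The eight pairs are exactly the indices of the short edges occurring in
  \<open>bulk_rel\<close>.\<close>

lemma third_fourth_values:
  "third 3 2 = 1" "fourth 3 2 = 0" "third 0 1 = 2" "fourth 0 1 = 3"
  "third 2 3 = 0" "fourth 2 3 = 1" "third 1 0 = 3" "fourth 1 0 = 2"
  "third 0 3 = 1" "fourth 0 3 = 2" "third 1 2 = 0" "fourth 1 2 = 3"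
  "third 2 1 = 3" "fourth 2 1 = 0" "third 3 0 = 2" "fourth 3 0 = 1"
proof -
  have "even4 3 2 1 0" using even4_transpose [OF _ _ refl, of 0 3 1 2] by (simp add: Transposition.transpose_def)
  then show "third 3 2 = 1" "fourth 3 2 = 0" by (rule third_fourth_eq)+
  have "even4 0 1 2 3" using even4_transpose [OF _ _ refl, of 0 1 0 1] by (simp add: Transposition.transpose_def)
  then show "third 0 1 = 2" "fourth 0 1 = 3" by (rule third_fourth_eq)+
  have "even4 2 3 0 1" using even4_transpose [OF _ _ refl, of 0 2 1 3] by (simp add: Transposition.transpose_def)
  then show "third 2 3 = 0" "fourth 2 3 = 1" by (rule third_fourth_eq)+
  have "even4 1 0 3 2" using even4_transpose [OF _ _ refl, of 0 1 2 3] by (simp add: Transposition.transpose_def)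
  then show "third 1 0 = 3" "fourth 1 0 = 2" by (rule third_fourth_eq)+
  have "even4 0 3 1 2" using even4_transpose [OF _ _ refl, of 1 3 2 3] by (simp add: Transposition.transpose_def)
  then show "third 0 3 = 1" "fourth 0 3 = 2" by (rule third_fourth_eq)+
  have "even4 1 2 0 3" using even4_transpose [OF _ _ refl, of 0 1 1 2] by (simp add: Transposition.transpose_def)
  then show "third 1 2 = 0" "fourth 1 2 = 3" by (rule third_fourth_eq)+
  have "even4 2 1 3 0" using even4_transpose [OF _ _ refl, of 0 2 2 3] by (simp add: Transposition.transpose_def)
  then show "third 2 1 = 3" "fourth 2 1 = 0" by (rule third_fourth_eq)+
  have "even4 3 0 2 1" using even4_transpose [OF _ _ refl, of 0 3 1 3] by (simp add: Transposition.transpose_def)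
  then show "third 3 0 = 2" "fourth 3 0 = 1" by (rule third_fourth_eq)+
qed

text \<open>Long edges are generators for \<open>j < k\<close> only; the order on the type
  \<open>4\<close> is that of the representatives 0, 1, 2, 3.\<close>

lemma four_less: "(0::4) < 1" "(0::4) < 2" "(0::4) < 3" "(1::4) < 2" "(1::4) < 3" "(2::4) < 3"
  by (simp_all add: less_bit0_def bit0.Rep_0 bit0.Rep_1 bit0.Rep_numeral)

text \<open>At each of the four punctures one short edge, or its inverse, cancels the end of a long
  edge and puts in its place the end of the edge 13 or 02 at that puncture. So all three terms of
  the bulk relation have equal weight at every gate.\<close>

lemma bulk_weights:
  fixes i :: nat and g :: gate
  defines "l \<equiv> \<lambda>j k. long_wt i j k g" and "s \<equiv> \<lambda>p x. short_wt i p x g"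
  shows "l 0 3 + s 3 2 + s 0 1 + (l 1 2 + s 2 3 + s 1 0) = l 1 3 + l 0 2"
    and "l 0 1 - s 0 3 - s 1 2 + (l 2 3 - s 2 1 - s 3 0) = l 1 3 + l 0 2"
  unfolding assms long_wt_def short_wt_def third_fourth_values by simp_all


section \<open>Balanced tensor products\<close>

text \<open>Closure of the two actions is what places the balancing relators in the free abelian
  group on pairs.\<close>

locale tensor_product = A: comm_group A + B: comm_group B
  for R :: "('r, 'x) ring_scheme"
    and A :: "('a, 'y) monoid_scheme" and ra :: "'a \<Rightarrow> 'r \<Rightarrow> 'a"
    and B :: "('b, 'z) monoid_scheme" and lb :: "'r \<Rightarrow> 'b \<Rightarrow> 'b" +
  assumes ra_closed: "a \<in> carrier A \<Longrightarrow> r \<in> carrier R \<Longrightarrow> ra a r \<in> carrier A"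
    and lb_closed: "r \<in> carrier R \<Longrightarrow> b \<in> carrier B \<Longrightarrow> lb r b \<in> carrier B"
begin

abbreviation (input) "pairs \<equiv> carrier A \<times> carrier B"
abbreviation (input) "null \<equiv> tensor_null R A ra B lb"
abbreviation (input) "cls \<equiv> tensor_class R A ra B lb"

interpretation F: comm_group "free_Abelian_group pairs"
  by (rule abelian_free_Abelian_group)

definition "null_gens =
  {frag_of (a \<otimes>\<^bsub>A\<^esub> a', b) - frag_of (a, b) - frag_of (a', b) | a a' b.
     a \<in> carrier A \<and> a' \<in> carrier A \<and> b \<in> carrier B} \<union>
  {frag_of (a, b \<otimes>\<^bsub>B\<^esub> b') - frag_of (a, b) - frag_of (a, b') | a b b'.
     a \<in> carrier A \<and> b \<in> carrier B \<and> b' \<in> carrier B} \<union>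
  {frag_of (ra a r, b) - frag_of (a, lb r b) | a r b.
     a \<in> carrier A \<and> r \<in> carrier R \<and> b \<in> carrier B}"

lemma null_eq: "null = generate (free_Abelian_group pairs) null_gens"
  unfolding tensor_null_def null_gens_def ..

lemma null_gens_closed: "null_gens \<subseteq> carrier (free_Abelian_group pairs)"
proof
  have diff: "u - v \<in> carrier (free_Abelian_group pairs)"
    if "u \<in> carrier (free_Abelian_group pairs)" "v \<in> carrier (free_Abelian_group pairs)" for u v
    using that keys_diff [of u v] by auto
  fix x assume "x \<in> null_gens"
  then show "x \<in> carrier (free_Abelian_group pairs)"
    unfolding null_gens_def
    by (elim UnE CollectE exE conjE)
      (simp_all add: diff ra_closed lb_closed del: carrier_free_Abelian_group_iff)
qed

lemma null_subgroup: "subgroup null (free_Abelian_group pairs)"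
  unfolding null_eq by (rule F.generate_is_subgroup [OF null_gens_closed])

lemma null_keys: "x \<in> null \<Longrightarrow> Poly_Mapping.keys x \<subseteq> pairs"
  using subgroup.mem_carrier [OF null_subgroup] by simp

lemma null_zero: "0 \<in> null"
  using subgroup.one_closed [OF null_subgroup] by simp

lemma null_add: "x \<in> null \<Longrightarrow> y \<in> null \<Longrightarrow> x + y \<in> null"
  using subgroup.m_closed [OF null_subgroup] by simp

lemma null_minus: "x \<in> null \<Longrightarrow> - x \<in> null"
  using subgroup.m_inv_closed [OF null_subgroup] null_keys by force

lemma null_diff: "x \<in> null \<Longrightarrow> y \<in> null \<Longrightarrow> x - y \<in> null"
  using null_add null_minus by force

lemma null_add_left:
  "a \<in> carrier A \<Longrightarrow> a' \<in> carrier A \<Longrightarrow> b \<in> carrier B \<Longrightarrow>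
    frag_of (a \<otimes>\<^bsub>A\<^esub> a', b) - frag_of (a, b) - frag_of (a', b) \<in> null"
  unfolding null_eq null_gens_def by (rule generate.incl) blast

lemma null_add_right:
  "a \<in> carrier A \<Longrightarrow> b \<in> carrier B \<Longrightarrow> b' \<in> carrier B \<Longrightarrow>
    frag_of (a, b \<otimes>\<^bsub>B\<^esub> b') - frag_of (a, b) - frag_of (a, b') \<in> null"
  unfolding null_eq null_gens_def by (rule generate.incl) blast

lemma null_balanced:
  "a \<in> carrier A \<Longrightarrow> r \<in> carrier R \<Longrightarrow> b \<in> carrier B \<Longrightarrow>
    frag_of (ra a r, b) - frag_of (a, lb r b) \<in> null"
  unfolding null_eq null_gens_def by (rule generate.incl) blast

text \<open>The additivity relator for the unit added to itself collapses to minus this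
  symbol.\<close>

lemma null_one_right: "a \<in> carrier A \<Longrightarrow> frag_of (a, \<one>\<^bsub>B\<^esub>) \<in> null"
  using null_minus [OF null_add_right [of a "\<one>\<^bsub>B\<^esub>" "\<one>\<^bsub>B\<^esub>"]] by simp

lemma null_one_left: "b \<in> carrier B \<Longrightarrow> frag_of (\<one>\<^bsub>A\<^esub>, b) \<in> null"
  using null_minus [OF null_add_left [of "\<one>\<^bsub>A\<^esub>" "\<one>\<^bsub>A\<^esub>"]] by simp

text \<open>A relative universal property: the relators need only go into a subgroup
  \<open>N\<close> of the target, so no quotient by \<open>N\<close> has to be formed. It is applied
  with \<open>N\<close> the relators themselves, with \<open>I_thr T D\<close>, and with the joint
  ideal.\<close>

lemma null_least:
  assumes "group G" and h: "h \<in> hom (free_Abelian_group pairs) G" and N: "subgroup N G"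
    and "\<And>a a' b. a \<in> carrier A \<Longrightarrow> a' \<in> carrier A \<Longrightarrow> b \<in> carrier B \<Longrightarrow>
      h (frag_of (a \<otimes>\<^bsub>A\<^esub> a', b) - frag_of (a, b) - frag_of (a', b)) \<in> N"
    and "\<And>a b b'. a \<in> carrier A \<Longrightarrow> b \<in> carrier B \<Longrightarrow> b' \<in> carrier B \<Longrightarrow>
      h (frag_of (a, b \<otimes>\<^bsub>B\<^esub> b') - frag_of (a, b) - frag_of (a, b')) \<in> N"
    and "\<And>a r b. a \<in> carrier A \<Longrightarrow> r \<in> carrier R \<Longrightarrow> b \<in> carrier B \<Longrightarrow>
      h (frag_of (ra a r, b) - frag_of (a, lb r b)) \<in> N"
    and x: "x \<in> null"
  shows "h x \<in> N"
proof -
  interpret h: group_hom "free_Abelian_group pairs" G h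
    using assms by (simp add: group_hom_def group_hom_axioms_def)
  have gens: "h x \<in> N" if "x \<in> null_gens" for x
    using that assms(4-6) unfolding null_gens_def by (elim UnE CollectE exE conjE) simp_all
  \<comment> \<open>Since \<open>h\<close> is a homomorphism on the carrier only, membership is
    carried along in the induction.\<close>
  have "x \<in> carrier (free_Abelian_group pairs) \<and> h x \<in> N"
    using x unfolding null_eq
  proof (induction rule: generate.induct)
    case one
    then show ?case
      using h.hom_one subgroup.one_closed [OF N] by simp
  next
    case (incl x)
    then show ?case using null_gens_closed gens by blast
  next
    case (inv x)
    then have "x \<in> carrier (free_Abelian_group pairs)" "h x \<in> N"
      using null_gens_closed gens by blast+
    then show ?case
      using subgroup.m_inv_closed [OF N] by (simp del: inv_free_Abelian_group carrier_free_Abelian_group_iff)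
  next
    case (eng x y)
    then show ?case
      using subgroup.m_closed [OF N] by (simp del: mult_free_Abelian_group carrier_free_Abelian_group_iff)
  qed
  then show ?thesis ..
qed

lemma class_eq: "cls x = (\<lambda>n. n + x) ` null"
  by (auto simp: tensor_class_def r_coset_def)

lemma class_eq_iff: "cls x = cls y \<longleftrightarrow> x - y \<in> null"
proof
  assume "cls x = cls y"
  then have "x \<in> (\<lambda>n. n + y) ` null"
    unfolding class_eq using null_zero by force
  then show "x - y \<in> null" by auto
next
  assume *: "x - y \<in> null"
  have "n + x \<in> (\<lambda>n. n + y) ` null" if "n \<in> null" for n
    using null_add [OF that *] by (intro image_eqI [where x = "n + (x - y)"]) auto
  moreover have "n + y \<in> (\<lambda>n. n + x) ` null" if "n \<in> null" for n
    using null_diff [OF that *] by (intro image_eqI [where x = "n - (x - y)"]) auto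
  ultimately show "cls x = cls y"
    unfolding class_eq by blast
qed

lemma null_normal: "null \<lhd> free_Abelian_group pairs"
  by (rule F.subgroup_imp_normal [OF null_subgroup])

lemma tensor_comm_group: "comm_group (tensor_group R A ra B lb)"
  unfolding tensor_group_def by (rule F.abelian_FactGroup [OF null_subgroup])

lemma tensor_carrier:
  "carrier (tensor_group R A ra B lb) = cls ` {x. Poly_Mapping.keys x \<subseteq> pairs}"
  unfolding tensor_group_def carrier_FactGroup tensor_class_def by auto

lemma tensor_one: "\<one>\<^bsub>tensor_group R A ra B lb\<^esub> = null"
  by (simp add: tensor_group_def)

lemma class_null: "cls 0 = null"
  by (simp add: class_eq)

lemma class_eq_one_iff: "cls x = \<one>\<^bsub>tensor_group R A ra B lb\<^esub> \<longleftrightarrow> x \<in> null"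
  using class_eq_iff [of x 0] by (simp add: tensor_one class_null)

lemma class_add:
  "Poly_Mapping.keys x \<subseteq> pairs \<Longrightarrow> Poly_Mapping.keys y \<subseteq> pairs \<Longrightarrow>
    cls x \<otimes>\<^bsub>tensor_group R A ra B lb\<^esub> cls y = cls (x + y)"
  using normal.rcos_sum [OF null_normal, of x y] by (simp add: tensor_group_def tensor_class_def)

lemma keys_frag_map:
  assumes "f \<in> carrier A \<rightarrow> carrier A" "g \<in> carrier B \<rightarrow> carrier B" "Poly_Mapping.keys x \<subseteq> pairs"
  shows "Poly_Mapping.keys (frag_extend (\<lambda>(a, b). frag_of (f a, g b)) x) \<subseteq> pairs"
proof (rule order_trans [OF keys_frag_extend])
  show "(\<Union>u\<in>Poly_Mapping.keys x. Poly_Mapping.keys (case u of (a, b) \<Rightarrow> frag_of (f a, g b))) \<subseteq> pairs"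
    using assms by (auto simp: Pi_iff split: prod.splits)
qed

text \<open>\<open>tensor_map\<close> is a union over all representatives of a coset. It is a single
  coset because linearity of \<open>f\<close> and \<open>g\<close> over \<open>R\<close> makes the
  induced map on symbols send relators to relators.\<close>

lemma tensor_map_class:
  assumes f: "f \<in> hom A A" and g: "g \<in> hom B B"
    and fr: "\<And>a r. a \<in> carrier A \<Longrightarrow> r \<in> carrier R \<Longrightarrow> f (ra a r) = ra (f a) r"
    and gr: "\<And>r b. r \<in> carrier R \<Longrightarrow> b \<in> carrier B \<Longrightarrow> g (lb r b) = lb r (g b)"
  shows "tensor_map R A ra B lb f g (cls x) =
    cls (frag_extend (\<lambda>(a, b). frag_of (f a, g b)) x)"
proof -
  let ?E = "frag_extend (\<lambda>(a, b). frag_of (f a, g b))"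
  have fA: "f a \<in> carrier A" if "a \<in> carrier A" for a using hom_in_carrier [OF f that] .
  have gB: "g b \<in> carrier B" if "b \<in> carrier B" for b using hom_in_carrier [OF g that] .
  have hom: "?E \<in> hom (free_Abelian_group pairs) (free_Abelian_group pairs)"
  proof (rule homI)
    show "?E x \<in> carrier (free_Abelian_group pairs)" if "x \<in> carrier (free_Abelian_group pairs)" for x
      using that unfolding carrier_free_Abelian_group_iff
      by (intro keys_frag_map) (simp_all add: Pi_iff fA gB)
  qed (simp add: frag_extend_add)
  have null: "?E n \<in> null" if "n \<in> null" for n
  proof (rule null_least [OF group_free_Abelian_group hom null_subgroup _ _ _ that])
    fix a a' b assume "a \<in> carrier A" "a' \<in> carrier A" "b \<in> carrier B"
    then show "?E (frag_of (a \<otimes>\<^bsub>A\<^esub> a', b) - frag_of (a, b) - frag_of (a', b)) \<in> null"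
      by (simp add: frag_extend_diff hom_mult [OF f] null_add_left fA gB)
  next
    fix a b b' assume "a \<in> carrier A" "b \<in> carrier B" "b' \<in> carrier B"
    then show "?E (frag_of (a, b \<otimes>\<^bsub>B\<^esub> b') - frag_of (a, b) - frag_of (a, b')) \<in> null"
      by (simp add: frag_extend_diff hom_mult [OF g] null_add_right fA gB)
  next
    fix a r b assume "a \<in> carrier A" "r \<in> carrier R" "b \<in> carrier B"
    then show "?E (frag_of (ra a r, b) - frag_of (a, lb r b)) \<in> null"
      by (simp add: frag_extend_diff fr gr null_balanced fA gB)
  qed
  \<comment> \<open>All members of the union coincide, as \<open>z\<close> and \<open>x\<close>
    differ by an element of the null subgroup.\<close>
  have const: "cls (?E z) = cls (?E x)" if "z \<in> cls x" for z
  proof -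
    from that obtain n where "n \<in> null" "z = n + x"
      unfolding class_eq by blast
    then show ?thesis
      using null by (simp add: class_eq_iff frag_extend_add)
  qed
  have "x \<in> cls x"
    unfolding class_eq by (rule image_eqI [OF _ null_zero]) simp
  then have "(\<Union>z\<in>cls x. cls (?E z)) = cls (?E x)"
    using const by (intro UN_constant_eq ballI)
  then show ?thesis
    unfolding tensor_map_def .
qed

end


section \<open>Weights\<close>

lemma qh_nonzero: "qh \<noteq> 0"
  by (simp add: qh_def Zero_fract_def eq_fract)

lemma ring_of_type_algebra_simps:
  "carrier ring_of_type_algebra = UNIV"
  "x \<otimes>\<^bsub>ring_of_type_algebra\<^esub> y = x * y"
  "x \<oplus>\<^bsub>ring_of_type_algebra\<^esub> y = x + y"
  "\<one>\<^bsub>ring_of_type_algebra\<^esub> = 1"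
  "\<zero>\<^bsub>ring_of_type_algebra\<^esub> = 0"
  by (simp_all add: ring_of_type_algebra_def)

locale skein_torus =
  fixes K :: "(real^4) set"
    and T :: triangulation
    and h :: "nat \<times> (real^4) \<Rightarrow> real^4"
    and D :: "'a skein_data"
  assumes tri: "ideal_triangulation K T h"
    and skein: "parabolic_skein_torus K T h D"
begin

lemma torus: "quantum_torus (alg D) (scal D) (long_gens T D \<union> short_gens T D \<union> thread_gens T D)"
  using skein by (simp only: parabolic_skein_torus_def)

sublocale A: ring "alg D"
  using torus unfolding quantum_torus_def by (elim conjE) blast

lemma scal_hom: "scal D \<in> ring_hom coeff_ring (alg D)"
  using torus unfolding quantum_torus_def by (elim conjE) blast

lemma scal_closed [simp, intro]: "scal D c \<in> carrier (alg D)"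
  using ring_hom_closed [OF scal_hom] by (simp add: ring_of_type_algebra_simps)

lemma scal_mult: "scal D (c * d) = scal D c \<otimes>\<^bsub>alg D\<^esub> scal D d"
  using ring_hom_mult [OF scal_hom] by (simp add: ring_of_type_algebra_simps)

lemma scal_add: "scal D (c + d) = scal D c \<oplus>\<^bsub>alg D\<^esub> scal D d"
  using ring_hom_add [OF scal_hom] by (simp add: ring_of_type_algebra_simps)

lemma scal_one: "scal D 1 = \<one>\<^bsub>alg D\<^esub>"
  using ring_hom_one [OF scal_hom] by (simp add: ring_of_type_algebra_simps)

lemma scal_zero: "scal D 0 = \<zero>\<^bsub>alg D\<^esub>"
  using ring_hom_zero [OF scal_hom ring_from_type_algebra A.ring_axioms]
  by (simp add: ring_of_type_algebra_simps)

lemma scal_central: "w \<in> carrier (alg D) \<Longrightarrow> scal D c \<otimes>\<^bsub>alg D\<^esub> w = w \<otimes>\<^bsub>alg D\<^esub> scal D c"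
  using torus unfolding quantum_torus_def by (elim conjE) simp

lemma scal_Units: "c \<noteq> 0 \<Longrightarrow> scal D c \<in> Units (alg D)"
  by (auto simp: Units_def scal_mult [symmetric] scal_one intro!: bexI [of _ "scal D (inverse c)"])

lemma gens_Units: "long_gens T D \<union> short_gens T D \<union> thread_gens T D \<subseteq> Units (alg D)"
  using torus unfolding quantum_torus_def by (elim conjE) blast

lemma long_Units: "i < ntet T \<Longrightarrow> j < k \<Longrightarrow> long D i j k \<in> Units (alg D)"
  using gens_Units unfolding long_gens_def by blast

lemma short_Units: "i < ntet T \<Longrightarrow> p \<noteq> x \<Longrightarrow> short D i p x \<in> Units (alg D)"
  using gens_Units unfolding short_gens_def by blast

lemma thread_Units: "g \<in> gates T \<Longrightarrow> thread D g \<in> Units (alg D)"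
  using gens_Units unfolding thread_gens_def by blast

lemma tori: "gate_tori_act T D"
  using skein by (simp only: parabolic_skein_torus_def)

text \<open>The weight is tested at a single scalar \<open>z\<close>, so \<open>k\<close> need not
  be determined by \<open>u\<close> (at \<open>z = 1\<close> every \<open>k\<close> fits). Weight 0
  for all gates and all nonzero \<open>z\<close> characterises \<open>W_inv T D\<close>.\<close>

definition has_weight :: "gate \<Rightarrow> coeff \<Rightarrow> 'a \<Rightarrow> int \<Rightarrow> bool" where
  "has_weight g z u k \<longleftrightarrow> u \<in> carrier (alg D) \<and>
     torus D g z u = scal D (z powi k) \<otimes>\<^bsub>alg D\<^esub> u"

context
  fixes g :: gate and z :: coeff
  assumes g: "g \<in> gates T" and z: "z \<noteq> 0"
begin

lemma torus_hom: "torus D g z \<in> ring_hom (alg D) (alg D)"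
  using tori g z by (simp add: gate_tori_act_def)

lemma torus_scal: "torus D g z (scal D c) = scal D c"
  using tori g z by (simp add: gate_tori_act_def)

lemma weight_long: "i < ntet T \<Longrightarrow> j < k \<Longrightarrow> has_weight g z (long D i j k) (long_wt i j k g)"
  using tori g z by (simp add: gate_tori_act_def has_weight_def long_Units A.Units_closed)

lemma weight_short: "i < ntet T \<Longrightarrow> p \<noteq> x \<Longrightarrow> has_weight g z (short D i p x) (short_wt i p x g)"
  using tori g z by (simp add: gate_tori_act_def has_weight_def short_Units A.Units_closed)

lemma weight_scal: "has_weight g z (scal D c) 0"
  by (simp add: has_weight_def torus_scal scal_one)

lemma weight_mult:
  assumes "has_weight g z u k" "has_weight g z v l"
  shows "has_weight g z (u \<otimes>\<^bsub>alg D\<^esub> v) (k + l)"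
proof -
  have uv: "u \<in> carrier (alg D)" "v \<in> carrier (alg D)"
    using assms by (simp_all add: has_weight_def)
  have "torus D g z (u \<otimes>\<^bsub>alg D\<^esub> v) =
      (scal D (z powi k) \<otimes>\<^bsub>alg D\<^esub> u) \<otimes>\<^bsub>alg D\<^esub> (scal D (z powi l) \<otimes>\<^bsub>alg D\<^esub> v)"
    using assms ring_hom_mult [OF torus_hom uv] by (simp add: has_weight_def)
  also have "\<dots> = scal D (z powi k) \<otimes>\<^bsub>alg D\<^esub> ((u \<otimes>\<^bsub>alg D\<^esub> scal D (z powi l)) \<otimes>\<^bsub>alg D\<^esub> v)"
    using uv by (simp add: A.m_assoc)
  also have "\<dots> = scal D (z powi k) \<otimes>\<^bsub>alg D\<^esub> ((scal D (z powi l) \<otimes>\<^bsub>alg D\<^esub> u) \<otimes>\<^bsub>alg D\<^esub> v)"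
    by (simp only: scal_central [OF uv(1)])
  also have "\<dots> = scal D (z powi (k + l)) \<otimes>\<^bsub>alg D\<^esub> (u \<otimes>\<^bsub>alg D\<^esub> v)"
    using uv z by (simp add: A.m_assoc power_int_add scal_mult)
  finally show ?thesis
    using uv by (simp add: has_weight_def)
qed

lemma weight_add:
  assumes "has_weight g z u k" "has_weight g z v k"
  shows "has_weight g z (u \<oplus>\<^bsub>alg D\<^esub> v) k"
  using assms ring_hom_add [OF torus_hom, of u v] by (simp add: has_weight_def A.r_distr)

text \<open>The torus fixes the unit, so the image of the inverse is a left inverse of a scalar
  multiple of \<open>u\<close>, and this can be solved for.\<close>

lemma weight_inv:
  assumes u: "u \<in> Units (alg D)" and k: "has_weight g z u k"
  shows "has_weight g z (inv\<^bsub>alg D\<^esub> u) (- k)"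
proof -
  have uc: "u \<in> carrier (alg D)" "inv\<^bsub>alg D\<^esub> u \<in> carrier (alg D)"
    using u by auto
  define v where "v = torus D g z (inv\<^bsub>alg D\<^esub> u)"
  have v: "v \<in> carrier (alg D)"
    using ring_hom_closed [OF torus_hom] uc by (simp add: v_def)
  have "v \<otimes>\<^bsub>alg D\<^esub> torus D g z u = \<one>\<^bsub>alg D\<^esub>"
    unfolding v_def
    using ring_hom_mult [OF torus_hom uc(2,1)] ring_hom_one [OF torus_hom] u by simp
  then have one: "v \<otimes>\<^bsub>alg D\<^esub> (scal D (z powi k) \<otimes>\<^bsub>alg D\<^esub> u) = \<one>\<^bsub>alg D\<^esub>"
    using k by (simp add: has_weight_def)
  \<comment> \<open>The scalar and its inverse and \<open>u\<close> and its inverse are inserted so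
    that the factor known to be one by \<open>one\<close> can be split off.\<close>
  have "v = v \<otimes>\<^bsub>alg D\<^esub> (scal D (z powi k * z powi (- k)) \<otimes>\<^bsub>alg D\<^esub> (u \<otimes>\<^bsub>alg D\<^esub> inv\<^bsub>alg D\<^esub> u))"
    using v u z by (simp add: power_int_minus scal_one)
  also have "\<dots> = v \<otimes>\<^bsub>alg D\<^esub> (scal D (z powi k) \<otimes>\<^bsub>alg D\<^esub> u) \<otimes>\<^bsub>alg D\<^esub>
      (scal D (z powi (- k)) \<otimes>\<^bsub>alg D\<^esub> inv\<^bsub>alg D\<^esub> u)"
    (is "_ = ?w")
  proof -
    have "?w = v \<otimes>\<^bsub>alg D\<^esub> (scal D (z powi k) \<otimes>\<^bsub>alg D\<^esub>
        ((u \<otimes>\<^bsub>alg D\<^esub> scal D (z powi (- k))) \<otimes>\<^bsub>alg D\<^esub> inv\<^bsub>alg D\<^esub> u))"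
      using v uc by (simp add: A.m_assoc)
    also have "\<dots> = v \<otimes>\<^bsub>alg D\<^esub> (scal D (z powi k) \<otimes>\<^bsub>alg D\<^esub>
        ((scal D (z powi (- k)) \<otimes>\<^bsub>alg D\<^esub> u) \<otimes>\<^bsub>alg D\<^esub> inv\<^bsub>alg D\<^esub> u))"
      by (simp only: scal_central [OF uc(1)])
    finally show ?thesis
      using v uc by (simp add: A.m_assoc scal_mult del: A.Units_r_inv)
  qed
  also have "\<dots> = scal D (z powi (- k)) \<otimes>\<^bsub>alg D\<^esub> inv\<^bsub>alg D\<^esub> u"
    unfolding one using uc by simp
  finally show ?thesis
    using uc by (simp add: has_weight_def v_def)
qed

end

section \<open>The weight-zero subalgebra and the bulk relations in it\<close>

lemma W_inv_sel:
  "carrier (W_inv T D) \<subseteq> carrier (alg D)"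
  "monoid.mult (W_inv T D) = monoid.mult (alg D)" "\<one>\<^bsub>W_inv T D\<^esub> = \<one>\<^bsub>alg D\<^esub>"
  "add (W_inv T D) = add (alg D)" "\<zero>\<^bsub>W_inv T D\<^esub> = \<zero>\<^bsub>alg D\<^esub>"
  by (auto simp: W_inv_def)

lemma W_invI:
  assumes "w \<in> carrier (alg D)" "\<And>g z. g \<in> gates T \<Longrightarrow> z \<noteq> 0 \<Longrightarrow> has_weight g z w 0"
  shows "w \<in> carrier (W_inv T D)"
  using assms by (simp add: W_inv_def has_weight_def scal_one)

lemma W_invD: "w \<in> carrier (W_inv T D) \<Longrightarrow> g \<in> gates T \<Longrightarrow> z \<noteq> 0 \<Longrightarrow> has_weight g z w 0"
  by (simp add: W_inv_def has_weight_def scal_one)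

lemma W_inv_subring: "subring (carrier (W_inv T D)) (alg D)"
proof (rule A.subringI)
  show "\<one>\<^bsub>alg D\<^esub> \<in> carrier (W_inv T D)"
    using weight_scal [of _ _ 1] by (intro W_invI) (simp_all add: scal_one)
  fix u v assume uv: "u \<in> carrier (W_inv T D)" "v \<in> carrier (W_inv T D)"
  then have uvA: "u \<in> carrier (alg D)" "v \<in> carrier (alg D)"
    using W_inv_sel(1) by auto
  show "u \<otimes>\<^bsub>alg D\<^esub> v \<in> carrier (W_inv T D)"
    using weight_mult [OF _ _ W_invD W_invD, of _ _ u v] uv uvA by (intro W_invI) simp_all
  show "u \<oplus>\<^bsub>alg D\<^esub> v \<in> carrier (W_inv T D)"
    using weight_add [OF _ _ W_invD W_invD, of _ _ u v] uv uvA by (intro W_invI) simp_all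
next
  fix u assume u: "u \<in> carrier (W_inv T D)"
  then have uA: "u \<in> carrier (alg D)"
    using W_inv_sel(1) by auto
  \<comment> \<open>Negation is multiplication by a scalar, which has weight 0, so it is covered by
    \<open>weight_mult\<close>.\<close>
  have "\<ominus>\<^bsub>alg D\<^esub> u = scal D (- 1) \<otimes>\<^bsub>alg D\<^esub> u"
  proof (rule A.minus_equality)
    have "scal D (- 1) \<otimes>\<^bsub>alg D\<^esub> u \<oplus>\<^bsub>alg D\<^esub> u = scal D (- 1 + 1) \<otimes>\<^bsub>alg D\<^esub> u"
      unfolding scal_add using uA by (simp add: A.l_distr scal_one)
    then show "scal D (- 1) \<otimes>\<^bsub>alg D\<^esub> u \<oplus>\<^bsub>alg D\<^esub> u = \<zero>\<^bsub>alg D\<^esub>"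
      using uA by (simp add: scal_zero)
  qed (use uA in auto)
  with weight_mult [OF _ _ weight_scal W_invD, of _ _ u "- 1"] u uA
  show "\<ominus>\<^bsub>alg D\<^esub> u \<in> carrier (W_inv T D)"
    by (intro W_invI) auto
qed (use W_inv_sel in auto)

text \<open>The hypotheses describe the tori on generators; that the rescaled relations are
  invariant is a weight count. It makes the generated left ideal a subgroup of
  \<open>W_inv T D\<close>.\<close>

lemma bulk_rels_closed: "bulk_rels T D \<subseteq> carrier (W_inv T D)"
proof
  fix b assume "b \<in> bulk_rels T D"
  then obtain i where i: "i < ntet T"
    and b: "b = inv\<^bsub>alg D\<^esub> (long D i 1 3 \<otimes>\<^bsub>alg D\<^esub> long D i 0 2) \<otimes>\<^bsub>alg D\<^esub> bulk_rel D i"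
    unfolding bulk_rels_def by blast
  have u: "long D i 1 3 \<otimes>\<^bsub>alg D\<^esub> long D i 0 2 \<in> Units (alg D)"
    using i by (simp add: long_Units four_less)
  have wt: "has_weight g z b 0" if gz: "g \<in> gates T" "z \<noteq> 0" for g z
  proof -
    note l = weight_long [OF gz i four_less(1)] weight_long [OF gz i four_less(2)]
      weight_long [OF gz i four_less(3)] weight_long [OF gz i four_less(4)]
      weight_long [OF gz i four_less(5)] weight_long [OF gz i four_less(6)]
    have s: "has_weight g z (short D i p x) (short_wt i p x g)"
      "has_weight g z (inv\<^bsub>alg D\<^esub> (short D i p x)) (- short_wt i p x g)" if "p \<noteq> x" for p x
      using weight_short [OF gz i that] weight_inv [OF gz short_Units [OF i that]] by simp_all
    note m = weight_mult [OF gz]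
    let ?k = "long_wt i 1 3 g + long_wt i 0 2 g"
    \<comment> \<open>\<open>?k\<close> is the weight of the product of the edges 13 and 02, by
      which the relation is divided.\<close>
    have "has_weight g z (bulk_rel D i) ?k"
      unfolding bulk_rel_def Let_def
    proof (intro weight_add [OF gz])
      show "has_weight g z (scal D (qh ^ 3) \<otimes>\<^bsub>alg D\<^esub> (long D i 1 3 \<otimes>\<^bsub>alg D\<^esub> long D i 0 2)) ?k"
        using m [OF weight_scal [OF gz] m [OF l(5) l(2)]] by simp
      \<comment> \<open>The weight is first displayed with the bracketing of the product, so that
        the rules apply factor by factor, and only then simplified by
        \<open>bulk_weights\<close>.\<close>
      have "has_weight g z (scal D (qh ^ 5) \<otimes>\<^bsub>alg D\<^esub>
        ((long D i 0 3 \<otimes>\<^bsub>alg D\<^esub> short D i 3 2 \<otimes>\<^bsub>alg D\<^esub> short D i 0 1) \<otimes>\<^bsub>alg D\<^esub>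
         (long D i 1 2 \<otimes>\<^bsub>alg D\<^esub> short D i 2 3 \<otimes>\<^bsub>alg D\<^esub> short D i 1 0)))
        (0 + (long_wt i 0 3 g + short_wt i 3 2 g + short_wt i 0 1 g +
          (long_wt i 1 2 g + short_wt i 2 3 g + short_wt i 1 0 g)))"
        by (intro m l s weight_scal [OF gz]) simp_all
      then show "has_weight g z (scal D (qh ^ 5) \<otimes>\<^bsub>alg D\<^esub>
        ((long D i 0 3 \<otimes>\<^bsub>alg D\<^esub> short D i 3 2 \<otimes>\<^bsub>alg D\<^esub> short D i 0 1) \<otimes>\<^bsub>alg D\<^esub>
         (long D i 1 2 \<otimes>\<^bsub>alg D\<^esub> short D i 2 3 \<otimes>\<^bsub>alg D\<^esub> short D i 1 0))) ?k"
        unfolding bulk_weights by simp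
      have "has_weight g z (scal D (qh ^ 3) \<otimes>\<^bsub>alg D\<^esub>
        ((long D i 0 1 \<otimes>\<^bsub>alg D\<^esub> inv\<^bsub>alg D\<^esub> (short D i 0 3) \<otimes>\<^bsub>alg D\<^esub> inv\<^bsub>alg D\<^esub> (short D i 1 2)) \<otimes>\<^bsub>alg D\<^esub>
         (long D i 2 3 \<otimes>\<^bsub>alg D\<^esub> inv\<^bsub>alg D\<^esub> (short D i 2 1) \<otimes>\<^bsub>alg D\<^esub> inv\<^bsub>alg D\<^esub> (short D i 3 0))))
        (0 + (long_wt i 0 1 g + - short_wt i 0 3 g + - short_wt i 1 2 g +
          (long_wt i 2 3 g + - short_wt i 2 1 g + - short_wt i 3 0 g)))"
        by (intro m l s weight_scal [OF gz]) simp_all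
      then show "has_weight g z (scal D (qh ^ 3) \<otimes>\<^bsub>alg D\<^esub>
        ((long D i 0 1 \<otimes>\<^bsub>alg D\<^esub> inv\<^bsub>alg D\<^esub> (short D i 0 3) \<otimes>\<^bsub>alg D\<^esub> inv\<^bsub>alg D\<^esub> (short D i 1 2)) \<otimes>\<^bsub>alg D\<^esub>
         (long D i 2 3 \<otimes>\<^bsub>alg D\<^esub> inv\<^bsub>alg D\<^esub> (short D i 2 1) \<otimes>\<^bsub>alg D\<^esub> inv\<^bsub>alg D\<^esub> (short D i 3 0)))) ?k"
        using bulk_weights(2) [of i g] by simp
    qed
    from m [OF weight_inv [OF gz u m [OF l(5) l(2)]] this] show ?thesis
      by (simp add: b)
  qed
  moreover have "b \<in> carrier (alg D)"
    using i u by (auto simp: b bulk_rel_def Let_def long_Units short_Units four_less A.Units_closed)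
  ultimately show "b \<in> carrier (W_inv T D)"
    by (intro W_invI)
qed

end


section \<open>Monodromies and the joint ideal\<close>

lemma next_corner_gates:
  assumes "oriented_gluing T" "g \<in> gates T"
  shows "next_corner T g \<in> gates T"
proof -
  obtain i p e where g: "g = (i, p, e)" "i < ntet T" "p \<noteq> e"
    using assms(2) by (auto simp: gates_def)
  obtain j s where gl: "glue T i (third p e) = (j, s)" by (cases "glue T i (third p e)")
  then have "j < ntet T" "bij s"
    using assms(1) g unfolding oriented_gluing_def by blast+
  with g gl show ?thesis
    by (simp add: next_corner_def gates_def bij_is_inj inj_eq)
qed

context skein_torus
begin

sublocale W: ring "W_inv T D"
  using A.subring_is_ring [OF W_inv_subring] by (simp add: W_inv_def)

lemma W_carrier: "w \<in> carrier (W_inv T D) \<Longrightarrow> w \<in> carrier (alg D)"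
  using W_inv_sel(1) by blast

lemma W_closed:
  "\<one>\<^bsub>alg D\<^esub> \<in> carrier (W_inv T D)" "\<zero>\<^bsub>alg D\<^esub> \<in> carrier (W_inv T D)"
  "x \<in> carrier (W_inv T D) \<Longrightarrow> y \<in> carrier (W_inv T D) \<Longrightarrow> x \<otimes>\<^bsub>alg D\<^esub> y \<in> carrier (W_inv T D)"
  "x \<in> carrier (W_inv T D) \<Longrightarrow> y \<in> carrier (W_inv T D) \<Longrightarrow> x \<oplus>\<^bsub>alg D\<^esub> y \<in> carrier (W_inv T D)"
  "x \<in> carrier (W_inv T D) \<Longrightarrow> \<ominus>\<^bsub>alg D\<^esub> x \<in> carrier (W_inv T D)"
  "x \<in> carrier (W_inv T D) \<Longrightarrow> y \<in> carrier (W_inv T D) \<Longrightarrow> x \<ominus>\<^bsub>alg D\<^esub> y \<in> carrier (W_inv T D)"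
  using subringE [OF W_inv_subring] by (auto simp: a_minus_def)

text \<open>The additive inverse is defined by a description over the carrier, so unlike the
  operations in \<open>W_inv_sel\<close> it does not coincide with that of \<open>alg D\<close> by
  unfolding.\<close>

lemma W_a_inv: "x \<in> carrier (W_inv T D) \<Longrightarrow> \<ominus>\<^bsub>W_inv T D\<^esub> x = \<ominus>\<^bsub>alg D\<^esub> x"
  by (rule W.minus_equality) (simp_all add: W_inv_sel W_closed W_carrier A.l_neg)

lemma W_subgroup:
  assumes "additive_subgroup N (W_inv T D)"
  shows "x \<in> N \<Longrightarrow> x \<in> carrier (W_inv T D)" "\<zero>\<^bsub>alg D\<^esub> \<in> N"
    "x \<in> N \<Longrightarrow> y \<in> N \<Longrightarrow> x \<oplus>\<^bsub>alg D\<^esub> y \<in> N"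
    "x \<in> N \<Longrightarrow> \<ominus>\<^bsub>alg D\<^esub> x \<in> N"
    "x \<in> N \<Longrightarrow> y \<in> N \<Longrightarrow> x \<ominus>\<^bsub>alg D\<^esub> y \<in> N"
proof -
  interpret N: additive_subgroup N "W_inv T D" by (fact assms)
  show car: "x \<in> carrier (W_inv T D)" if "x \<in> N" for x using N.a_subset that by blast
  show add: "x \<oplus>\<^bsub>alg D\<^esub> y \<in> N" if "x \<in> N" "y \<in> N" for x y
    using N.a_closed [OF that] by (simp add: W_inv_sel)
  show neg: "\<ominus>\<^bsub>alg D\<^esub> x \<in> N" if "x \<in> N" for x
    using N.a_inv_closed [OF that] by (simp add: W_a_inv car that)
  show "\<zero>\<^bsub>alg D\<^esub> \<in> N" using N.zero_closed by (simp add: W_inv_sel)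
  show "x \<ominus>\<^bsub>alg D\<^esub> y \<in> N" if "x \<in> N" "y \<in> N"
    using add neg that by (simp add: a_minus_def)
qed

section \<open>Laurent subalgebras: thread monodromies and the boundary torus\<close>

lemma laurent_subalgebra_least:
  assumes "subring E (alg D)" "range (scal D) \<subseteq> E" "U \<subseteq> E" "m_inv (alg D) ` U \<subseteq> E"
  shows "laurent_subalgebra D U \<subseteq> E"
  unfolding laurent_subalgebra_def
  using assms subringE(1) [OF assms(1)] by (intro A.generate_ring_min_subring1) auto

lemma laurent_subalgebra_incl:
  "scal D c \<in> laurent_subalgebra D U"
  "u \<in> U \<Longrightarrow> u \<in> laurent_subalgebra D U"
  "u \<in> U \<Longrightarrow> inv\<^bsub>alg D\<^esub> u \<in> laurent_subalgebra D U"
  unfolding laurent_subalgebra_def by (auto intro: generate_ring.incl)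

lemma laurent_subalgebra_subring:
  assumes "U \<subseteq> carrier (alg D)" "m_inv (alg D) ` U \<subseteq> carrier (alg D)"
  shows "subring (laurent_subalgebra D U) (alg D)"
  unfolding laurent_subalgebra_def using assms by (intro A.generate_ring_is_subring) auto

text \<open>Invariance, also of the inverses, is read off from the presentation of
  \<open>W_inv T D\<close> as a Laurent subalgebra instead of from weights.\<close>

lemma W_inv_generators:
  "scal D c \<in> carrier (W_inv T D)"
  "u \<in> {mer D, lon D} \<union> alphas T D \<union> thread_mons T D \<Longrightarrow> u \<in> carrier (W_inv T D)"
  "u \<in> {mer D, lon D} \<union> alphas T D \<union> thread_mons T D \<Longrightarrow> inv\<^bsub>alg D\<^esub> u \<in> carrier (W_inv T D)"
proof -
  have "\<exists>Y. (\<forall>l\<in>{1..ntet T - 1}. edge_ratio T D (Y l)) \<and>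
        carrier (W_inv T D) = laurent_subalgebra D
          ({mer D, lon D} \<union> alphas T D \<union> thread_mons T D \<union> Y ` {1..ntet T - 1})"
    using skein unfolding parabolic_skein_torus_def by (elim conjE) assumption
  then obtain Y :: "nat \<Rightarrow> 'a" where Y: "carrier (W_inv T D) = laurent_subalgebra D
      ({mer D, lon D} \<union> alphas T D \<union> thread_mons T D \<union> Y ` {1..ntet T - 1})"
    by blast
  show "scal D c \<in> carrier (W_inv T D)"
    unfolding Y by (rule laurent_subalgebra_incl)
  assume "u \<in> {mer D, lon D} \<union> alphas T D \<union> thread_mons T D"
  then show "u \<in> carrier (W_inv T D)" "inv\<^bsub>alg D\<^esub> u \<in> carrier (W_inv T D)"
    unfolding Y by (auto intro: laurent_subalgebra_incl)
qed

lemma laurent_subalgebra_W: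
  assumes "U \<subseteq> {mer D, lon D} \<union> alphas T D \<union> thread_mons T D"
  shows "subring (laurent_subalgebra D U) (alg D)"
    and "laurent_subalgebra D U \<subseteq> carrier (W_inv T D)"
proof -
  have U: "U \<subseteq> carrier (W_inv T D)" "m_inv (alg D) ` U \<subseteq> carrier (W_inv T D)"
    using assms W_inv_generators(2,3) by blast+
  then show "subring (laurent_subalgebra D U) (alg D)"
    using W_inv_sel(1) by (intro laurent_subalgebra_subring) blast+
  have "range (scal D) \<subseteq> carrier (W_inv T D)"
    using W_inv_generators(1) by blast
  with U show "laurent_subalgebra D U \<subseteq> carrier (W_inv T D)"
    by (intro laurent_subalgebra_least [OF W_inv_subring])
qed

abbreviation "thr \<equiv> carrier (W_thr T D)"

lemma thr_eq: "thr = laurent_subalgebra D (thread_mons T D)"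
  by (simp add: W_thr_def)

lemma thr_subring: "subring thr (alg D)"
  unfolding thr_eq by (intro laurent_subalgebra_W) blast

lemma thr_W: "c \<in> thr \<Longrightarrow> c \<in> carrier (W_inv T D)"
  unfolding thr_eq using laurent_subalgebra_W(2) [of "thread_mons T D"] by blast

lemma scal_thr: "scal D c \<in> thr"
  unfolding thr_eq by (rule laurent_subalgebra_incl)

abbreviation "bdry \<equiv> carrier (boundary_torus D)"

lemma bdry_eq: "bdry = laurent_subalgebra D {mer D, lon D}"
  by (simp add: boundary_torus_def)

lemma bdry_subring: "subring bdry (alg D)"
  unfolding bdry_eq by (intro laurent_subalgebra_W) blast

lemma bdry_W: "p \<in> bdry \<Longrightarrow> p \<in> carrier (W_inv T D)"
  unfolding bdry_eq using laurent_subalgebra_W(2) [of "{mer D, lon D}"] by blast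

text \<open>The walk around a defect circle stays among the gates, so the factors are generating
  threads, hence units; the normalising power of \<open>qh\<close> is nonzero.\<close>

lemma thread_mon_Units:
  assumes "j \<in> {1..2 * ntet T}"
  shows "thread_mon T D j \<in> Units (alg D)"
proof -
  have "circ D ` {1..2 * ntet T} \<subseteq> gates T"
    using skein unfolding parabolic_skein_torus_def by (elim conjE) assumption
  then have circ: "circ D j \<in> gates T"
    using assms by blast
  have "oriented_gluing T"
    using tri by (simp add: ideal_triangulation_def)
  then have "(next_corner T ^^ m) (circ D j) \<in> gates T" for m
    by (induction m) (simp_all add: circ next_corner_gates)
  then have "set (circle_threads T D j) \<subseteq> Units (alg D)"
    by (auto simp: circle_threads_def thread_Units)
  then show ?thesis
    unfolding thread_mon_def lattice_product_def
    by (intro A.Units_m_closed scal_Units A.foldr_Units) (simp_all add: qh_nonzero)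
qed

text \<open>A closed walk cuts the skein into short edges, threads and their inverses, all of them
  units.\<close>

lemma carried_by_loop_Units:
  assumes "carried_by_loop T h D P w"
  shows "w \<in> Units (alg D)"
proof -
  obtain ss a where "closed_walk T h ss" "a \<noteq> 0"
    and w: "w = scal D a \<otimes>\<^bsub>alg D\<^esub> foldr (monoid.mult (alg D)) (map (step_elem D) ss) \<one>\<^bsub>alg D\<^esub>"
    using assms unfolding carried_by_loop_def by blast
  have "step_elem D s \<in> Units (alg D)" if "valid_step T s" for s
    using that by (cases s) (simp_all add: short_Units thread_Units)
  then have "set (map (step_elem D) ss) \<subseteq> Units (alg D)"
    using \<open>closed_walk T h ss\<close> by (auto simp: closed_walk_def)
  then show ?thesis
    unfolding w using \<open>a \<noteq> 0\<close> by (intro A.Units_m_closed scal_Units A.foldr_Units)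
qed

lemma mer_lon_Units: "{mer D, lon D} \<subseteq> Units (alg D)"
proof -
  have "carried_by_loop T h D (meridian_loop K T h) (mer D)"
    "carried_by_loop T h D (longitude_loop K T h) (lon D)"
    using skein by (simp_all only: parabolic_skein_torus_def)
  then show ?thesis
    using carried_by_loop_Units by blast
qed

lemma thread_mons_Units: "thread_mons T D \<subseteq> Units (alg D)"
  using thread_mon_Units by (auto simp: thread_mons_def)

text \<open>The centraliser of \<open>V\<close> is a subring containing the scalars,
  \<open>U\<close> and the inverses of \<open>U\<close>.\<close>

lemma laurent_subalgebra_commute:
  assumes "U \<subseteq> Units (alg D)" "V \<subseteq> carrier (alg D)"
    and "\<And>u v. u \<in> U \<Longrightarrow> v \<in> V \<Longrightarrow> u \<otimes>\<^bsub>alg D\<^esub> v = v \<otimes>\<^bsub>alg D\<^esub> u"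
    and x: "x \<in> laurent_subalgebra D U" and v: "v \<in> V"
  shows "x \<otimes>\<^bsub>alg D\<^esub> v = v \<otimes>\<^bsub>alg D\<^esub> x"
proof -
  let ?Z = "{x \<in> carrier (alg D). \<forall>y\<in>V. x \<otimes>\<^bsub>alg D\<^esub> y = y \<otimes>\<^bsub>alg D\<^esub> x}"
  have "laurent_subalgebra D U \<subseteq> ?Z"
  proof (rule laurent_subalgebra_least [OF A.centraliser_subring [OF assms(2)]])
    show "range (scal D) \<subseteq> ?Z"
      using assms(2) scal_central by blast
    show "U \<subseteq> ?Z"
      using assms(1,3) by blast
    have "inv\<^bsub>alg D\<^esub> u \<otimes>\<^bsub>alg D\<^esub> v = v \<otimes>\<^bsub>alg D\<^esub> inv\<^bsub>alg D\<^esub> u" if "u \<in> U" "v \<in> V" for u v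
      using A.Units_commute_inv assms(1-3) that by blast
    then show "m_inv (alg D) ` U \<subseteq> ?Z"
      using assms(1) by blast
  qed
  with x v show ?thesis by blast
qed

text \<open>Two passes through \<open>laurent_subalgebra_commute\<close>: one extends from
  \<open>mer D\<close> and \<open>lon D\<close> to the boundary torus, the other from the thread
  monodromies to the algebra they generate.\<close>

lemma bdry_thr_commute:
  assumes p: "p \<in> bdry" and c: "c \<in> thr"
  shows "p \<otimes>\<^bsub>alg D\<^esub> c = c \<otimes>\<^bsub>alg D\<^esub> p"
proof -
  have comm: "\<forall>r\<in>thread_mons T D. \<forall>w\<in>thread_mons T D \<union> {mer D, lon D}.
      r \<otimes>\<^bsub>alg D\<^esub> w = w \<otimes>\<^bsub>alg D\<^esub> r"
    using skein unfolding parabolic_skein_torus_def by (elim conjE) assumption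
  have "x \<otimes>\<^bsub>alg D\<^esub> r = r \<otimes>\<^bsub>alg D\<^esub> x" if "x \<in> bdry" "r \<in> thread_mons T D" for x r
    using that(1) unfolding bdry_eq
    by (rule laurent_subalgebra_commute [OF mer_lon_Units _ _ _ that(2), rotated -1])
      (use comm thread_mons_Units in auto)
  then have "c \<otimes>\<^bsub>alg D\<^esub> p = p \<otimes>\<^bsub>alg D\<^esub> c"
    using c subringE(1) [OF bdry_subring] unfolding thr_eq
    by (intro laurent_subalgebra_commute [OF thread_mons_Units _ _ _ p]) auto
  then show ?thesis ..
qed

lemma alphas_central:
  assumes "a \<in> alphas T D" "w \<in> carrier (W_inv T D)"
  shows "a \<otimes>\<^bsub>alg D\<^esub> w = w \<otimes>\<^bsub>alg D\<^esub> a"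
proof -
  have "\<forall>a\<in>alphas T D. \<forall>w\<in>carrier (W_inv T D). a \<otimes>\<^bsub>alg D\<^esub> w = w \<otimes>\<^bsub>alg D\<^esub> a"
    using skein unfolding parabolic_skein_torus_def by (elim conjE) assumption
  with assms show ?thesis by blast
qed

section \<open>The character and the right ideal of thread relations\<close>

lemma chi_scal: "chi D (scal D c) = c"
proof -
  have "\<forall>c. chi D (scal D c) = c"
    using skein unfolding parabolic_skein_torus_def by (elim conjE) assumption
  then show ?thesis by blast
qed

text \<open>\<open>chi D\<close> is known to be multiplicative and additive on
  \<open>W_mon T D\<close>, which contains the algebra of thread monodromies.\<close>

lemma chi_thr:
  assumes "c \<in> thr" "d \<in> thr"
  shows "chi D (c \<otimes>\<^bsub>alg D\<^esub> d) = chi D c * chi D d" "chi D (c \<oplus>\<^bsub>alg D\<^esub> d) = chi D c + chi D d"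
proof -
  have "subring (laurent_subalgebra D (alphas T D \<union> thread_mons T D)) (alg D)"
    by (intro laurent_subalgebra_W) blast
  then have "thr \<subseteq> carrier (W_mon T D)"
    unfolding thr_eq by (intro laurent_subalgebra_least) (auto simp: W_mon_def intro: laurent_subalgebra_incl)
  with assms have cd: "c \<in> carrier (W_mon T D)" "d \<in> carrier (W_mon T D)" by auto
  have "chi D \<in> ring_hom (W_mon T D) coeff_ring"
    using skein unfolding parabolic_skein_torus_def by (elim conjE) assumption
  from ring_hom_mult [OF this cd] ring_hom_add [OF this cd]
  show "chi D (c \<otimes>\<^bsub>alg D\<^esub> d) = chi D c * chi D d" "chi D (c \<oplus>\<^bsub>alg D\<^esub> d) = chi D c + chi D d"
    by (simp_all add: W_mon_def ring_of_type_algebra_simps)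
qed

lemma chi_uminus: "c \<in> thr \<Longrightarrow> chi D (\<ominus>\<^bsub>alg D\<^esub> c) = - chi D c"
  using chi_thr(2) [of c "\<ominus>\<^bsub>alg D\<^esub> c"] subringE [OF thr_subring] chi_scal [of 0]
  by (simp add: A.r_neg scal_zero subset_iff eq_neg_iff_add_eq_0 add.commute)

lemma scal_uminus: "scal D (- c) = \<ominus>\<^bsub>alg D\<^esub> scal D c"
  by (rule A.minus_equality [symmetric]) (simp_all add: scal_add [symmetric] scal_zero)

lemma specialise_closed:
  "m \<in> carrier (W_inv T D) \<Longrightarrow> specialise D m \<in> carrier (W_inv T D)"
  unfolding specialise_def by (intro W_closed W_inv_generators(1))

lemma mon_specialise_closed:
  "specialise D ` (alphas T D \<union> thread_mons T D) \<subseteq> carrier (W_inv T D)"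
  using specialise_closed W_inv_generators(2) by blast

lemma I_thr_additive: "additive_subgroup (I_thr T D) (W_inv T D)"
  unfolding I_thr_def by (rule W.additive_gen_right_ideal [OF mon_specialise_closed])

lemma I_thr_right: "x \<in> I_thr T D \<Longrightarrow> w \<in> carrier (W_inv T D) \<Longrightarrow> x \<otimes>\<^bsub>alg D\<^esub> w \<in> I_thr T D"
  using W.gen_right_ideal_mult_closed [OF mon_specialise_closed] by (simp add: I_thr_def W_inv_sel)

lemma I_thr_gen:
  "m \<in> alphas T D \<union> thread_mons T D \<Longrightarrow> w \<in> carrier (W_inv T D) \<Longrightarrow>
    specialise D m \<otimes>\<^bsub>alg D\<^esub> w \<in> I_thr T D"
  using W.gen_right_ideal_incl [of "specialise D m" "specialise D ` (alphas T D \<union> thread_mons T D)" w]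
  by (simp add: I_thr_def W_inv_sel)

text \<open>The tensor product over \<open>W_thr T D\<close> specialises every \<open>c\<close> in
  that algebra, whereas \<open>I_thr T D\<close> is generated by the monodromies alone. The
  induction bridges the gap using closure under right multiplication, with scalars moved to the
  right by centrality.\<close>

lemma specialise_thr:
  assumes "c \<in> thr"
  shows "specialise D c \<in> I_thr T D"
  using assms unfolding thr_eq laurent_subalgebra_def
proof (induction rule: generate_ring.induct)
  note zero = W_subgroup(2) [OF I_thr_additive]
  have scal0: "specialise D (scal D a) \<in> I_thr T D" for a
    using zero by (simp add: specialise_def chi_scal A.r_neg a_minus_def)
  {
    case one
    then show ?case using scal0 [of 1] by (simp add: scal_one)
  next
    case (incl c)
    then consider "c \<in> range (scal D)" | "c \<in> thread_mons T D"
      | r where "r \<in> thread_mons T D" "c = inv\<^bsub>alg D\<^esub> r" by blast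
    then show ?case
    proof cases
      case 1
      then show ?thesis using scal0 by blast
    next
      case 2
      then have "specialise D c \<otimes>\<^bsub>alg D\<^esub> \<one>\<^bsub>alg D\<^esub> \<in> I_thr T D"
        by (intro I_thr_gen W_closed) simp
      then show ?thesis
        using 2 W_carrier [OF specialise_closed [OF W_inv_generators(2)], of c] by simp
    next
      case 3
      have r: "r \<in> Units (alg D)" and rW: "r \<in> carrier (W_inv T D)" "c \<in> carrier (W_inv T D)"
        using 3 thread_mons_Units W_inv_generators(2,3) by auto
      have rA: "r \<in> carrier (alg D)" "c \<in> carrier (alg D)" using rW W_carrier by auto
      have rthr: "r \<in> thr" "c \<in> thr"
        unfolding thr_eq 3(2) using 3(1) by (auto intro: laurent_subalgebra_incl)
      have "chi D r * chi D c = 1"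
        using chi_thr(1) [OF rthr] r chi_scal [of 1] 3(2) by (simp add: scal_one)
      then have x: "chi D r \<noteq> 0" "chi D c = inverse (chi D r)"
        by (auto simp: inverse_unique)
      \<comment> \<open>With \<open>x\<close> the value of \<open>chi D\<close> at \<open>r\<close>,
        this is minus the product of the inverses of \<open>x\<close> and \<open>r\<close>;
        multiplying \<open>r - x\<close> by it gives the difference of the inverses of
        \<open>r\<close> and \<open>x\<close>.\<close>
      let ?v = "scal D (- inverse (chi D r)) \<otimes>\<^bsub>alg D\<^esub> c"
      have "specialise D r \<otimes>\<^bsub>alg D\<^esub> ?v = r \<otimes>\<^bsub>alg D\<^esub> ?v \<ominus>\<^bsub>alg D\<^esub> scal D (chi D r) \<otimes>\<^bsub>alg D\<^esub> ?v"
        using rA by (simp add: specialise_def A.l_minus_distr)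
      also have "scal D (chi D r) \<otimes>\<^bsub>alg D\<^esub> ?v = scal D (- 1) \<otimes>\<^bsub>alg D\<^esub> c"
        using rA x by (simp add: A.m_assoc [symmetric] scal_mult [symmetric])
      also have "r \<otimes>\<^bsub>alg D\<^esub> ?v = (scal D (- inverse (chi D r)) \<otimes>\<^bsub>alg D\<^esub> r) \<otimes>\<^bsub>alg D\<^esub> c"
        unfolding scal_central [OF rA(1)] using rA by (simp add: A.m_assoc)
      also have "\<dots> = scal D (- inverse (chi D r))"
        using rA r by (simp add: A.m_assoc 3(2))
      finally have "specialise D c = specialise D r \<otimes>\<^bsub>alg D\<^esub> ?v"
        using rA by (simp add: specialise_def x(2) a_minus_def scal_uminus scal_one A.l_minus A.a_comm)
      moreover have "specialise D r \<otimes>\<^bsub>alg D\<^esub> ?v \<in> I_thr T D"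
        using 3 rW by (intro I_thr_gen W_closed(3) W_inv_generators(1)) auto
      ultimately show ?thesis by simp
    qed
  next
    case (a_inv c)
    then have c: "c \<in> thr" by (simp add: thr_eq laurent_subalgebra_def)
    have "specialise D (\<ominus>\<^bsub>alg D\<^esub> c) = \<ominus>\<^bsub>alg D\<^esub> specialise D c"
      using W_carrier [OF thr_W [OF c]]
      by (simp add: specialise_def chi_uminus [OF c] scal_uminus a_minus_def A.minus_add)
    then show ?case
      using W_subgroup(4) [OF I_thr_additive] a_inv by simp
  next
    case (eng_add c d)
    then have cd: "c \<in> thr" "d \<in> thr" by (simp_all add: thr_eq laurent_subalgebra_def)
    have "specialise D (c \<oplus>\<^bsub>alg D\<^esub> d) = specialise D c \<oplus>\<^bsub>alg D\<^esub> specialise D d"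
      using cd [THEN thr_W, THEN W_carrier]
      by (simp add: specialise_def chi_thr [OF cd] scal_add a_minus_def A.minus_add A.a_ac)
    then show ?case
      using W_subgroup(3) [OF I_thr_additive] eng_add by simp
  next
    case (eng_mult c d)
    then have cd: "c \<in> thr" "d \<in> thr" by (simp_all add: thr_eq laurent_subalgebra_def)
    note cdA = cd [THEN thr_W, THEN W_carrier]
    let ?x = "scal D (chi D c)" and ?y = "scal D (chi D d)"
    \<comment> \<open>Telescoping through the product of the value of \<open>c\<close> with
      \<open>d\<close>; each half becomes a right multiple of a specialised factor.\<close>
    have "specialise D (c \<otimes>\<^bsub>alg D\<^esub> d) =
        (c \<otimes>\<^bsub>alg D\<^esub> d \<ominus>\<^bsub>alg D\<^esub> ?x \<otimes>\<^bsub>alg D\<^esub> d) \<oplus>\<^bsub>alg D\<^esub> (?x \<otimes>\<^bsub>alg D\<^esub> d \<ominus>\<^bsub>alg D\<^esub> ?x \<otimes>\<^bsub>alg D\<^esub> ?y)"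
      using cdA by (simp add: A.minus_add_minus specialise_def chi_thr [OF cd] scal_mult)
    also have "?x \<otimes>\<^bsub>alg D\<^esub> d \<ominus>\<^bsub>alg D\<^esub> ?x \<otimes>\<^bsub>alg D\<^esub> ?y = specialise D d \<otimes>\<^bsub>alg D\<^esub> ?x"
      using cdA by (simp add: specialise_def A.l_minus_distr scal_central [of _ "chi D c"])
    also have "c \<otimes>\<^bsub>alg D\<^esub> d \<ominus>\<^bsub>alg D\<^esub> ?x \<otimes>\<^bsub>alg D\<^esub> d = specialise D c \<otimes>\<^bsub>alg D\<^esub> d"
      using cdA by (simp add: specialise_def A.l_minus_distr)
    finally show ?case
      using W_subgroup(3) [OF I_thr_additive] I_thr_right eng_mult cd thr_W W_inv_generators(1) by simp
  }
qed

section \<open>The left ideal of module relations and the joint ideal\<close>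

lemma bulk_module_gens_closed: "bulk_rels T D \<union> specialise D ` alphas T D \<subseteq> carrier (W_inv T D)"
  using bulk_rels_closed mon_specialise_closed by blast

lemma bulk_module_additive: "additive_subgroup (bulk_module_rels T D) (W_inv T D)"
  unfolding bulk_module_rels_def by (rule W.additive_gen_left_ideal [OF bulk_module_gens_closed])

lemma bulk_module_left:
  "w \<in> carrier (W_inv T D) \<Longrightarrow> x \<in> bulk_module_rels T D \<Longrightarrow> w \<otimes>\<^bsub>alg D\<^esub> x \<in> bulk_module_rels T D"
  using W.gen_left_ideal_mult_closed [OF bulk_module_gens_closed]
  by (simp add: bulk_module_rels_def W_inv_sel)

lemma I_bulk_additive: "additive_subgroup (I_bulk T D) (W_inv T D)"
  unfolding I_bulk_def by (rule W.additive_gen_left_ideal [OF bulk_rels_closed])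

lemma I_bulk_left:
  "w \<in> carrier (W_inv T D) \<Longrightarrow> x \<in> I_bulk T D \<Longrightarrow> w \<otimes>\<^bsub>alg D\<^esub> x \<in> I_bulk T D"
  using W.gen_left_ideal_mult_closed [OF bulk_rels_closed] by (simp add: I_bulk_def W_inv_sel)

lemma I_bulk_bulk_module: "I_bulk T D \<subseteq> bulk_module_rels T D"
  unfolding I_bulk_def
  using bulk_module_additive W.gen_left_ideal_incl [of _ _ "bulk_rels T D \<union> specialise D ` alphas T D"]
  by (intro W.gen_left_ideal_least) (auto simp: bulk_module_rels_def)

abbreviation "joint \<equiv> I_thr T D <+>\<^bsub>W_inv T D\<^esub> I_bulk T D"

lemma joint_additive: "additive_subgroup joint (W_inv T D)"
  by (rule W.add_additive_subgroups [OF I_thr_additive I_bulk_additive])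

lemma joint_iff: "z \<in> joint \<longleftrightarrow> (\<exists>x\<in>I_thr T D. \<exists>y\<in>I_bulk T D. z = x \<oplus>\<^bsub>alg D\<^esub> y)"
  by (auto simp: set_add_def' W_inv_sel)

lemma I_thr_joint: "x \<in> I_thr T D \<Longrightarrow> x \<in> joint"
  unfolding joint_iff
  using W_subgroup [OF I_bulk_additive] W_subgroup [OF I_thr_additive] W_carrier
  by (intro bexI [of _ x] bexI [of _ "\<zero>\<^bsub>alg D\<^esub>"]) auto

lemma I_bulk_joint: "x \<in> I_bulk T D \<Longrightarrow> x \<in> joint"
  unfolding joint_iff
  using W_subgroup [OF I_bulk_additive] W_subgroup [OF I_thr_additive] W_carrier
  by (intro bexI [of _ x] bexI [of _ "\<zero>\<^bsub>alg D\<^esub>"]) auto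

lemma specialise_alpha_central:
  assumes "a \<in> alphas T D" "w \<in> carrier (W_inv T D)"
  shows "specialise D a \<otimes>\<^bsub>alg D\<^esub> w = w \<otimes>\<^bsub>alg D\<^esub> specialise D a"
proof -
  have "a \<in> carrier (alg D)" "w \<in> carrier (alg D)"
    using assms W_inv_generators(2) W_carrier by auto
  then show ?thesis
    using assms by (simp add: specialise_def A.l_minus_distr A.r_minus_distr alphas_central [OF assms] scal_central)
qed

text \<open>By centrality, a left multiple of a specialised puncture monodromy is also a right
  multiple, so it falls into \<open>I_thr T D\<close>.\<close>

lemma bulk_module_joint: "bulk_module_rels T D \<subseteq> joint"
  unfolding bulk_module_rels_def
proof (rule W.gen_left_ideal_least [OF joint_additive])
  fix w s assume w: "w \<in> carrier (W_inv T D)" and "s \<in> bulk_rels T D \<union> specialise D ` alphas T D"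
  then consider "s \<in> bulk_rels T D" | a where "a \<in> alphas T D" "s = specialise D a" by blast
  then show "w \<otimes>\<^bsub>W_inv T D\<^esub> s \<in> joint"
  proof cases
    case 1
    then show ?thesis
      using W.gen_left_ideal_incl [OF w] by (intro I_bulk_joint) (simp add: I_bulk_def)
  next
    case 2
    then show ?thesis
      using I_thr_gen [of a w] w by (intro I_thr_joint) (simp add: W_inv_sel specialise_alpha_central)
  qed
qed

lemma bdry_specialise_commute:
  assumes p: "p \<in> bdry" and m: "m \<in> alphas T D \<union> thread_mons T D"
  shows "p \<otimes>\<^bsub>alg D\<^esub> specialise D m = specialise D m \<otimes>\<^bsub>alg D\<^esub> p"
proof -
  have "p \<otimes>\<^bsub>alg D\<^esub> m = m \<otimes>\<^bsub>alg D\<^esub> p"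
    using m alphas_central [OF _ bdry_W [OF p]] bdry_thr_commute [OF p] laurent_subalgebra_incl
    unfolding thr_eq by fastforce
  moreover have "p \<in> carrier (alg D)" "m \<in> carrier (alg D)"
    using p m bdry_W W_inv_generators(2) W_carrier by auto
  ultimately show ?thesis
    by (simp add: specialise_def A.l_minus_distr A.r_minus_distr scal_central)
qed

text \<open>The right ideal brings no closure under left multiplication. Elements of the boundary
  torus have it because they commute with each generator \<open>s\<close>: then \<open>p\<close>
  times \<open>s w\<close> is \<open>s\<close> times \<open>p w\<close>.\<close>

lemma joint_bdry_left:
  assumes p: "p \<in> bdry" and x: "x \<in> joint"
  shows "p \<otimes>\<^bsub>alg D\<^esub> x \<in> joint"
proof -
  let ?P = "{x \<in> carrier (W_inv T D). p \<otimes>\<^bsub>W_inv T D\<^esub> x \<in> I_thr T D}"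
  have "gen_right_ideal (W_inv T D) (specialise D ` (alphas T D \<union> thread_mons T D)) \<subseteq> ?P"
  proof (rule W.gen_right_ideal_least)
    show "additive_subgroup ?P (W_inv T D)"
      using bdry_W [OF p] by (intro W.additive_vimage [OF I_thr_additive]) (auto simp: W.r_distr)
    fix w s assume w: "w \<in> carrier (W_inv T D)" and "s \<in> specialise D ` (alphas T D \<union> thread_mons T D)"
    then obtain m where m: "m \<in> alphas T D \<union> thread_mons T D" and s: "s = specialise D m" by blast
    have car: "p \<in> carrier (alg D)" "w \<in> carrier (alg D)" "s \<in> carrier (alg D)"
      using p w m s bdry_W W_carrier specialise_closed [OF W_inv_generators(2)] by auto
    have "p \<otimes>\<^bsub>alg D\<^esub> (s \<otimes>\<^bsub>alg D\<^esub> w) = s \<otimes>\<^bsub>alg D\<^esub> (p \<otimes>\<^bsub>alg D\<^esub> w)"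
      using car bdry_specialise_commute [OF p m]
      by (simp add: s A.m_assoc [symmetric])
    moreover have "s \<otimes>\<^bsub>alg D\<^esub> (p \<otimes>\<^bsub>alg D\<^esub> w) \<in> I_thr T D"
      unfolding s by (intro I_thr_gen m W_closed(3) w bdry_W [OF p])
    moreover have "s \<otimes>\<^bsub>alg D\<^esub> w \<in> carrier (W_inv T D)"
      using s m w specialise_closed [OF W_inv_generators(2)] by (intro W_closed) auto
    ultimately show "s \<otimes>\<^bsub>W_inv T D\<^esub> w \<in> ?P"
      by (simp add: W_inv_sel)
  qed
  then have "I_thr T D \<subseteq> ?P"
    unfolding I_thr_def .
  then have I: "p \<otimes>\<^bsub>alg D\<^esub> y \<in> I_thr T D" if "y \<in> I_thr T D" for y
    using that by (auto simp: W_inv_sel)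
  from x obtain y z where yz: "y \<in> I_thr T D" "z \<in> I_bulk T D" "x = y \<oplus>\<^bsub>alg D\<^esub> z"
    unfolding joint_iff by blast
  have car: "p \<in> carrier (alg D)" "y \<in> carrier (alg D)" "z \<in> carrier (alg D)"
    using yz p bdry_W W_subgroup(1) [OF I_thr_additive] W_subgroup(1) [OF I_bulk_additive] W_carrier by blast+
  show ?thesis
    unfolding joint_iff
    using I yz I_bulk_left [OF bdry_W [OF p]] car by (metis A.r_distr)
qed

end


section \<open>The localised skein module\<close>

context skein_torus
begin

sublocale thr_tensor: tensor_product "W_thr T D" skmod_thr "thr_act D" "add_monoid (W_inv T D)"
  "monoid.mult (alg D)"
proof -
  interpret A: comm_group skmod_thr
    unfolding skmod_thr_def
    by (rule abelian_group.a_comm_group [OF ring.is_abelian_group [OF ring_from_type_algebra]])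
  interpret B: comm_group "add_monoid (W_inv T D)"
    by (rule W.a_comm_group)
  show "tensor_product (W_thr T D) skmod_thr (thr_act D) (add_monoid (W_inv T D)) (monoid.mult (alg D))"
    by unfold_locales (simp_all add: skmod_thr_def ring_of_type_algebra_simps thr_W W_closed)
qed

text \<open>Not an abbreviation: the simplifier would rewrite the \<open>undefined\<close> extension field inside
  \<open>add_monoid\<close>, so that rules about classes would no longer match.\<close>

definition thr_class :: "(coeff \<times> 'a \<Rightarrow>\<^sub>0 int) \<Rightarrow> (coeff \<times> 'a \<Rightarrow>\<^sub>0 int) set" where
  "thr_class = tensor_class (W_thr T D) skmod_thr (thr_act D) (add_monoid (W_inv T D)) (monoid.mult (alg D))"

definition thr_null :: "(coeff \<times> 'a \<Rightarrow>\<^sub>0 int) set" where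
  "thr_null = tensor_null (W_thr T D) skmod_thr (thr_act D) (add_monoid (W_inv T D)) (monoid.mult (alg D))"

abbreviation "thr_pairs \<equiv> (UNIV :: coeff set) \<times> carrier (W_inv T D)"

lemma thr_pairs_eq: "carrier skmod_thr \<times> carrier (add_monoid (W_inv T D)) = thr_pairs"
  by (simp add: skmod_thr_def ring_of_type_algebra_simps)

lemma skmod_thr_sel: "x \<otimes>\<^bsub>skmod_thr\<^esub> y = x + y" "carrier skmod_thr = UNIV"
  by (simp_all add: skmod_thr_def ring_of_type_algebra_simps)

section \<open>The skein module of the bulk as a quotient of \<open>W_inv T D\<close>\<close>

lemma bulk_class_eq: "bulk_class T D w = {j \<oplus>\<^bsub>alg D\<^esub> w | j. j \<in> bulk_module_rels T D}"
  by (auto simp: bulk_class_def a_r_coset_def' W_inv_sel)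

lemma bulk_class_eq_iff:
  assumes "w \<in> carrier (W_inv T D)" "w' \<in> carrier (W_inv T D)"
  shows "bulk_class T D w = bulk_class T D w' \<longleftrightarrow> w \<ominus>\<^bsub>alg D\<^esub> w' \<in> bulk_module_rels T D"
proof
  note J = W_subgroup [OF bulk_module_additive]
  note wA = assms [THEN W_carrier]
  {
    assume "bulk_class T D w = bulk_class T D w'"
    moreover have "w \<in> bulk_class T D w"
      unfolding bulk_class_eq using J(2) wA by force
    ultimately obtain j where j: "j \<in> bulk_module_rels T D" "w = j \<oplus>\<^bsub>alg D\<^esub> w'"
      unfolding bulk_class_eq by blast
    then have "w \<ominus>\<^bsub>alg D\<^esub> w' = j"
      using W_carrier [OF J(1)] wA by (simp add: a_minus_def A.a_assoc A.r_neg)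
    with j show "w \<ominus>\<^bsub>alg D\<^esub> w' \<in> bulk_module_rels T D" by simp
  next
    assume d: "w \<ominus>\<^bsub>alg D\<^esub> w' \<in> bulk_module_rels T D"
    have "j \<oplus>\<^bsub>alg D\<^esub> w = (j \<oplus>\<^bsub>alg D\<^esub> (w \<ominus>\<^bsub>alg D\<^esub> w')) \<oplus>\<^bsub>alg D\<^esub> w'"
      "j \<oplus>\<^bsub>alg D\<^esub> w' = (j \<ominus>\<^bsub>alg D\<^esub> (w \<ominus>\<^bsub>alg D\<^esub> w')) \<oplus>\<^bsub>alg D\<^esub> w"
      if "j \<in> bulk_module_rels T D" for j
      using W_carrier [OF J(1) [OF that]] wA
      by (simp_all add: a_minus_def A.a_assoc A.l_neg A.minus_add A.a_comm [of w' w] A.r_neg1)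
    then show "bulk_class T D w = bulk_class T D w'"
      unfolding bulk_class_eq using J(3) [OF _ d] J(5) [OF _ d] by blast
  }
qed

lemma bulk_class_zero: "bulk_class T D \<zero>\<^bsub>alg D\<^esub> = bulk_module_rels T D"
  unfolding bulk_class_eq using W_carrier [OF W_subgroup(1) [OF bulk_module_additive]] by force

lemma bulk_module_subgroup: "subgroup (bulk_module_rels T D) (add_monoid (W_inv T D))"
  using bulk_module_additive by (simp add: additive_subgroup_def)

lemma skmod_bulk_comm_group: "comm_group (skmod_bulk T D)"
  unfolding skmod_bulk_def
  by (rule comm_group.abelian_FactGroup [OF W.a_comm_group bulk_module_subgroup])

lemma skmod_bulk_carrier: "carrier (skmod_bulk T D) = bulk_class T D ` carrier (W_inv T D)"
  by (simp add: skmod_bulk_def carrier_FactGroup bulk_class_def [abs_def] a_r_coset_def)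

lemma skmod_bulk_one: "\<one>\<^bsub>skmod_bulk T D\<^esub> = bulk_class T D \<zero>\<^bsub>alg D\<^esub>"
  by (simp add: skmod_bulk_def bulk_class_zero)

lemma skmod_bulk_mult:
  assumes "w \<in> carrier (W_inv T D)" "w' \<in> carrier (W_inv T D)"
  shows "bulk_class T D w \<otimes>\<^bsub>skmod_bulk T D\<^esub> bulk_class T D w' = bulk_class T D (w \<oplus>\<^bsub>alg D\<^esub> w')"
proof -
  have "bulk_module_rels T D \<lhd> add_monoid (W_inv T D)"
    by (rule comm_group.subgroup_imp_normal [OF W.a_comm_group bulk_module_subgroup])
  from normal.rcos_sum [OF this, of w w'] assms show ?thesis
    by (simp add: skmod_bulk_def bulk_class_def a_r_coset_def W_inv_sel)
qed

text \<open>The action is a union over representatives; it is a single coset because the relations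
  form a left ideal.\<close>

lemma bulk_act_class:
  assumes "w \<in> carrier (W_inv T D)" "x \<in> carrier (W_inv T D)"
  shows "bulk_act T D w (bulk_class T D x) = bulk_class T D (w \<otimes>\<^bsub>alg D\<^esub> x)"
proof -
  note J = W_subgroup [OF bulk_module_additive]
  have const: "bulk_class T D (w \<otimes>\<^bsub>alg D\<^esub> y) = bulk_class T D (w \<otimes>\<^bsub>alg D\<^esub> x)"
    if y: "y \<in> bulk_class T D x" for y
  proof -
    from y obtain j where j: "j \<in> bulk_module_rels T D" "y = j \<oplus>\<^bsub>alg D\<^esub> x"
      unfolding bulk_class_eq by blast
    have car: "j \<in> carrier (alg D)" "w \<in> carrier (alg D)" "x \<in> carrier (alg D)"
      using assms J(1) [OF j(1)] W_carrier by auto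
    have "w \<otimes>\<^bsub>alg D\<^esub> y \<ominus>\<^bsub>alg D\<^esub> w \<otimes>\<^bsub>alg D\<^esub> x = w \<otimes>\<^bsub>alg D\<^esub> j"
      using car by (simp add: j(2) a_minus_def A.r_distr A.a_assoc A.r_neg)
    moreover have "y \<in> carrier (W_inv T D)"
      using W_closed(4) [OF J(1) [OF j(1)] assms(2)] by (simp add: j(2))
    ultimately show ?thesis
      using bulk_module_left [OF assms(1) j(1)] assms by (simp add: bulk_class_eq_iff W_closed)
  qed
  have "x \<in> bulk_class T D x"
    unfolding bulk_class_eq using J(2) W_carrier [OF assms(2)] by force
  then show ?thesis
    unfolding bulk_act_def using const by (intro UN_constant_eq ballI)
qed

section \<open>The inner and the outer tensor product\<close>

abbreviation "frag_map f \<equiv> frag_extend (\<lambda>(a :: coeff, b :: 'a). frag_of (a, f b))"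

lemma keys_frag_map:
  assumes "f \<in> carrier (W_inv T D) \<rightarrow> carrier (W_inv T D)" "Poly_Mapping.keys x \<subseteq> thr_pairs"
  shows "Poly_Mapping.keys (frag_map f x) \<subseteq> thr_pairs"
  using thr_tensor.keys_frag_map [of id f x] assms unfolding thr_pairs_eq by simp

lemma thr_tensor_map_class:
  assumes "\<And>w. w \<in> carrier (W_inv T D) \<Longrightarrow> f w \<in> carrier (W_inv T D)"
    and "\<And>w w'. w \<in> carrier (W_inv T D) \<Longrightarrow> w' \<in> carrier (W_inv T D) \<Longrightarrow>
      f (w \<oplus>\<^bsub>alg D\<^esub> w') = f w \<oplus>\<^bsub>alg D\<^esub> f w'"
    and "\<And>c w. c \<in> thr \<Longrightarrow> w \<in> carrier (W_inv T D) \<Longrightarrow>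
      f (c \<otimes>\<^bsub>alg D\<^esub> w) = c \<otimes>\<^bsub>alg D\<^esub> f w"
  shows "thr_tensor_map T D f (thr_class x) = thr_class (frag_map f x)"
  unfolding thr_tensor_map_def thr_class_def
  using thr_tensor.tensor_map_class [of id f x] assms by (simp add: hom_def Pi_iff W_inv_sel)

lemma thr_tensor_ract_class:
  assumes "w \<in> carrier (W_inv T D)"
  shows "thr_tensor_ract T D (thr_class x) w = thr_class (frag_map (\<lambda>y. y \<otimes>\<^bsub>alg D\<^esub> w) x)"
  unfolding thr_tensor_ract_def
  using assms by (intro thr_tensor_map_class) (auto simp: W_closed W_carrier thr_W A.l_distr A.m_assoc)

lemma thr_tensor_carrier: "carrier (thr_tensor T D) = thr_class ` {x. Poly_Mapping.keys x \<subseteq> thr_pairs}"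
  unfolding thr_class_def using thr_tensor.tensor_carrier by (simp add: thr_tensor_def skmod_thr_sel)

lemma thr_tensor_mult:
  "Poly_Mapping.keys x \<subseteq> thr_pairs \<Longrightarrow> Poly_Mapping.keys y \<subseteq> thr_pairs \<Longrightarrow>
    thr_class x \<otimes>\<^bsub>thr_tensor T D\<^esub> thr_class y = thr_class (x + y)"
  unfolding thr_class_def using thr_tensor.class_add [of x y] by (simp add: thr_tensor_def skmod_thr_sel)

lemma thr_tensor_comm_group: "comm_group (thr_tensor T D)"
  unfolding thr_tensor_def by (rule thr_tensor.tensor_comm_group)

lemma right_mult_closed:
  "w \<in> carrier (W_inv T D) \<Longrightarrow> (\<lambda>y. y \<otimes>\<^bsub>alg D\<^esub> w) \<in> carrier (W_inv T D) \<rightarrow> carrier (W_inv T D)"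
  by (auto intro: W_closed)

sublocale loc: tensor_product "W_inv T D" "thr_tensor T D" "thr_tensor_ract T D" "skmod_bulk T D" "bulk_act T D"
proof -
  interpret A: comm_group "thr_tensor T D" by (rule thr_tensor_comm_group)
  interpret B: comm_group "skmod_bulk T D" by (rule skmod_bulk_comm_group)
  show "tensor_product (W_inv T D) (thr_tensor T D) (thr_tensor_ract T D) (skmod_bulk T D) (bulk_act T D)"
  proof unfold_locales
    fix Z w assume "Z \<in> carrier (thr_tensor T D)" "w \<in> carrier (W_inv T D)"
    then show "thr_tensor_ract T D Z w \<in> carrier (thr_tensor T D)"
      using keys_frag_map [OF right_mult_closed] by (auto simp: thr_tensor_carrier thr_tensor_ract_class)
  next
    fix w Z assume "w \<in> carrier (W_inv T D)" "Z \<in> carrier (skmod_bulk T D)"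
    then show "bulk_act T D w Z \<in> carrier (skmod_bulk T D)"
      by (auto simp: skmod_bulk_carrier bulk_act_class W_closed)
  qed
qed

abbreviation "loc_null \<equiv> tensor_null (W_inv T D) (thr_tensor T D) (thr_tensor_ract T D) (skmod_bulk T D) (bulk_act T D)"
abbreviation "loc_class \<equiv> tensor_class (W_inv T D) (thr_tensor T D) (thr_tensor_ract T D) (skmod_bulk T D) (bulk_act T D)"

text \<open>The symbol for \<open>(1 \<otimes> w) \<otimes> [1]\<close>, before passing to its
  class. The element \<open>w\<close> sits in the middle factor, where insertion acts; for
  \<open>w\<close> the unit this gives the empty skein.\<close>

definition skein_of :: "'a \<Rightarrow> (coeff \<times> 'a \<Rightarrow>\<^sub>0 int) set \<times> 'a set" where
  "skein_of w = (thr_class (frag_of (1, w)), bulk_class T D \<one>\<^bsub>alg D\<^esub>)"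

lemma frag_of_thr_class:
  "w \<in> carrier (W_inv T D) \<Longrightarrow> thr_class (frag_of (c, w)) \<in> carrier (thr_tensor T D)"
  by (simp add: thr_tensor_carrier)

text \<open>Insertion is a \<open>tensor_map\<close> inside a \<open>tensor_map\<close>. The inner
  one is well defined as \<open>p\<close> commutes with thread monodromies, the outer one as left
  multiplication by \<open>p\<close> commutes with the right action.\<close>

lemma insert_empty_skein:
  assumes p: "p \<in> bdry"
  shows "insert_skein T D p (empty_skein T D) = loc_class (frag_of (skein_of p))"
proof -
  note pW = bdry_W [OF p]
  let ?f = "\<lambda>x. p \<otimes>\<^bsub>alg D\<^esub> x"
  have f: "thr_tensor_map T D ?f (thr_class x) = thr_class (frag_map ?f x)" for x
  proof (rule thr_tensor_map_class)
    fix c w assume c: "c \<in> thr" and w: "w \<in> carrier (W_inv T D)"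
    have car: "p \<in> carrier (alg D)" "c \<in> carrier (alg D)" "w \<in> carrier (alg D)"
      using pW thr_W [OF c] w W_carrier by auto
    show "p \<otimes>\<^bsub>alg D\<^esub> (c \<otimes>\<^bsub>alg D\<^esub> w) = c \<otimes>\<^bsub>alg D\<^esub> (p \<otimes>\<^bsub>alg D\<^esub> w)"
      using car bdry_thr_commute [OF p c] by (simp add: A.m_assoc [symmetric])
  qed (auto simp: pW W_closed W_carrier A.r_distr)
  have fW: "?f \<in> carrier (W_inv T D) \<rightarrow> carrier (W_inv T D)"
    using pW by (auto intro: W_closed)
  \<comment> \<open>On symbols this is associativity; both sides are additive in
    \<open>x\<close>.\<close>
  have comm: "frag_map ?f (frag_map (\<lambda>y. y \<otimes>\<^bsub>alg D\<^esub> w) x) =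
      frag_map (\<lambda>y. y \<otimes>\<^bsub>alg D\<^esub> w) (frag_map ?f x)"
    if "Poly_Mapping.keys x \<subseteq> thr_pairs" "w \<in> carrier (W_inv T D)" for x w
  proof (induction x rule: free_Abelian_group_induct)
    fix u assume "u \<in> thr_pairs"
    then show "frag_map ?f (frag_map (\<lambda>y. y \<otimes>\<^bsub>alg D\<^esub> w) (frag_of u)) =
        frag_map (\<lambda>y. y \<otimes>\<^bsub>alg D\<^esub> w) (frag_map ?f (frag_of u))"
      using that(2) pW by (auto simp: A.m_assoc W_carrier)
  qed (use that(1) in \<open>simp_all add: frag_extend_diff\<close>)
  have hom: "thr_tensor_map T D ?f \<in> hom (thr_tensor T D) (thr_tensor T D)"
  proof (rule homI)
    fix Z assume "Z \<in> carrier (thr_tensor T D)"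
    then show "thr_tensor_map T D ?f Z \<in> carrier (thr_tensor T D)"
      using keys_frag_map [OF fW] by (auto simp: thr_tensor_carrier f)
  next
    fix Z Z' assume "Z \<in> carrier (thr_tensor T D)" "Z' \<in> carrier (thr_tensor T D)"
    then show "thr_tensor_map T D ?f (Z \<otimes>\<^bsub>thr_tensor T D\<^esub> Z') =
        thr_tensor_map T D ?f Z \<otimes>\<^bsub>thr_tensor T D\<^esub> thr_tensor_map T D ?f Z'"
      using keys_frag_map [OF fW] by (auto simp: thr_tensor_carrier f thr_tensor_mult frag_extend_add)
  qed
  have ract: "thr_tensor_map T D ?f (thr_tensor_ract T D Z w) = thr_tensor_ract T D (thr_tensor_map T D ?f Z) w"
    if "Z \<in> carrier (thr_tensor T D)" "w \<in> carrier (W_inv T D)" for Z w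
  proof -
    from that(1) obtain x where "Poly_Mapping.keys x \<subseteq> thr_pairs" "Z = thr_class x"
      unfolding thr_tensor_carrier by blast
    then show ?thesis
      by (simp only: f thr_tensor_ract_class [OF that(2)] comm [OF _ that(2)])
  qed
  have "tensor_map (W_inv T D) (thr_tensor T D) (thr_tensor_ract T D) (skmod_bulk T D) (bulk_act T D)
      (thr_tensor_map T D ?f) id (loc_class x) =
    loc_class (frag_extend (\<lambda>(a, b). frag_of (thr_tensor_map T D ?f a, id b)) x)" for x
    by (rule loc.tensor_map_class [OF hom _ ract]) (simp_all add: hom_def)
  then show ?thesis
    unfolding insert_skein_def empty_skein_def thr_class_def [symmetric] skein_of_def
    using W_carrier [OF pW] by (simp only: frag_extend_of split f id_apply A.r_one)
qed

lemma localised_A_ideal_iff: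
  "p \<in> localised_A_ideal T D \<longleftrightarrow> p \<in> bdry \<and> frag_of (skein_of p) \<in> loc_null"
  unfolding localised_A_ideal_def mem_Collect_eq
  by (rule conj_cong [OF refl]) (simp only: insert_empty_skein SkMod_loc_def loc.class_eq_one_iff)

end


section \<open>The annihilator of the empty skein\<close>

context skein_torus
begin

lemma W_additiveI:
  assumes "N \<subseteq> carrier (W_inv T D)" "\<zero>\<^bsub>alg D\<^esub> \<in> N"
    and "\<And>x y. x \<in> N \<Longrightarrow> y \<in> N \<Longrightarrow> x \<oplus>\<^bsub>alg D\<^esub> y \<in> N" "\<And>x. x \<in> N \<Longrightarrow> \<ominus>\<^bsub>alg D\<^esub> x \<in> N"
  shows "additive_subgroup N (W_inv T D)"
  unfolding additive_subgroup_def
proof (rule W.add.subgroupI)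
  show "\<ominus>\<^bsub>W_inv T D\<^esub> x \<in> N" if "x \<in> N" for x
    using that assms(1,4) W_a_inv [of x] by (auto simp: subset_iff)
qed (use assms in \<open>auto simp: W_inv_sel\<close>)

text \<open>Additivity passes through both levels: the inner relator gives an equality of classes,
  which turns the statement into an outer relator.\<close>

lemma skein_of_add:
  assumes "w \<in> carrier (W_inv T D)" "w' \<in> carrier (W_inv T D)"
  shows "frag_of (skein_of (w \<oplus>\<^bsub>alg D\<^esub> w')) - frag_of (skein_of w) - frag_of (skein_of w') \<in> loc_null"
proof -
  have "frag_of (1, w \<oplus>\<^bsub>alg D\<^esub> w') - frag_of (1, w) - frag_of (1, w') \<in> thr_null"
    using thr_tensor.null_add_right [of 1 w w'] assms
    by (simp add: thr_null_def skmod_thr_sel W_inv_sel)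
  then have "thr_class (frag_of (1, w \<oplus>\<^bsub>alg D\<^esub> w')) = thr_class (frag_of (1, w) + frag_of (1, w'))"
    unfolding thr_class_def thr_null_def thr_tensor.class_eq_iff by (simp only: diff_diff_eq)
  also have "\<dots> = thr_class (frag_of (1, w)) \<otimes>\<^bsub>thr_tensor T D\<^esub> thr_class (frag_of (1, w'))"
    using assms by (intro thr_tensor_mult [symmetric]) simp_all
  finally show ?thesis
    unfolding skein_of_def
    by (simp only:) (intro loc.null_add_left frag_of_thr_class assms, simp add: skmod_bulk_carrier W_closed)
qed

text \<open>The kernel of the additive map from \<open>W_inv T D\<close> sending \<open>w\<close> to
  the class of \<open>(1 \<otimes> w) \<otimes> [1]\<close>. It is taken on all of
  \<open>W_inv T D\<close> because the ideals to be compared with it live there.\<close>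

definition "null_skeins = {w \<in> carrier (W_inv T D). frag_of (skein_of w) \<in> loc_null}"

lemma null_skeins_additive: "additive_subgroup null_skeins (W_inv T D)"
proof (rule W_additiveI)
  have zero: "frag_of (skein_of \<zero>\<^bsub>alg D\<^esub>) \<in> loc_null"
    using loc.null_minus [OF skein_of_add [of "\<zero>\<^bsub>alg D\<^esub>" "\<zero>\<^bsub>alg D\<^esub>"]] by (simp add: W_closed)
  then show "\<zero>\<^bsub>alg D\<^esub> \<in> null_skeins"
    by (simp add: null_skeins_def W_closed)
  show "x \<oplus>\<^bsub>alg D\<^esub> y \<in> null_skeins" if "x \<in> null_skeins" "y \<in> null_skeins" for x y
    using loc.null_add [OF loc.null_add [OF skein_of_add [of x y]], of "frag_of (skein_of y)" "frag_of (skein_of x)"] that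
    by (simp add: null_skeins_def W_closed)
  show "\<ominus>\<^bsub>alg D\<^esub> x \<in> null_skeins" if "x \<in> null_skeins" for x
  proof -
    have x: "x \<in> carrier (W_inv T D)" "frag_of (skein_of x) \<in> loc_null"
      using that by (simp_all add: null_skeins_def)
    have "frag_of (skein_of \<zero>\<^bsub>alg D\<^esub>) - frag_of (skein_of x) - frag_of (skein_of (\<ominus>\<^bsub>alg D\<^esub> x)) \<in> loc_null"
      using skein_of_add [of x "\<ominus>\<^bsub>alg D\<^esub> x"] x W_carrier by (simp add: W_closed A.r_neg)
    from loc.null_diff [OF loc.null_diff [OF zero x(2)] this] show ?thesis
      using x by (simp add: null_skeins_def W_closed)
  qed
qed (auto simp: null_skeins_def)

text \<open>Balancing moves \<open>w\<close> to the right: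
  \<open>(1 \<otimes> w) \<otimes> [1]\<close> equals \<open>(1 \<otimes> 1) \<otimes> [w]\<close>,
  and the class of \<open>w\<close> is zero.\<close>

lemma bulk_module_null: "bulk_module_rels T D \<subseteq> null_skeins"
proof
  fix w assume w: "w \<in> bulk_module_rels T D"
  then have wW: "w \<in> carrier (W_inv T D)"
    by (rule W_subgroup(1) [OF bulk_module_additive])
  have one: "\<one>\<^bsub>alg D\<^esub> \<in> carrier (W_inv T D)" "\<zero>\<^bsub>alg D\<^esub> \<in> carrier (W_inv T D)"
    by (rule W_closed)+
  have act: "bulk_act T D w (bulk_class T D \<one>\<^bsub>alg D\<^esub>) = \<one>\<^bsub>skmod_bulk T D\<^esub>"
    using bulk_class_eq_iff [OF wW one(2)] w W_carrier [OF wW]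
    by (simp add: bulk_act_class wW one skmod_bulk_one a_minus_def)
  have ract: "thr_tensor_ract T D (thr_class (frag_of (1, \<one>\<^bsub>alg D\<^esub>))) w = thr_class (frag_of (1, w))"
    using W_carrier [OF wW] by (simp add: thr_tensor_ract_class wW)
  have "frag_of (thr_class (frag_of (1, w)), bulk_class T D \<one>\<^bsub>alg D\<^esub>) -
      frag_of (thr_class (frag_of (1, \<one>\<^bsub>alg D\<^esub>)), \<one>\<^bsub>skmod_bulk T D\<^esub>) \<in> loc_null"
    unfolding act [symmetric] ract [symmetric]
    by (rule loc.null_balanced) (use one wW frag_of_thr_class skmod_bulk_carrier in auto)
  moreover have "frag_of (thr_class (frag_of (1, \<one>\<^bsub>alg D\<^esub>)), \<one>\<^bsub>skmod_bulk T D\<^esub>) \<in> loc_null"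
    by (rule loc.null_one_right [OF frag_of_thr_class [OF one(1)]])
  ultimately have "frag_of (skein_of w) \<in> loc_null"
    unfolding skein_of_def using loc.null_add by fastforce
  then show "w \<in> null_skeins"
    by (simp add: null_skeins_def wW)
qed

lemmas thr_null_diff = thr_tensor.null_diff [folded thr_null_def]

text \<open>Both \<open>c\<close> and the scalar \<open>scal D (chi D c)\<close> lie in
  \<open>W_thr T D\<close> and have the same character value, so balancing identifies
  \<open>1 \<otimes> c w\<close> with the corresponding scalar multiple.\<close>

lemma specialise_thr_null:
  assumes c: "c \<in> thr" and w: "w \<in> carrier (W_inv T D)"
  shows "frag_of (1, specialise D c \<otimes>\<^bsub>alg D\<^esub> w) \<in> thr_null"
proof -
  let ?y = "scal D (chi D c)"
  have car: "c \<in> carrier (alg D)" "w \<in> carrier (alg D)"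
    using thr_W [OF c] w W_carrier by auto
  have bal: "frag_of (chi D d, w) - frag_of (1, d \<otimes>\<^bsub>alg D\<^esub> w) \<in> thr_null" if "d \<in> thr" for d
    using thr_tensor.null_balanced [of 1 d w] that w
    by (simp add: thr_null_def skmod_thr_sel thr_act_def)
  have "frag_of (1, c \<otimes>\<^bsub>alg D\<^esub> w) - frag_of (1, ?y \<otimes>\<^bsub>alg D\<^esub> w) \<in> thr_null"
    using thr_null_diff [OF bal [OF scal_thr [of "chi D c"]] bal [OF c]] by (simp add: chi_scal)
  moreover have "frag_of (1, c \<otimes>\<^bsub>alg D\<^esub> w) - frag_of (1, specialise D c \<otimes>\<^bsub>alg D\<^esub> w) -
      frag_of (1, ?y \<otimes>\<^bsub>alg D\<^esub> w) \<in> thr_null"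
  proof -
    have "specialise D c \<otimes>\<^bsub>alg D\<^esub> w \<oplus>\<^bsub>alg D\<^esub> ?y \<otimes>\<^bsub>alg D\<^esub> w = c \<otimes>\<^bsub>alg D\<^esub> w"
      using car by (simp add: specialise_def a_minus_def A.l_distr A.l_minus A.a_assoc A.l_neg)
    then show ?thesis
      using thr_tensor.null_add_right [of 1 "specialise D c \<otimes>\<^bsub>alg D\<^esub> w" "?y \<otimes>\<^bsub>alg D\<^esub> w"] c w
      by (simp add: thr_null_def skmod_thr_sel W_inv_sel W_closed thr_W specialise_closed W_inv_generators(1))
  qed
  ultimately show ?thesis
    using thr_null_diff by fastforce
qed

text \<open>The two kinds of generators die in different factors: puncture relations are moved to
  the right by centrality and vanish in the bulk module, thread relations vanish already in the
  inner tensor product.\<close>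

lemma I_thr_null: "I_thr T D \<subseteq> null_skeins"
  unfolding I_thr_def
proof (rule W.gen_right_ideal_least [OF null_skeins_additive])
  fix w s assume w: "w \<in> carrier (W_inv T D)" and "s \<in> specialise D ` (alphas T D \<union> thread_mons T D)"
  then consider a where "a \<in> alphas T D" "s = specialise D a"
    | r where "r \<in> thread_mons T D" "s = specialise D r" by blast
  then show "s \<otimes>\<^bsub>W_inv T D\<^esub> w \<in> null_skeins"
  proof cases
    case 1
    then have "s \<otimes>\<^bsub>alg D\<^esub> w = w \<otimes>\<^bsub>W_inv T D\<^esub> s"
      using specialise_alpha_central w by (simp add: W_inv_sel)
    moreover have "w \<otimes>\<^bsub>W_inv T D\<^esub> s \<in> bulk_module_rels T D"
      unfolding bulk_module_rels_def using 1 w by (intro W.gen_left_ideal_incl) auto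
    ultimately show ?thesis
      using bulk_module_null by (auto simp: W_inv_sel)
  next
    case 2
    then have r: "r \<in> thr"
      unfolding thr_eq by (intro laurent_subalgebra_incl)
    let ?x = "specialise D r \<otimes>\<^bsub>alg D\<^esub> w"
    have "thr_class (frag_of (1, ?x)) = \<one>\<^bsub>thr_tensor T D\<^esub>"
      using specialise_thr_null [OF r w] unfolding thr_class_def thr_tensor_def thr_null_def
      by (simp only: thr_tensor.class_eq_one_iff)
    then have "frag_of (skein_of ?x) \<in> loc_null"
      unfolding skein_of_def using loc.null_one_left skmod_bulk_carrier W_closed(1) by simp
    then show ?thesis
      using 2 w r by (simp add: null_skeins_def W_inv_sel W_closed thr_W specialise_closed)
  qed
qed

lemma joint_null: "joint \<subseteq> null_skeins"
proof
  fix w assume "w \<in> joint"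
  then obtain x y where "x \<in> I_thr T D" "y \<in> I_bulk T D" "w = x \<oplus>\<^bsub>alg D\<^esub> y"
    unfolding joint_iff by blast
  then show "w \<in> null_skeins"
    using I_thr_null I_bulk_bulk_module bulk_module_null W_subgroup(3) [OF null_skeins_additive] by blast
qed

section \<open>The converse: from the double tensor product back to \<open>W_inv T D\<close>\<close>

lemma frag_hom:
  assumes f: "f \<in> hom (free_Abelian_group S) (add_monoid (W_inv T D))"
    and x: "Poly_Mapping.keys x \<subseteq> S" and y: "Poly_Mapping.keys y \<subseteq> S"
  shows "f x \<in> carrier (W_inv T D)" "f (x + y) = f x \<oplus>\<^bsub>alg D\<^esub> f y" "f (x - y) = f x \<ominus>\<^bsub>alg D\<^esub> f y"
proof -
  have closed: "f z \<in> carrier (W_inv T D)" if "Poly_Mapping.keys z \<subseteq> S" for z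
    using hom_in_carrier [OF f, of z] that by simp
  have add: "f (z + y) = f z \<oplus>\<^bsub>alg D\<^esub> f y" if "Poly_Mapping.keys z \<subseteq> S" for z
    using hom_mult [OF f, of z y] that y by (simp add: W_inv_sel)
  show "f x \<in> carrier (W_inv T D)" "f (x + y) = f x \<oplus>\<^bsub>alg D\<^esub> f y"
    by (rule closed [OF x], rule add [OF x])
  have xy: "Poly_Mapping.keys (x - y) \<subseteq> S"
    using x y keys_diff [of x y] by blast
  have "f x = f (x - y) \<oplus>\<^bsub>alg D\<^esub> f y"
    using add [OF xy] by simp
  then show "f (x - y) = f x \<ominus>\<^bsub>alg D\<^esub> f y"
    using closed [OF xy] closed [OF y] W_carrier by (simp add: a_minus_def A.a_assoc A.r_neg)
qed

lemma frag_hom3: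
  assumes f: "f \<in> hom (free_Abelian_group S) (add_monoid (W_inv T D))"
    and "u \<in> S" "v \<in> S" "w \<in> S"
  shows "f (frag_of u - frag_of v - frag_of w) = f (frag_of u) \<ominus>\<^bsub>alg D\<^esub> f (frag_of v) \<ominus>\<^bsub>alg D\<^esub> f (frag_of w)"
proof -
  have "Poly_Mapping.keys (frag_of u - frag_of v) \<subseteq> S"
    using keys_diff [of "frag_of u" "frag_of v"] assms by auto
  then show ?thesis
    using assms by (simp add: frag_hom(3) [OF f])
qed

text \<open>The inverse map \<open>(c \<otimes> w) \<otimes> [y] \<mapsto> c w y\<close> into \<open>W\<^sub>i\<^sub>n\<^sub>v\<close> modulo \<^const>\<open>I_thr\<close> plus
  the bulk relations is built on representatives: \<open>f\<close> multiplies out the first tensor product,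
  \<open>rep\<close> and \<open>brep\<close> choose representatives of classes, and \<open>k\<close> extends their product additively.\<close>

lemma null_joint:
  assumes p: "p \<in> carrier (W_inv T D)" and null: "frag_of (skein_of p) \<in> loc_null"
  shows "p \<in> joint"
proof -
  let ?W = "carrier (W_inv T D)"
  have "(\<lambda>(c, w). scal D c \<otimes>\<^bsub>alg D\<^esub> w) ` thr_pairs \<subseteq> carrier (add_monoid (W_inv T D))"
    by (auto simp: W_closed W_inv_generators(1))
  from comm_group.free_Abelian_group_universal [OF W.a_comm_group this]
  obtain f where f: "f \<in> hom (free_Abelian_group thr_pairs) (add_monoid (W_inv T D))"
    and "\<And>u. u \<in> thr_pairs \<Longrightarrow> f (frag_of u) = (case u of (c, w) \<Rightarrow> scal D c \<otimes>\<^bsub>alg D\<^esub> w)"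
    by blast
  then have f_of: "f (frag_of (c, w)) = scal D c \<otimes>\<^bsub>alg D\<^esub> w" if "w \<in> ?W" for c w
    using that by force
  note fW = frag_hom(1) [OF f] and fadd = frag_hom(2) [OF f] and fdiff = frag_hom(3) [OF f]
  have f3: "f (frag_of u - frag_of v - frag_of w) = f (frag_of u) \<ominus>\<^bsub>alg D\<^esub> f (frag_of v) \<ominus>\<^bsub>alg D\<^esub> f (frag_of w)"
    if "u \<in> thr_pairs" "v \<in> thr_pairs" "w \<in> thr_pairs" for u v w
    using that by (rule frag_hom3 [OF f])
  \<comment> \<open>The additivity relators go to zero; a balancing relator goes to a multiple of a
    specialised element of \<open>W_thr T D\<close>.\<close>
  have fnull: "f n \<in> I_thr T D" if n: "n \<in> thr_null" for n
  proof (rule thr_tensor.null_least [OF _ _ _ _ _ _ n [unfolded thr_null_def]])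
    show "group (add_monoid (W_inv T D))" by (rule W.add.group_axioms)
    show "f \<in> hom (free_Abelian_group (carrier skmod_thr \<times> carrier (add_monoid (W_inv T D)))) (add_monoid (W_inv T D))"
      unfolding thr_pairs_eq by (rule f)
    show "subgroup (I_thr T D) (add_monoid (W_inv T D))"
      using I_thr_additive by (simp add: additive_subgroup_def)
  next
    fix c d :: coeff and w assume "w \<in> carrier (add_monoid (W_inv T D))"
    then have w: "w \<in> ?W" by simp
    have "f (frag_of (c + d, w) - frag_of (c, w) - frag_of (d, w)) =
        scal D (c + d) \<otimes>\<^bsub>alg D\<^esub> w \<ominus>\<^bsub>alg D\<^esub> scal D c \<otimes>\<^bsub>alg D\<^esub> w \<ominus>\<^bsub>alg D\<^esub> scal D d \<otimes>\<^bsub>alg D\<^esub> w"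
      using w by (simp add: f3 f_of)
    also have "\<dots> = \<zero>\<^bsub>alg D\<^esub>"
      using W_carrier [OF w] by (simp add: scal_add A.l_distr A.add_minus_minus)
    finally have "f (frag_of (c + d, w) - frag_of (c, w) - frag_of (d, w)) = \<zero>\<^bsub>alg D\<^esub>" .
    then show "f (frag_of (c \<otimes>\<^bsub>skmod_thr\<^esub> d, w) - frag_of (c, w) - frag_of (d, w)) \<in> I_thr T D"
      using W_subgroup(2) [OF I_thr_additive] by (simp add: skmod_thr_sel)
  next
    fix c :: coeff and w w' assume "w \<in> carrier (add_monoid (W_inv T D))" "w' \<in> carrier (add_monoid (W_inv T D))"
    then have w: "w \<in> ?W" "w' \<in> ?W" by simp_all
    have "f (frag_of (c, w \<oplus>\<^bsub>alg D\<^esub> w') - frag_of (c, w) - frag_of (c, w')) =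
        scal D c \<otimes>\<^bsub>alg D\<^esub> (w \<oplus>\<^bsub>alg D\<^esub> w') \<ominus>\<^bsub>alg D\<^esub> scal D c \<otimes>\<^bsub>alg D\<^esub> w \<ominus>\<^bsub>alg D\<^esub> scal D c \<otimes>\<^bsub>alg D\<^esub> w'"
      using w by (simp add: f3 f_of W_closed)
    also have "\<dots> = \<zero>\<^bsub>alg D\<^esub>"
      using w [THEN W_carrier] by (simp add: A.r_distr A.add_minus_minus)
    finally have "f (frag_of (c, w \<oplus>\<^bsub>alg D\<^esub> w') - frag_of (c, w) - frag_of (c, w')) = \<zero>\<^bsub>alg D\<^esub>" .
    then show "f (frag_of (c, w \<otimes>\<^bsub>add_monoid (W_inv T D)\<^esub> w') - frag_of (c, w) - frag_of (c, w')) \<in> I_thr T D"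
      using W_subgroup(2) [OF I_thr_additive] by (simp add: W_inv_sel)
  next
    fix c r w assume r: "r \<in> thr" and "w \<in> carrier (add_monoid (W_inv T D))"
    then have w: "w \<in> ?W" by simp
    have car: "r \<in> carrier (alg D)" "w \<in> carrier (alg D)"
      using thr_W [OF r] w W_carrier by auto
    have "f (frag_of (thr_act D c r, w) - frag_of (c, r \<otimes>\<^bsub>alg D\<^esub> w)) =
        scal D (c * chi D r) \<otimes>\<^bsub>alg D\<^esub> w \<ominus>\<^bsub>alg D\<^esub> scal D c \<otimes>\<^bsub>alg D\<^esub> (r \<otimes>\<^bsub>alg D\<^esub> w)"
      using w thr_W [OF r] by (simp add: fdiff f_of W_closed thr_act_def)
    also have "\<dots> = scal D c \<otimes>\<^bsub>alg D\<^esub> (\<ominus>\<^bsub>alg D\<^esub> specialise D r \<otimes>\<^bsub>alg D\<^esub> w)"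
      using car by (simp add: specialise_def a_minus_def scal_mult A.m_assoc A.l_distr A.r_distr
          A.l_minus A.r_minus A.minus_add A.a_comm)
    \<comment> \<open>The scalar is moved past the specialised element, which must stand on the left
      to use the right ideal.\<close>
    also have "\<dots> = (\<ominus>\<^bsub>alg D\<^esub> specialise D r) \<otimes>\<^bsub>alg D\<^esub> (scal D c \<otimes>\<^bsub>alg D\<^esub> w)"
      using car W_carrier [OF specialise_closed [OF thr_W [OF r]]]
      by (simp add: A.m_assoc [symmetric] scal_central [of "\<ominus>\<^bsub>alg D\<^esub> specialise D r"])
    also have "\<dots> \<in> I_thr T D"
      by (intro I_thr_right W_subgroup(4) [OF I_thr_additive] specialise_thr r W_closed(3) W_inv_generators(1) w)
    finally show "f (frag_of (thr_act D c r, w) - frag_of (c, r \<otimes>\<^bsub>alg D\<^esub> w)) \<in> I_thr T D" .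
  qed
  \<comment> \<open>No additivity of the choice is claimed. Representatives of one class differ by
    an element of \<open>thr_null\<close>, so \<open>fnull\<close> confines the ambiguity to
    \<open>I_thr T D\<close>.\<close>
  define rep where "rep Z = f (SOME x. Poly_Mapping.keys x \<subseteq> thr_pairs \<and> Z = thr_class x)" for Z
  define brep where "brep B = (SOME y. y \<in> ?W \<and> B = bulk_class T D y)" for B
  have rep: "rep (thr_class x) \<in> ?W" "rep (thr_class x) \<ominus>\<^bsub>alg D\<^esub> f x \<in> I_thr T D"
    if x: "Poly_Mapping.keys x \<subseteq> thr_pairs" for x
  proof -
    obtain x' where x': "rep (thr_class x) = f x'" "Poly_Mapping.keys x' \<subseteq> thr_pairs" "thr_class x = thr_class x'"
    proof
      show "rep (thr_class x) = f (SOME y. Poly_Mapping.keys y \<subseteq> thr_pairs \<and> thr_class x = thr_class y)"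
        by (fact rep_def)
      have "\<exists>y. Poly_Mapping.keys y \<subseteq> thr_pairs \<and> thr_class x = thr_class y"
        using x by blast
      from someI_ex [OF this]
      show "Poly_Mapping.keys (SOME y. Poly_Mapping.keys y \<subseteq> thr_pairs \<and> thr_class x = thr_class y) \<subseteq> thr_pairs"
        "thr_class x = thr_class (SOME y. Poly_Mapping.keys y \<subseteq> thr_pairs \<and> thr_class x = thr_class y)"
        by (rule conjunct1, rule conjunct2)
    qed
    show "rep (thr_class x) \<in> ?W"
      unfolding x'(1) by (rule fW [OF x'(2,2)])
    have "x' - x \<in> thr_null"
      using x'(3) [symmetric] unfolding thr_class_def thr_null_def thr_tensor.class_eq_iff .
    then show "rep (thr_class x) \<ominus>\<^bsub>alg D\<^esub> f x \<in> I_thr T D"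
      unfolding x'(1) fdiff [OF x'(2) x, symmetric] by (rule fnull)
  qed
  have brep: "brep (bulk_class T D y) \<in> ?W" "brep (bulk_class T D y) \<ominus>\<^bsub>alg D\<^esub> y \<in> bulk_module_rels T D"
    if y: "y \<in> ?W" for y
  proof -
    have "\<exists>z. z \<in> ?W \<and> bulk_class T D y = bulk_class T D z"
      using y by blast
    from someI_ex [OF this, folded brep_def]
    have z: "brep (bulk_class T D y) \<in> ?W" "bulk_class T D (brep (bulk_class T D y)) = bulk_class T D y"
      by simp_all
    show "brep (bulk_class T D y) \<in> ?W" by (fact z(1))
    show "brep (bulk_class T D y) \<ominus>\<^bsub>alg D\<^esub> y \<in> bulk_module_rels T D"
      using z(2) unfolding bulk_class_eq_iff [OF z(1) y] .
  qed
  define g where "g Z B = rep Z \<otimes>\<^bsub>alg D\<^esub> brep B" for Z B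
  have g: "g (thr_class x) (bulk_class T D y) \<in> ?W"
    "g (thr_class x) (bulk_class T D y) \<ominus>\<^bsub>alg D\<^esub> f x \<otimes>\<^bsub>alg D\<^esub> y \<in> joint"
    if x: "Poly_Mapping.keys x \<subseteq> thr_pairs" and y: "y \<in> ?W" for x y
  proof -
    let ?a = "rep (thr_class x)" and ?b = "brep (bulk_class T D y)"
    show "g (thr_class x) (bulk_class T D y) \<in> ?W"
      unfolding g_def using rep(1) [OF x] brep(1) [OF y] by (rule W_closed)
    have car: "?a \<in> carrier (alg D)" "?b \<in> carrier (alg D)" "f x \<in> carrier (alg D)" "y \<in> carrier (alg D)"
      using rep(1) [OF x] brep(1) [OF y] fW [OF x x] y W_carrier by auto
    \<comment> \<open>The error of the left representative is multiplied on the right, that of the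
      right representative on the left, as the sides of the two ideals require.\<close>
    have "g (thr_class x) (bulk_class T D y) \<ominus>\<^bsub>alg D\<^esub> f x \<otimes>\<^bsub>alg D\<^esub> y =
        (?a \<ominus>\<^bsub>alg D\<^esub> f x) \<otimes>\<^bsub>alg D\<^esub> ?b \<oplus>\<^bsub>alg D\<^esub> f x \<otimes>\<^bsub>alg D\<^esub> (?b \<ominus>\<^bsub>alg D\<^esub> y)"
      using car by (simp add: g_def A.l_minus_distr A.r_minus_distr A.minus_add_minus)
    moreover have "(?a \<ominus>\<^bsub>alg D\<^esub> f x) \<otimes>\<^bsub>alg D\<^esub> ?b \<in> joint"
      by (intro I_thr_joint I_thr_right rep(2) brep(1) x y)
    moreover have "f x \<otimes>\<^bsub>alg D\<^esub> (?b \<ominus>\<^bsub>alg D\<^esub> y) \<in> joint"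
      using bulk_module_joint bulk_module_left [OF fW [OF x x] brep(2) [OF y]] by blast
    ultimately show "g (thr_class x) (bulk_class T D y) \<ominus>\<^bsub>alg D\<^esub> f x \<otimes>\<^bsub>alg D\<^esub> y \<in> joint"
      using W_subgroup(3) [OF joint_additive] by simp
  qed
  let ?pairs = "carrier (thr_tensor T D) \<times> carrier (skmod_bulk T D)"
  have "(\<lambda>(Z, B). g Z B) ` ?pairs \<subseteq> carrier (add_monoid (W_inv T D))"
    using g(1) by (auto simp: thr_tensor_carrier skmod_bulk_carrier)
  from comm_group.free_Abelian_group_universal [OF W.a_comm_group this]
  obtain k where k: "k \<in> hom (free_Abelian_group ?pairs) (add_monoid (W_inv T D))"
    and "\<And>u. u \<in> ?pairs \<Longrightarrow> k (frag_of u) = (case u of (Z, B) \<Rightarrow> g Z B)"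
    by blast
  then have k_of: "k (frag_of (thr_class x, bulk_class T D y)) = g (thr_class x) (bulk_class T D y)"
    if "Poly_Mapping.keys x \<subseteq> thr_pairs" "y \<in> ?W" for x y
    using that by (auto simp: thr_tensor_carrier skmod_bulk_carrier)
  have k3: "k (frag_of u - frag_of v - frag_of w) = k (frag_of u) \<ominus>\<^bsub>alg D\<^esub> k (frag_of v) \<ominus>\<^bsub>alg D\<^esub> k (frag_of w)"
    if "u \<in> ?pairs" "v \<in> ?pairs" "w \<in> ?pairs" for u v w
    using that by (rule frag_hom3 [OF k])
  \<comment> \<open>Prepares the outer balancing relators: by associativity it holds on symbols, and
    both sides are additive.\<close>
  have f_right: "f (frag_map (\<lambda>v. v \<otimes>\<^bsub>alg D\<^esub> w) x) = f x \<otimes>\<^bsub>alg D\<^esub> w"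
    if w: "w \<in> ?W" and x: "Poly_Mapping.keys x \<subseteq> thr_pairs" for w x
  proof (rule free_Abelian_group_induct [OF x])
    show "f (frag_map (\<lambda>v. v \<otimes>\<^bsub>alg D\<^esub> w) 0) = f 0 \<otimes>\<^bsub>alg D\<^esub> w"
      using fdiff [of 0 0] fW [of 0 0] w W_carrier by (simp add: a_minus_def A.r_neg)
  next
    fix u assume "u \<in> thr_pairs"
    then show "f (frag_map (\<lambda>v. v \<otimes>\<^bsub>alg D\<^esub> w) (frag_of u)) = f (frag_of u) \<otimes>\<^bsub>alg D\<^esub> w"
      using w by (auto simp: f_of W_closed W_carrier A.m_assoc)
  next
    fix a b assume ab: "Poly_Mapping.keys a \<subseteq> thr_pairs" "Poly_Mapping.keys b \<subseteq> thr_pairs"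
      and "f (frag_map (\<lambda>v. v \<otimes>\<^bsub>alg D\<^esub> w) a) = f a \<otimes>\<^bsub>alg D\<^esub> w"
        "f (frag_map (\<lambda>v. v \<otimes>\<^bsub>alg D\<^esub> w) b) = f b \<otimes>\<^bsub>alg D\<^esub> w"
    then show "f (frag_map (\<lambda>v. v \<otimes>\<^bsub>alg D\<^esub> w) (a - b)) = f (a - b) \<otimes>\<^bsub>alg D\<^esub> w"
      using fW [OF ab] fW [OF ab(2,1)] w W_carrier
      by (simp add: frag_extend_diff fdiff [OF ab] A.l_minus_distr
          fdiff [OF keys_frag_map [OF right_mult_closed [OF w] ab(1)] keys_frag_map [OF right_mult_closed [OF w] ab(2)]])
  qed
  have joint3: "a \<ominus>\<^bsub>alg D\<^esub> b \<ominus>\<^bsub>alg D\<^esub> c \<in> joint"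
    if "a \<in> ?W" "b \<in> ?W" "c \<in> ?W" "y \<in> ?W" "z \<in> ?W"
      "a \<ominus>\<^bsub>alg D\<^esub> (y \<oplus>\<^bsub>alg D\<^esub> z) \<in> joint" "b \<ominus>\<^bsub>alg D\<^esub> y \<in> joint" "c \<ominus>\<^bsub>alg D\<^esub> z \<in> joint" for a b c y z
    using A.minus_minus_minus [of a b c y z] W_subgroup(5) [OF joint_additive W_subgroup(5) [OF joint_additive that(6,7)] that(8)]
      that(1-5) W_carrier by simp
  have "k n \<in> joint" if n: "n \<in> loc_null" for n
  proof (rule loc.null_least [OF _ k _ _ _ _ n])
    show "group (add_monoid (W_inv T D))" by (rule W.add.group_axioms)
    show "subgroup joint (add_monoid (W_inv T D))"
      using joint_additive by (simp add: additive_subgroup_def)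
  next
    fix Z Z' B
    assume Z: "Z \<in> carrier (thr_tensor T D)" "Z' \<in> carrier (thr_tensor T D)" and B: "B \<in> carrier (skmod_bulk T D)"
    then obtain x x' y where x: "Poly_Mapping.keys x \<subseteq> thr_pairs" "Z = thr_class x"
      and x': "Poly_Mapping.keys x' \<subseteq> thr_pairs" "Z' = thr_class x'" and y: "y \<in> ?W" "B = bulk_class T D y"
      unfolding thr_tensor_carrier skmod_bulk_carrier by blast
    have xx: "Poly_Mapping.keys (x + x') \<subseteq> thr_pairs"
      using x(1) x'(1) keys_add [of x x'] by blast
    have "k (frag_of (Z \<otimes>\<^bsub>thr_tensor T D\<^esub> Z', B) - frag_of (Z, B) - frag_of (Z', B)) =
        g (thr_class (x + x')) B \<ominus>\<^bsub>alg D\<^esub> g Z B \<ominus>\<^bsub>alg D\<^esub> g Z' B"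
      using Z B loc.A.m_closed [OF Z] k_of [OF xx y(1)] k_of [OF x(1) y(1)] k_of [OF x'(1) y(1)]
      by (simp add: k3 x(2) x'(2) y(2) thr_tensor_mult [OF x(1) x'(1)])
    moreover have "f (x + x') \<otimes>\<^bsub>alg D\<^esub> y = f x \<otimes>\<^bsub>alg D\<^esub> y \<oplus>\<^bsub>alg D\<^esub> f x' \<otimes>\<^bsub>alg D\<^esub> y"
      using fadd [OF x(1) x'(1)] fW [OF x(1) x(1)] fW [OF x'(1) x'(1)] y W_carrier by (simp add: A.l_distr)
    ultimately show "k (frag_of (Z \<otimes>\<^bsub>thr_tensor T D\<^esub> Z', B) - frag_of (Z, B) - frag_of (Z', B)) \<in> joint"
      using joint3 [OF g(1) [OF xx y(1)] g(1) [OF x(1) y(1)] g(1) [OF x'(1) y(1)] _ _ _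
          g(2) [OF x(1) y(1)] g(2) [OF x'(1) y(1)]] g(2) [OF xx y(1)]
        fW [OF x(1) x(1)] fW [OF x'(1) x'(1)] x(2) x'(2) y by (simp add: W_closed)
  next
    fix Z B B'
    assume Z: "Z \<in> carrier (thr_tensor T D)" and B: "B \<in> carrier (skmod_bulk T D)" "B' \<in> carrier (skmod_bulk T D)"
    then obtain x y y' where x: "Poly_Mapping.keys x \<subseteq> thr_pairs" "Z = thr_class x"
      and y: "y \<in> ?W" "B = bulk_class T D y" and y': "y' \<in> ?W" "B' = bulk_class T D y'"
      unfolding thr_tensor_carrier skmod_bulk_carrier by blast
    have yy: "y \<oplus>\<^bsub>alg D\<^esub> y' \<in> ?W"
      by (rule W_closed(4) [OF y(1) y'(1)])
    have "k (frag_of (Z, B \<otimes>\<^bsub>skmod_bulk T D\<^esub> B') - frag_of (Z, B) - frag_of (Z, B')) =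
        g Z (bulk_class T D (y \<oplus>\<^bsub>alg D\<^esub> y')) \<ominus>\<^bsub>alg D\<^esub> g Z B \<ominus>\<^bsub>alg D\<^esub> g Z B'"
      using Z B loc.B.m_closed [OF B] k_of [OF x(1) yy] k_of [OF x(1) y(1)] k_of [OF x(1) y'(1)]
      by (simp add: k3 x(2) y(2) y'(2) skmod_bulk_mult [OF y(1) y'(1)])
    moreover have "f x \<otimes>\<^bsub>alg D\<^esub> (y \<oplus>\<^bsub>alg D\<^esub> y') = f x \<otimes>\<^bsub>alg D\<^esub> y \<oplus>\<^bsub>alg D\<^esub> f x \<otimes>\<^bsub>alg D\<^esub> y'"
      using fW [OF x(1) x(1)] y y' W_carrier by (simp add: A.r_distr)
    ultimately show "k (frag_of (Z, B \<otimes>\<^bsub>skmod_bulk T D\<^esub> B') - frag_of (Z, B) - frag_of (Z, B')) \<in> joint"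
      using joint3 [OF g(1) [OF x(1) yy] g(1) [OF x(1) y(1)] g(1) [OF x(1) y'(1)] _ _ _
          g(2) [OF x(1) y(1)] g(2) [OF x(1) y'(1)]] g(2) [OF x(1) yy]
        fW [OF x(1) x(1)] x(2) y y' by (simp add: W_closed)
  next
    fix Z w B
    assume Z: "Z \<in> carrier (thr_tensor T D)" and w: "w \<in> ?W" and B: "B \<in> carrier (skmod_bulk T D)"
    then obtain x y where x: "Poly_Mapping.keys x \<subseteq> thr_pairs" "Z = thr_class x"
      and y: "y \<in> ?W" "B = bulk_class T D y"
      unfolding thr_tensor_carrier skmod_bulk_carrier by blast
    let ?x = "frag_map (\<lambda>v. v \<otimes>\<^bsub>alg D\<^esub> w) x"
    have xw: "Poly_Mapping.keys ?x \<subseteq> thr_pairs"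
      by (rule keys_frag_map [OF right_mult_closed [OF w] x(1)])
    have wy: "w \<otimes>\<^bsub>alg D\<^esub> y \<in> ?W"
      by (rule W_closed(3) [OF w y(1)])
    let ?u = "g (thr_class ?x) B" and ?v = "g Z (bulk_class T D (w \<otimes>\<^bsub>alg D\<^esub> y))"
    have "f ?x = f x \<otimes>\<^bsub>alg D\<^esub> w"
      by (rule f_right [OF w x(1)])
    then have "f ?x \<otimes>\<^bsub>alg D\<^esub> y = f x \<otimes>\<^bsub>alg D\<^esub> (w \<otimes>\<^bsub>alg D\<^esub> y)"
      using fW [OF x(1) x(1)] w y W_carrier by (simp add: A.m_assoc)
    \<comment> \<open>Both \<open>?u\<close> and \<open>?v\<close> are congruent to the same triple
      product, once bracketed from each side.\<close>
    then have "(?u \<ominus>\<^bsub>alg D\<^esub> f x \<otimes>\<^bsub>alg D\<^esub> (w \<otimes>\<^bsub>alg D\<^esub> y)) \<ominus>\<^bsub>alg D\<^esub>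
        (?v \<ominus>\<^bsub>alg D\<^esub> f x \<otimes>\<^bsub>alg D\<^esub> (w \<otimes>\<^bsub>alg D\<^esub> y)) \<in> joint"
      using W_subgroup(5) [OF joint_additive] g(2) [OF xw y(1)] g(2) [OF x(1) wy] x(2) y(2) by simp
    moreover have "(?u \<ominus>\<^bsub>alg D\<^esub> f x \<otimes>\<^bsub>alg D\<^esub> (w \<otimes>\<^bsub>alg D\<^esub> y)) \<ominus>\<^bsub>alg D\<^esub>
        (?v \<ominus>\<^bsub>alg D\<^esub> f x \<otimes>\<^bsub>alg D\<^esub> (w \<otimes>\<^bsub>alg D\<^esub> y)) = ?u \<ominus>\<^bsub>alg D\<^esub> ?v"
      using g(1) [OF xw y(1)] g(1) [OF x(1) wy] fW [OF x(1) x(1)] wy x(2) y(2)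
      by (intro A.minus_minus_cancel) (simp_all add: W_carrier)
    moreover have "k (frag_of (thr_tensor_ract T D Z w, B) - frag_of (Z, bulk_act T D w B)) = ?u \<ominus>\<^bsub>alg D\<^esub> ?v"
      using loc.ra_closed [OF Z w] loc.lb_closed [OF w B] Z B k_of [OF xw y(1)] k_of [OF x(1) wy]
      by (simp add: frag_hom(3) [OF k] x(2) y(2) thr_tensor_ract_class [OF w] bulk_act_class [OF w y(1)])
    ultimately show "k (frag_of (thr_tensor_ract T D Z w, B) - frag_of (Z, bulk_act T D w B)) \<in> joint"
      by simp
  qed
  \<comment> \<open>For the symbol of \<open>p\<close> the triple product is \<open>p\<close>
    itself, so the value of \<open>g\<close> lies in \<open>joint\<close> and is also congruent to
    \<open>p\<close>.\<close>
  from this [OF null] have "g (thr_class (frag_of (1, p))) (bulk_class T D \<one>\<^bsub>alg D\<^esub>) \<in> joint"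
    using k_of [of "frag_of (1, p)" "\<one>\<^bsub>alg D\<^esub>"] p by (simp add: skein_of_def W_closed)
  moreover have "g (thr_class (frag_of (1, p))) (bulk_class T D \<one>\<^bsub>alg D\<^esub>) \<ominus>\<^bsub>alg D\<^esub> p \<in> joint"
    using g(2) [of "frag_of (1, p)" "\<one>\<^bsub>alg D\<^esub>"] p W_carrier [OF p]
    by (simp add: W_closed f_of scal_one)
  ultimately have "g (thr_class (frag_of (1, p))) (bulk_class T D \<one>\<^bsub>alg D\<^esub>) \<ominus>\<^bsub>alg D\<^esub>
      (g (thr_class (frag_of (1, p))) (bulk_class T D \<one>\<^bsub>alg D\<^esub>) \<ominus>\<^bsub>alg D\<^esub> p) \<in> joint" (is "?u \<ominus>\<^bsub>alg D\<^esub> _ \<in> _")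
    by (rule W_subgroup(5) [OF joint_additive])
  moreover have "?u \<in> carrier (alg D)"
    using g(1) [of "frag_of (1, p)" "\<one>\<^bsub>alg D\<^esub>"] p W_carrier by (simp add: W_closed)
  ultimately show ?thesis
    using W_carrier [OF p] by (simp add: a_minus_def A.minus_add A.r_neg2)
qed

lemma localised_A_ideal_eq: "localised_A_ideal T D = bdry \<inter> joint"
  using joint_null null_joint bdry_W by (auto simp: localised_A_ideal_iff null_skeins_def)

lemma localised_A_ideal_left: "left_ideal (localised_A_ideal T D) (boundary_torus D)"
proof -
  note P = subringE [OF bdry_subring] and N = W_subgroup [OF joint_additive]
  have sel: "monoid.mult (boundary_torus D) = monoid.mult (alg D)"
    "add (boundary_torus D) = add (alg D)" "\<zero>\<^bsub>boundary_torus D\<^esub> = \<zero>\<^bsub>alg D\<^esub>"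
    by (simp_all add: boundary_torus_def)
  interpret P: ring "boundary_torus D"
    using A.subring_is_ring [OF bdry_subring] by (simp add: boundary_torus_def)
  \<comment> \<open>As for \<open>W_inv T D\<close>, the additive inverse depends on the carrier and
    has to be transferred.\<close>
  have inv: "\<ominus>\<^bsub>boundary_torus D\<^esub> x = \<ominus>\<^bsub>alg D\<^esub> x" if "x \<in> bdry" for x
    using that P(5) [of x] subsetD [OF P(1)]
    by (intro P.minus_equality) (simp_all add: sel A.l_neg)
  show ?thesis
    unfolding left_ideal_def localised_A_ideal_eq additive_subgroup_def
  proof (intro conjI ballI P.add.subgroupI)
    show "bdry \<inter> joint \<noteq> {}" using P(2) N(2) by blast
    fix x assume x: "x \<in> bdry \<inter> joint"
    then show "\<ominus>\<^bsub>boundary_torus D\<^esub> x \<in> bdry \<inter> joint"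
      using P(5) N(4) by (simp add: inv)
    show "x \<oplus>\<^bsub>boundary_torus D\<^esub> y \<in> bdry \<inter> joint" if "y \<in> bdry \<inter> joint" for y
      using x that P(7) N(3) by (simp add: sel)
    show "a \<otimes>\<^bsub>boundary_torus D\<^esub> x \<in> bdry \<inter> joint" if "a \<in> bdry" for a
      using x that P(6) joint_bdry_left by (simp add: sel)
  qed auto
qed

end

theorem theorem1p6:
  fixes K :: "(real^4) set"
    and T :: triangulation
    and h :: "nat \<times> (real^4) \<Rightarrow> real^4"
    and D :: "'a skein_data"
  assumes "knot K"
    and "ideal_triangulation K T h"
    and "parabolic_skein_torus K T h D"
  shows "left_ideal (localised_A_ideal T D) (boundary_torus D) \<and>
    localised_A_ideal T D =
      carrier (boundary_torus D) \<inter> (I_thr T D <+>\<^bsub>W_inv T D\<^esub> I_bulk T D)"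
proof -
  interpret skein_torus K T h D
    using assms(2,3) by unfold_locales
  show ?thesis
    using localised_A_ideal_left localised_A_ideal_eq by blast
qed

end
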